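(* Let $\mathcal{B}$ be a bicategory, let $\mathcal{L},\mathcal{R}\colon\mathcal{B}^{\mathrm{op}}\to\mathbf{Cat}$ be $\mathcal{B}$-indexed categories, and write $\mathbf{Optic}=\mathbf{Optic}_{\mathcal{L},\mathcal{R}}$. Let $\mathcal{D}$ be a category, and let $\iota^{\mathrm{op}}$ be the universal ($\mathbf{Optic}^{\mathrm{op}}$-valued) Tambara representation. Then the functor $$-\circ\iota^{\mathrm{op}}\colon[\mathbf{Optic}^{\mathrm{op}},\mathcal{D}]\to\mathbf{Tamb}_{\mathcal{D}}$$ is an isomorphism of categories.
   Context: For a bicategory $\mathcal{B}$, $\mathcal{B}(A,B)$ denotes the category of 1-morphisms $A\to B$ and 2-morphisms; $\mathcal{B}^{\mathrm{op}}$ reverses 1-morphisms only. A $\mathcal{B}$-indexed category is a pseudofunctor $\mathcal{B}^{\mathrm{op}}\to\mathbf{Cat}$. Write $\mathcal{L}^A=\mathcal{L}(A)$, $\mathcal{R}^A=\mathcal{R}(A)$, $f^*=\mathcal{L}(f)$, $f^{*'}=\mathcal{R}(f)$; the coherence isomorphisms of $\mathcal{L}$ are $\theta_A\colon\mathrm{Id}_{\mathcal{L}^A}\Rightarrow \mathrm{Id}_A^*$, $\theta_{f,g}\colon f^*\circ g^*\Rightarrow (g\circ f)^*$, and analogously $\theta'$ for $\mathcal{R}$. The category $\mathbf{Optic}$ of dependent optics has objects $(X,X')^A$ with $A\in\mathrm{Ob}(\mathcal{B})$, $X\in\mathrm{Ob}(\mathcal{L}^A)$, $X'\in\mathrm{Ob}(\mathcal{R}^A)$,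 and morphisms $(X,X')^A\to(Y,Y')^B$ the elements of the coend $\int^{f\in\mathcal{B}(A,B)}\mathcal{L}^A(X,f^*Y)\times\mathcal{R}^A(f^{*'}Y',X')$ (assumed to exist), i.e. classes $\langle l|r\rangle$ of pairs $l\colon X\to f^*Y$, $r\colon f^{*'}Y'\to X'$ ($f$ is the representative), under the equivalence relation generated by $(\mathcal{L}(m)_Y\circ l,r)\sim(l,r\circ\mathcal{R}(m)_{Y'})$ for $m\colon f\Rightarrow g$, $l\colon X\to f^*Y$, $r\colon g^{*'}Y'\to X'$. Identities are $\langle(\theta_A)_X|(\theta_A'^{-1})_{X'}\rangle$ (representative $\mathrm{Id}_A$) and composition is $\langle l_2|r_2\rangle\circ\langle l_1|r_1\rangle=\langle(\theta_{f,g})_Z\circ f^*(l_2)\circ l_1\,|\,r_1\circ f^{*'}(r_2)\circ(\theta'^{-1}_{f,g})_{Z'}\rangle$ (representative $g\circ f$), where $f,g$ are representatives of $\langle l_1|r_1\rangle,\langle l_2|r_2\rangle$. A $\mathcal{D}$-valued Tambara representation $(P,\zeta)$ consists of a functor $P^A\colon(\mathcal{L}^A)^{\mathrm{op}}\times\mathcal{R}^A\to\mathcal{D}$ for each $A\in\mathrm{Ob}(\mathcal{B})$ and, for each 1-morphism $f\colon A\to B$, a natural transformation $\zeta_f$ with components $(\zeta_f)_{Y,Y'}\colon P^B(Y,Y')\to P^A(f^*Y,f^{*'}Y')$, such that $\zeta_f$ is extranatural in $f$ (for all $m\colon f\Rightarrow g$, $P^A(\mathcal{L}(m)_Y,\mathrm{id})\circ(\zeta_g)_{Y,Y'}=P^A(\mathrm{id},\mathcal{R}(m)_{Y'})\circ(\zeta_f)_{Y,Y'}$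 as maps $P^B(Y,Y')\to P^A(f^*Y,g^{*'}Y')$), and $P^A(\theta_A,\theta_A'^{-1})\circ\zeta_{\mathrm{Id}_A}=\mathrm{id}_{P^A}$, and $P^A(\theta_{f,g},\theta_{f,g}'^{-1})\circ\zeta_{g\circ f}=(\zeta_f)_{g^*(-),g^{*'}(=)}\circ\zeta_g$ for all $f\colon A\to B$, $g\colon B\to C$. A morphism $(P,\zeta)\to(Q,\zeta')$ is a family of natural transformations $\eta^A\colon P^A\Rightarrow Q^A$ with $\eta^A_{f^*(-),f^{*'}(=)}\circ\zeta_f=\zeta'_f\circ\eta^B$ for all $f\colon A\to B$. These form the category $\mathbf{Tamb}_{\mathcal{D}}$. The universal Tambara representation $\iota^{\mathrm{op}}$: $\iota^A\colon\mathcal{L}^A\times(\mathcal{R}^A)^{\mathrm{op}}\to\mathbf{Optic}$ sends $(X,X')$ to $(X,X')^A$ and $(l\colon X_0\to X_1,\ r\colon X_1'\to X_0')$ to $\langle(\theta_A)_{X_1}\circ l\,|\,r\circ(\theta_A'^{-1})_{X_1'}\rangle$ (representative $\mathrm{Id}_A$). The $\mathbf{Optic}^{\mathrm{op}}$-valued Tambara representation $\iota^{\mathrm{op}}$ consists of the opposite functors $(\iota^A)^{\mathrm{op}}$ with natural transformations $\zeta_f$ having components $\langle\mathrm{id}_{f^*Y}|\mathrm{id}_{f^{*'}Y'}\rangle^{\mathrm{op}}$ (representative $f$). The functor $-\circ\iota^{\mathrm{op}}$ sends $F\colon\mathbf{Optic}^{\mathrm{op}}\to\mathcal{D}$ to the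 Tambara representation given by the functors $F\circ(\iota^A)^{\mathrm{op}}$ and natural transformations with components $F(\langle\mathrm{id}_{f^*Y}|\mathrm{id}_{f^{*'}Y'}\rangle)$, and a natural transformation $\mu\colon F\Rightarrow G$ to the family $\mu_{\iota^A(X,X')}$. *)

theory Defs
  imports "HOL-Library.FuncSet"
begin

section \<open>Categories, functors, natural transformations\<close>

text \<open>
  Two functors (or natural transformations) must be equal as soon as they agree on the
  objects and arrows of their source category, since the main theorem asserts an isomorphism,
  not just an equivalence, of categories.  Therefore all maps that belong to a functor or to a
  natural transformation are required to be \<^const>\<open>extensional\<close>.
\<close>

record ('o, 'r) cat =
  Obj :: "'o set"
  Arr :: "'r set"
  Dom :: "'r \<Rightarrow> 'o"
  Cod :: "'r \<Rightarrow> 'o"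
  Ide :: "'o \<Rightarrow> 'r"
  Cmp :: "'r \<Rightarrow> 'r \<Rightarrow> 'r" (infixr "\<cdot>\<index>" 70)

definition hom :: "('o, 'r) cat \<Rightarrow> 'o \<Rightarrow> 'o \<Rightarrow> 'r set" where
  "hom C X Y = {f \<in> Arr C. Dom C f = X \<and> Cod C f = Y}"

locale category =
  fixes C :: "('o, 'r) cat"
  assumes dom_obj: "f \<in> Arr C \<Longrightarrow> Dom C f \<in> Obj C"
    and cod_obj: "f \<in> Arr C \<Longrightarrow> Cod C f \<in> Obj C"
    and ide_hom: "X \<in> Obj C \<Longrightarrow> Ide C X \<in> hom C X X"
    and cmp_hom: "f \<in> hom C X Y \<Longrightarrow> g \<in> hom C Y Z \<Longrightarrow> g \<cdot>\<^bsub>C\<^esub> f \<in> hom C X Z"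
    and ide_left: "f \<in> hom C X Y \<Longrightarrow> Ide C Y \<cdot>\<^bsub>C\<^esub> f = f"
    and ide_right: "f \<in> hom C X Y \<Longrightarrow> f \<cdot>\<^bsub>C\<^esub> Ide C X = f"
    and cmp_assoc: "f \<in> hom C W X \<Longrightarrow> g \<in> hom C X Y \<Longrightarrow> h \<in> hom C Y Z \<Longrightarrow>
      (h \<cdot>\<^bsub>C\<^esub> g) \<cdot>\<^bsub>C\<^esub> f = h \<cdot>\<^bsub>C\<^esub> (g \<cdot>\<^bsub>C\<^esub> f)"

definition inverse_arrows :: "('o, 'r) cat \<Rightarrow> 'r \<Rightarrow> 'r \<Rightarrow> bool" where
  "inverse_arrows C f g \<longleftrightarrow> f \<in> Arr C \<and> g \<in> hom C (Cod C f) (Dom C f) \<and>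
     g \<cdot>\<^bsub>C\<^esub> f = Ide C (Dom C f) \<and> f \<cdot>\<^bsub>C\<^esub> g = Ide C (Cod C f)"

definition iso_arrow :: "('o, 'r) cat \<Rightarrow> 'r \<Rightarrow> bool" where
  "iso_arrow C f \<longleftrightarrow> (\<exists>g. inverse_arrows C f g)"

definition inv_arrow :: "('o, 'r) cat \<Rightarrow> 'r \<Rightarrow> 'r" where
  "inv_arrow C f = (THE g. inverse_arrows C f g)"

definition op_cat :: "('o, 'r) cat \<Rightarrow> ('o, 'r) cat" where
  "op_cat C = \<lparr>Obj = Obj C, Arr = Arr C, Dom = Cod C, Cod = Dom C, Ide = Ide C,
     Cmp = (\<lambda>g f. f \<cdot>\<^bsub>C\<^esub> g)\<rparr>"

definition prod_cat ::
  "('o1, 'r1) cat \<Rightarrow> ('o2, 'r2) cat \<Rightarrow> ('o1 \<times> 'o2, 'r1 \<times> 'r2) cat" where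
  "prod_cat C D = \<lparr>Obj = Obj C \<times> Obj D, Arr = Arr C \<times> Arr D,
     Dom = (\<lambda>(f, f'). (Dom C f, Dom D f')), Cod = (\<lambda>(f, f'). (Cod C f, Cod D f')),
     Ide = (\<lambda>(X, X'). (Ide C X, Ide D X')),
     Cmp = (\<lambda>(g, g') (f, f'). (g \<cdot>\<^bsub>C\<^esub> f, g' \<cdot>\<^bsub>D\<^esub> f'))\<rparr>"

record ('o1, 'r1, 'o2, 'r2) fun_data =
  FOb :: "'o1 \<Rightarrow> 'o2"
  FAr :: "'r1 \<Rightarrow> 'r2"

locale cat_functor = source: category C + target: category D
  for C :: "('o1, 'r1) cat" and D :: "('o2, 'r2) cat" +
  fixes F :: "('o1, 'r1, 'o2, 'r2) fun_data"
  assumes FOb_ext: "FOb F \<in> extensional (Obj C)"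
    and FAr_ext: "FAr F \<in> extensional (Arr C)"
    and FOb_obj: "X \<in> Obj C \<Longrightarrow> FOb F X \<in> Obj D"
    and FAr_hom: "f \<in> hom C X Y \<Longrightarrow> FAr F f \<in> hom D (FOb F X) (FOb F Y)"
    and FAr_ide: "X \<in> Obj C \<Longrightarrow> FAr F (Ide C X) = Ide D (FOb F X)"
    and FAr_cmp: "f \<in> hom C X Y \<Longrightarrow> g \<in> hom C Y Z \<Longrightarrow>
      FAr F (g \<cdot>\<^bsub>C\<^esub> f) = FAr F g \<cdot>\<^bsub>D\<^esub> FAr F f"

text \<open>
  The opposite of a functor \<open>F : C \<rightarrow> D\<close> has the same data as \<open>F\<close>, so no operation on
  \<^type>\<open>fun_data\<close> is needed for it: \<^term>\<open>cat_functor (op_cat C) (op_cat D) F\<close>.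
\<close>

definition id_functor :: "('o, 'r) cat \<Rightarrow> ('o, 'r, 'o, 'r) fun_data" where
  "id_functor C = \<lparr>FOb = (\<lambda>X\<in>Obj C. X), FAr = (\<lambda>f\<in>Arr C. f)\<rparr>"

text \<open>\<open>comp_functor C G F\<close> is the composite \<open>G \<circ> F\<close>, where \<open>C\<close> is the source of \<open>F\<close>.\<close>

definition comp_functor ::
  "('o1, 'r1) cat \<Rightarrow> ('o2, 'r2, 'o3, 'r3) fun_data \<Rightarrow> ('o1, 'r1, 'o2, 'r2) fun_data \<Rightarrow>
   ('o1, 'r1, 'o3, 'r3) fun_data" where
  "comp_functor C G F =
     \<lparr>FOb = (\<lambda>X\<in>Obj C. FOb G (FOb F X)), FAr = (\<lambda>f\<in>Arr C. FAr G (FAr F f))\<rparr>"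

definition prod_functor ::
  "('o1 \<times> 'o2, 'r1 \<times> 'r2) cat \<Rightarrow> ('o1, 'r1, 'p1, 's1) fun_data \<Rightarrow> ('o2, 'r2, 'p2, 's2) fun_data \<Rightarrow>
   ('o1 \<times> 'o2, 'r1 \<times> 'r2, 'p1 \<times> 'p2, 's1 \<times> 's2) fun_data" where
  "prod_functor C F G =
     \<lparr>FOb = (\<lambda>(X, X')\<in>Obj C. (FOb F X, FOb G X')),
      FAr = (\<lambda>(f, f')\<in>Arr C. (FAr F f, FAr G f'))\<rparr>"

locale nat_trans = source: cat_functor C D F + target: cat_functor C D G
  for C :: "('o1, 'r1) cat" and D :: "('o2, 'r2) cat"
    and F G :: "('o1, 'r1, 'o2, 'r2) fun_data" +
  fixes t :: "'o1 \<Rightarrow> 'r2"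
  assumes comp_ext: "t \<in> extensional (Obj C)"
    and comp_hom: "X \<in> Obj C \<Longrightarrow> t X \<in> hom D (FOb F X) (FOb G X)"
    and naturality: "f \<in> hom C X Y \<Longrightarrow> FAr G f \<cdot>\<^bsub>D\<^esub> t X = t Y \<cdot>\<^bsub>D\<^esub> FAr F f"

locale nat_iso = nat_trans +
  assumes comp_iso: "X \<in> Obj C \<Longrightarrow> iso_arrow D (t X)"

definition functor_category ::
  "('o1, 'r1) cat \<Rightarrow> ('o2, 'r2) cat \<Rightarrow>
   (('o1, 'r1, 'o2, 'r2) fun_data,
    ('o1, 'r1, 'o2, 'r2) fun_data \<times> ('o1, 'r1, 'o2, 'r2) fun_data \<times> ('o1 \<Rightarrow> 'r2)) cat" where
  "functor_category C D =
     \<lparr>Obj = {F. cat_functor C D F},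
      Arr = {(F, G, t). nat_trans C D F G t},
      Dom = (\<lambda>(F, G, t). F),
      Cod = (\<lambda>(F, G, t). G),
      Ide = (\<lambda>F. (F, F, \<lambda>X\<in>Obj C. Ide D (FOb F X))),
      Cmp = (\<lambda>(G', H, u) (F, G, t). (F, H, \<lambda>X\<in>Obj C. u X \<cdot>\<^bsub>D\<^esub> t X))\<rparr>"

definition isomorphism_of_categories ::
  "('o1, 'r1) cat \<Rightarrow> ('o2, 'r2) cat \<Rightarrow> ('o1, 'r1, 'o2, 'r2) fun_data \<Rightarrow> bool" where
  "isomorphism_of_categories C D F \<longleftrightarrow> cat_functor C D F \<and>
     (\<exists>G. cat_functor D C G \<and> comp_functor C G F = id_functor C \<and>
          comp_functor D F G = id_functor D)"


section \<open>Bicategories and indexed categories\<close>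

text \<open>
  The hom-categories \<open>\<B>(A,B)\<close> are presented together: \<open>Vert\<close> is the disjoint union of all of
  them, with 1-cells as objects and 2-cells as arrows, and \<open>\<B>(A,B)\<close> is its full subcategory on
  the 1-cells with source \<open>A\<close> and target \<open>B\<close>.  Both horizontal compositions are written in
  function-composition order.
\<close>

record ('a, 'f, 'm) bicat =
  Zero :: "'a set"
  Vert :: "('f, 'm) cat"
  Src :: "'f \<Rightarrow> 'a"
  Trg :: "'f \<Rightarrow> 'a"
  One :: "'a \<Rightarrow> 'f"
  HCmp :: "'f \<Rightarrow> 'f \<Rightarrow> 'f" (infixr "\<star>\<index>" 75)
  HCmp2 :: "'m \<Rightarrow> 'm \<Rightarrow> 'm" (infixr "\<diamondop>\<index>" 75)
  Assoc :: "'f \<Rightarrow> 'f \<Rightarrow> 'f \<Rightarrow> 'm"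
  LUnit :: "'f \<Rightarrow> 'm"
  RUnit :: "'f \<Rightarrow> 'm"

definition hom1 :: "('a, 'f, 'm) bicat \<Rightarrow> 'a \<Rightarrow> 'a \<Rightarrow> 'f set" where
  "hom1 B X Y = {f \<in> Obj (Vert B). Src B f = X \<and> Trg B f = Y}"

abbreviation hom2 :: "('a, 'f, 'm) bicat \<Rightarrow> 'f \<Rightarrow> 'f \<Rightarrow> 'm set" where
  "hom2 B \<equiv> hom (Vert B)"

abbreviation vcmp :: "'m \<Rightarrow> ('a, 'f, 'm) bicat \<Rightarrow> 'm \<Rightarrow> 'm" ("_ \<bullet>[_] _" [71, 0, 70] 70) where
  "n \<bullet>[B] m \<equiv> n \<cdot>\<^bsub>Vert B\<^esub> m"

locale bicategory = vert: category "Vert B" for B :: "('a, 'f, 'm) bicat" +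
  assumes src_zero: "f \<in> Obj (Vert B) \<Longrightarrow> Src B f \<in> Zero B"
    and trg_zero: "f \<in> Obj (Vert B) \<Longrightarrow> Trg B f \<in> Zero B"
    and src_two: "m \<in> hom2 B f g \<Longrightarrow> Src B f = Src B g"
    and trg_two: "m \<in> hom2 B f g \<Longrightarrow> Trg B f = Trg B g"
    and one_hom1: "X \<in> Zero B \<Longrightarrow> One B X \<in> hom1 B X X"
    and hcmp_hom1: "f \<in> hom1 B X Y \<Longrightarrow> g \<in> hom1 B Y Z \<Longrightarrow> g \<star>\<^bsub>B\<^esub> f \<in> hom1 B X Z"
    and hcmp2_hom2: "f \<in> hom1 B X Y \<Longrightarrow> g \<in> hom1 B Y Z \<Longrightarrow>
      m \<in> hom2 B f f' \<Longrightarrow> n \<in> hom2 B g g' \<Longrightarrow>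
      n \<diamondop>\<^bsub>B\<^esub> m \<in> hom2 B (g \<star>\<^bsub>B\<^esub> f) (g' \<star>\<^bsub>B\<^esub> f')"
    and hcmp2_ide: "f \<in> hom1 B X Y \<Longrightarrow> g \<in> hom1 B Y Z \<Longrightarrow>
      Ide (Vert B) g \<diamondop>\<^bsub>B\<^esub> Ide (Vert B) f = Ide (Vert B) (g \<star>\<^bsub>B\<^esub> f)"
    and interchange: "f \<in> hom1 B X Y \<Longrightarrow> g \<in> hom1 B Y Z \<Longrightarrow>
      m \<in> hom2 B f f' \<Longrightarrow> m' \<in> hom2 B f' f'' \<Longrightarrow> n \<in> hom2 B g g' \<Longrightarrow> n' \<in> hom2 B g' g'' \<Longrightarrow>
      (n' \<bullet>[B] n) \<diamondop>\<^bsub>B\<^esub> (m' \<bullet>[B] m) = (n' \<diamondop>\<^bsub>B\<^esub> m') \<bullet>[B] (n \<diamondop>\<^bsub>B\<^esub> m)"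
    and assoc_hom2: "f \<in> hom1 B W X \<Longrightarrow> g \<in> hom1 B X Y \<Longrightarrow> h \<in> hom1 B Y Z \<Longrightarrow>
      Assoc B h g f \<in> hom2 B ((h \<star>\<^bsub>B\<^esub> g) \<star>\<^bsub>B\<^esub> f) (h \<star>\<^bsub>B\<^esub> (g \<star>\<^bsub>B\<^esub> f))"
    and assoc_iso: "f \<in> hom1 B W X \<Longrightarrow> g \<in> hom1 B X Y \<Longrightarrow> h \<in> hom1 B Y Z \<Longrightarrow>
      iso_arrow (Vert B) (Assoc B h g f)"
    and assoc_natural: "f \<in> hom1 B W X \<Longrightarrow> g \<in> hom1 B X Y \<Longrightarrow> h \<in> hom1 B Y Z \<Longrightarrow>
      m \<in> hom2 B f f' \<Longrightarrow> n \<in> hom2 B g g' \<Longrightarrow> p \<in> hom2 B h h' \<Longrightarrow>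
      (p \<diamondop>\<^bsub>B\<^esub> (n \<diamondop>\<^bsub>B\<^esub> m)) \<bullet>[B] Assoc B h g f
        = Assoc B h' g' f' \<bullet>[B] ((p \<diamondop>\<^bsub>B\<^esub> n) \<diamondop>\<^bsub>B\<^esub> m)"
    and lunit_hom2: "f \<in> hom1 B X Y \<Longrightarrow> LUnit B f \<in> hom2 B (One B Y \<star>\<^bsub>B\<^esub> f) f"
    and lunit_iso: "f \<in> hom1 B X Y \<Longrightarrow> iso_arrow (Vert B) (LUnit B f)"
    and lunit_natural: "f \<in> hom1 B X Y \<Longrightarrow> m \<in> hom2 B f f' \<Longrightarrow>
      m \<bullet>[B] LUnit B f = LUnit B f' \<bullet>[B] (Ide (Vert B) (One B Y) \<diamondop>\<^bsub>B\<^esub> m)"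
    and runit_hom2: "f \<in> hom1 B X Y \<Longrightarrow> RUnit B f \<in> hom2 B (f \<star>\<^bsub>B\<^esub> One B X) f"
    and runit_iso: "f \<in> hom1 B X Y \<Longrightarrow> iso_arrow (Vert B) (RUnit B f)"
    and runit_natural: "f \<in> hom1 B X Y \<Longrightarrow> m \<in> hom2 B f f' \<Longrightarrow>
      m \<bullet>[B] RUnit B f = RUnit B f' \<bullet>[B] (m \<diamondop>\<^bsub>B\<^esub> Ide (Vert B) (One B X))"
    and triangle: "f \<in> hom1 B X Y \<Longrightarrow> g \<in> hom1 B Y Z \<Longrightarrow>
      (Ide (Vert B) g \<diamondop>\<^bsub>B\<^esub> LUnit B f) \<bullet>[B] Assoc B g (One B Y) f
        = RUnit B g \<diamondop>\<^bsub>B\<^esub> Ide (Vert B) f"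
    and pentagon: "f \<in> hom1 B V W \<Longrightarrow> g \<in> hom1 B W X \<Longrightarrow> h \<in> hom1 B X Y \<Longrightarrow> k \<in> hom1 B Y Z \<Longrightarrow>
      (Ide (Vert B) k \<diamondop>\<^bsub>B\<^esub> Assoc B h g f) \<bullet>[B]
          (Assoc B k (h \<star>\<^bsub>B\<^esub> g) f \<bullet>[B] (Assoc B k h g \<diamondop>\<^bsub>B\<^esub> Ide (Vert B) f))
        = Assoc B k h (g \<star>\<^bsub>B\<^esub> f) \<bullet>[B] Assoc B (k \<star>\<^bsub>B\<^esub> h) g f"

text \<open>
  The data of a pseudofunctor \<open>\<L> : \<B>\<^sup>o\<^sup>p \<rightarrow> Cat\<close>: the category \<open>\<L>\<^sup>A\<close> (\<open>Fib\<close>), the functor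
  \<open>f\<^sup>*\<close> (\<open>Pull\<close>), the component \<open>\<L>(m)\<^sub>Y\<close> (\<open>Act\<close>), and the components \<open>(\<theta>\<^sub>A)\<^sub>X\<close> (\<open>ThId\<close>) and
  \<open>(\<theta>\<^sub>f\<^sub>,\<^sub>g)\<^sub>Z\<close> (\<open>ThCmp\<close>) of the coherence isomorphisms.
\<close>

record ('a, 'f, 'm, 'o, 'r) indexed =
  Fib :: "'a \<Rightarrow> ('o, 'r) cat"
  Pull :: "'f \<Rightarrow> ('o, 'r, 'o, 'r) fun_data"
  Act :: "'m \<Rightarrow> 'o \<Rightarrow> 'r"
  ThId :: "'a \<Rightarrow> 'o \<Rightarrow> 'r"
  ThCmp :: "'f \<Rightarrow> 'f \<Rightarrow> 'o \<Rightarrow> 'r"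

text \<open>
  \<open>th_natural\<close> is naturality of \<open>\<theta>\<^sub>f\<^sub>,\<^sub>g\<close> in the 1-cells \<open>f\<close> and \<open>g\<close>, whereas naturality in the
  object \<open>Z\<close> is part of \<open>th_cmp\<close>.
\<close>

locale indexed_category = base: bicategory B for B :: "('a, 'f, 'm) bicat" +
  fixes L :: "('a, 'f, 'm, 'o, 'r) indexed"
  assumes fib_category: "X \<in> Zero B \<Longrightarrow> category (Fib L X)"
    and pull_functor: "f \<in> hom1 B X Y \<Longrightarrow> cat_functor (Fib L Y) (Fib L X) (Pull L f)"
    and act_nat_trans: "f \<in> hom1 B X Y \<Longrightarrow> m \<in> hom2 B f g \<Longrightarrow>
      nat_trans (Fib L Y) (Fib L X) (Pull L f) (Pull L g) (Act L m)"
    and act_ide: "f \<in> hom1 B X Y \<Longrightarrow> U \<in> Obj (Fib L Y) \<Longrightarrow>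
      Act L (Ide (Vert B) f) U = Ide (Fib L X) (FOb (Pull L f) U)"
    and act_vcmp: "f \<in> hom1 B X Y \<Longrightarrow> m \<in> hom2 B f g \<Longrightarrow> n \<in> hom2 B g h \<Longrightarrow>
      U \<in> Obj (Fib L Y) \<Longrightarrow> Act L (n \<bullet>[B] m) U = Act L n U \<cdot>\<^bsub>Fib L X\<^esub> Act L m U"
    and th_id: "X \<in> Zero B \<Longrightarrow>
      nat_iso (Fib L X) (Fib L X) (id_functor (Fib L X)) (Pull L (One B X)) (ThId L X)"
    and th_cmp: "f \<in> hom1 B X Y \<Longrightarrow> g \<in> hom1 B Y Z \<Longrightarrow>
      nat_iso (Fib L Z) (Fib L X) (comp_functor (Fib L Z) (Pull L f) (Pull L g))
        (Pull L (g \<star>\<^bsub>B\<^esub> f)) (ThCmp L f g)"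
    and th_natural: "f \<in> hom1 B X Y \<Longrightarrow> g \<in> hom1 B Y Z \<Longrightarrow>
      m \<in> hom2 B f f' \<Longrightarrow> n \<in> hom2 B g g' \<Longrightarrow> U \<in> Obj (Fib L Z) \<Longrightarrow>
      Act L (n \<diamondop>\<^bsub>B\<^esub> m) U \<cdot>\<^bsub>Fib L X\<^esub> ThCmp L f g U
        = ThCmp L f' g' U \<cdot>\<^bsub>Fib L X\<^esub>
            (Act L m (FOb (Pull L g') U) \<cdot>\<^bsub>Fib L X\<^esub> FAr (Pull L f) (Act L n U))"
    and th_assoc: "f \<in> hom1 B W X \<Longrightarrow> g \<in> hom1 B X Y \<Longrightarrow> h \<in> hom1 B Y Z \<Longrightarrow>
      U \<in> Obj (Fib L Z) \<Longrightarrow>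
      Act L (Assoc B h g f) U \<cdot>\<^bsub>Fib L W\<^esub>
          (ThCmp L f (h \<star>\<^bsub>B\<^esub> g) U \<cdot>\<^bsub>Fib L W\<^esub> FAr (Pull L f) (ThCmp L g h U))
        = ThCmp L (g \<star>\<^bsub>B\<^esub> f) h U \<cdot>\<^bsub>Fib L W\<^esub> ThCmp L f g (FOb (Pull L h) U)"
    and th_lunit: "f \<in> hom1 B X Y \<Longrightarrow> U \<in> Obj (Fib L Y) \<Longrightarrow>
      Act L (LUnit B f) U \<cdot>\<^bsub>Fib L X\<^esub>
          (ThCmp L f (One B Y) U \<cdot>\<^bsub>Fib L X\<^esub> FAr (Pull L f) (ThId L Y U))
        = Ide (Fib L X) (FOb (Pull L f) U)"
    and th_runit: "f \<in> hom1 B X Y \<Longrightarrow> U \<in> Obj (Fib L Y) \<Longrightarrow>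
      Act L (RUnit B f) U \<cdot>\<^bsub>Fib L X\<^esub>
          (ThCmp L (One B X) f U \<cdot>\<^bsub>Fib L X\<^esub> ThId L X (FOb (Pull L f) U))
        = Ide (Fib L X) (FOb (Pull L f) U)"


section \<open>Dependent optics\<close>

text \<open>
  The object \<open>(X,X')\<^sup>A\<close> is the triple \<open>(A, X, X')\<close>, and a pair \<open>(l, r)\<close> with representative
  \<open>f\<close> is the triple \<open>(f, l, r)\<close>.
\<close>

type_synonym ('a, 'lo, 'ro) optic_obj = "'a \<times> 'lo \<times> 'ro"
type_synonym ('f, 'lr, 'rr) optic_rep = "'f \<times> 'lr \<times> 'rr"
type_synonym ('a, 'f, 'lo, 'lr, 'ro, 'rr) optic_arr =
  "('a, 'lo, 'ro) optic_obj \<times> ('a, 'lo, 'ro) optic_obj \<times> ('f, 'lr, 'rr) optic_rep set"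

definition optic_reps ::
  "('a, 'f, 'm) bicat \<Rightarrow> ('a, 'f, 'm, 'lo, 'lr) indexed \<Rightarrow> ('a, 'f, 'm, 'ro, 'rr) indexed \<Rightarrow>
   ('a, 'lo, 'ro) optic_obj \<Rightarrow> ('a, 'lo, 'ro) optic_obj \<Rightarrow> ('f, 'lr, 'rr) optic_rep set" where
  "optic_reps B L R = (\<lambda>(A, X, X') (C, Y, Y').
     {(f, l, r). f \<in> hom1 B A C \<and> l \<in> hom (Fib L A) X (FOb (Pull L f) Y) \<and>
        r \<in> hom (Fib R A) (FOb (Pull R f) Y') X'})"

inductive optic_step ::
  "('a, 'f, 'm) bicat \<Rightarrow> ('a, 'f, 'm, 'lo, 'lr) indexed \<Rightarrow> ('a, 'f, 'm, 'ro, 'rr) indexed \<Rightarrow>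
   ('a, 'lo, 'ro) optic_obj \<Rightarrow> ('a, 'lo, 'ro) optic_obj \<Rightarrow>
   ('f, 'lr, 'rr) optic_rep \<Rightarrow> ('f, 'lr, 'rr) optic_rep \<Rightarrow> bool"
  for B L R where
  "f \<in> hom1 B A C \<Longrightarrow> g \<in> hom1 B A C \<Longrightarrow> m \<in> hom2 B f g \<Longrightarrow>
   l \<in> hom (Fib L A) X (FOb (Pull L f) Y) \<Longrightarrow> r \<in> hom (Fib R A) (FOb (Pull R g) Y') X' \<Longrightarrow>
   optic_step B L R (A, X, X') (C, Y, Y')
     (g, Act L m Y \<cdot>\<^bsub>Fib L A\<^esub> l, r) (f, l, r \<cdot>\<^bsub>Fib R A\<^esub> Act R m Y')"

definition optic_class ::
  "('a, 'f, 'm) bicat \<Rightarrow> ('a, 'f, 'm, 'lo, 'lr) indexed \<Rightarrow> ('a, 'f, 'm, 'ro, 'rr) indexed \<Rightarrow>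
   ('a, 'lo, 'ro) optic_obj \<Rightarrow> ('a, 'lo, 'ro) optic_obj \<Rightarrow>
   ('f, 'lr, 'rr) optic_rep \<Rightarrow> ('f, 'lr, 'rr) optic_rep set" where
  "optic_class B L R S T t = {u. equivclp (optic_step B L R S T) t u}"

text \<open>
  The coend of the \<open>Set\<close>-valued functor \<open>(f,g) \<mapsto> \<L>\<^sup>A(X,f\<^sup>*Y) \<times> \<R>\<^sup>A(g\<^sup>*Y',X')\<close>, as a quotient.
\<close>

definition optic_coend ::
  "('a, 'f, 'm) bicat \<Rightarrow> ('a, 'f, 'm, 'lo, 'lr) indexed \<Rightarrow> ('a, 'f, 'm, 'ro, 'rr) indexed \<Rightarrow>
   ('a, 'lo, 'ro) optic_obj \<Rightarrow> ('a, 'lo, 'ro) optic_obj \<Rightarrow> ('f, 'lr, 'rr) optic_rep set set" where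
  "optic_coend B L R S T = optic_class B L R S T ` optic_reps B L R S T"

text \<open>The arrow \<open>\<langle>l|r\<rangle> : S \<rightarrow> T\<close> with representative \<open>f\<close>.\<close>

definition optic ::
  "('a, 'f, 'm) bicat \<Rightarrow> ('a, 'f, 'm, 'lo, 'lr) indexed \<Rightarrow> ('a, 'f, 'm, 'ro, 'rr) indexed \<Rightarrow>
   ('a, 'lo, 'ro) optic_obj \<Rightarrow> ('a, 'lo, 'ro) optic_obj \<Rightarrow> 'f \<Rightarrow> 'lr \<Rightarrow> 'rr \<Rightarrow>
   ('a, 'f, 'lo, 'lr, 'ro, 'rr) optic_arr" where
  "optic B L R S T f l r = (S, T, optic_class B L R S T (f, l, r))"

definition optic_rep_cmp ::
  "('a, 'f, 'm) bicat \<Rightarrow> ('a, 'f, 'm, 'lo, 'lr) indexed \<Rightarrow> ('a, 'f, 'm, 'ro, 'rr) indexed \<Rightarrow>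
   ('a, 'lo, 'ro) optic_obj \<Rightarrow> ('a, 'lo, 'ro) optic_obj \<Rightarrow>
   ('f, 'lr, 'rr) optic_rep \<Rightarrow> ('f, 'lr, 'rr) optic_rep \<Rightarrow> ('f, 'lr, 'rr) optic_rep" where
  "optic_rep_cmp B L R = (\<lambda>(A, X, X') (E, Z, Z') (g, l2, r2) (f, l1, r1).
     (g \<star>\<^bsub>B\<^esub> f,
      ThCmp L f g Z \<cdot>\<^bsub>Fib L A\<^esub> (FAr (Pull L f) l2 \<cdot>\<^bsub>Fib L A\<^esub> l1),
      r1 \<cdot>\<^bsub>Fib R A\<^esub> (FAr (Pull R f) r2 \<cdot>\<^bsub>Fib R A\<^esub> inv_arrow (Fib R A) (ThCmp R f g Z'))))"

text \<open>
  Composition is defined on classes by the union over all choices of representatives of the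
  class of the composite; these classes all coincide, as composition respects the relation.
\<close>

definition Optic ::
  "('a, 'f, 'm) bicat \<Rightarrow> ('a, 'f, 'm, 'lo, 'lr) indexed \<Rightarrow> ('a, 'f, 'm, 'ro, 'rr) indexed \<Rightarrow>
   (('a, 'lo, 'ro) optic_obj, ('a, 'f, 'lo, 'lr, 'ro, 'rr) optic_arr) cat" where
  "Optic B L R =
     (let Ob = {(A, X, X'). A \<in> Zero B \<and> X \<in> Obj (Fib L A) \<and> X' \<in> Obj (Fib R A)} in
     \<lparr>Obj = Ob,
      Arr = {(S, T, c). S \<in> Ob \<and> T \<in> Ob \<and> c \<in> optic_coend B L R S T},
      Dom = (\<lambda>(S, T, c). S),
      Cod = (\<lambda>(S, T, c). T),
      Ide = (\<lambda>(A, X, X'). optic B L R (A, X, X') (A, X, X')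
               (One B A) (ThId L A X) (inv_arrow (Fib R A) (ThId R A X'))),
      Cmp = (\<lambda>(T', U, d) (S, T, c).
               (S, U, \<Union>u\<in>d. \<Union>t\<in>c. optic_class B L R S U (optic_rep_cmp B L R S U u t)))\<rparr>)"


section \<open>Tambara representations\<close>

record ('a, 'f, 'lo, 'lr, 'ro, 'rr, 'do, 'dr) tamb_data =
  Prof :: "'a \<Rightarrow> ('lo \<times> 'ro, 'lr \<times> 'rr, 'do, 'dr) fun_data"
  Str :: "'f \<Rightarrow> 'lo \<times> 'ro \<Rightarrow> 'dr"

abbreviation prof_cat ::
  "('a, 'f, 'm, 'lo, 'lr) indexed \<Rightarrow> ('a, 'f, 'm, 'ro, 'rr) indexed \<Rightarrow> 'a \<Rightarrow>
   ('lo \<times> 'ro, 'lr \<times> 'rr) cat" where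
  "prof_cat L R A \<equiv> prod_cat (op_cat (Fib L A)) (Fib R A)"

abbreviation pull2 ::
  "('a, 'f, 'm) bicat \<Rightarrow> ('a, 'f, 'm, 'lo, 'lr) indexed \<Rightarrow> ('a, 'f, 'm, 'ro, 'rr) indexed \<Rightarrow> 'f \<Rightarrow>
   ('lo \<times> 'ro, 'lr \<times> 'rr, 'lo \<times> 'ro, 'lr \<times> 'rr) fun_data" where
  "pull2 B L R f \<equiv> prod_functor (prof_cat L R (Trg B f)) (Pull L f) (Pull R f)"

locale tambara_representation =
  left: indexed_category B L + right: indexed_category B R + target: category D
  for B :: "('a, 'f, 'm) bicat"
    and L :: "('a, 'f, 'm, 'lo, 'lr) indexed"
    and R :: "('a, 'f, 'm, 'ro, 'rr) indexed"
    and D :: "('do, 'dr) cat" +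
  fixes P :: "('a, 'f, 'lo, 'lr, 'ro, 'rr, 'do, 'dr) tamb_data"
  assumes prof_ext: "Prof P \<in> extensional (Zero B)"
    and str_ext: "Str P \<in> extensional (Obj (Vert B))"
    and prof_functor: "A \<in> Zero B \<Longrightarrow> cat_functor (prof_cat L R A) D (Prof P A)"
    and str_nat_trans: "f \<in> hom1 B A C \<Longrightarrow>
      nat_trans (prof_cat L R C) D
        (Prof P C) (comp_functor (prof_cat L R C) (Prof P A) (pull2 B L R f)) (Str P f)"
    and str_extranatural: "f \<in> hom1 B A C \<Longrightarrow> g \<in> hom1 B A C \<Longrightarrow> m \<in> hom2 B f g \<Longrightarrow>
      Y \<in> Obj (Fib L C) \<Longrightarrow> Y' \<in> Obj (Fib R C) \<Longrightarrow>
      FAr (Prof P A) (Act L m Y, Ide (Fib R A) (FOb (Pull R g) Y')) \<cdot>\<^bsub>D\<^esub> Str P g (Y, Y')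
        = FAr (Prof P A) (Ide (Fib L A) (FOb (Pull L f) Y), Act R m Y') \<cdot>\<^bsub>D\<^esub> Str P f (Y, Y')"
    and str_unit: "A \<in> Zero B \<Longrightarrow> X \<in> Obj (Fib L A) \<Longrightarrow> X' \<in> Obj (Fib R A) \<Longrightarrow>
      FAr (Prof P A) (ThId L A X, inv_arrow (Fib R A) (ThId R A X')) \<cdot>\<^bsub>D\<^esub>
          Str P (One B A) (X, X')
        = Ide D (FOb (Prof P A) (X, X'))"
    and str_cmp: "f \<in> hom1 B A C \<Longrightarrow> g \<in> hom1 B C E \<Longrightarrow>
      Z \<in> Obj (Fib L E) \<Longrightarrow> Z' \<in> Obj (Fib R E) \<Longrightarrow>
      FAr (Prof P A) (ThCmp L f g Z, inv_arrow (Fib R A) (ThCmp R f g Z')) \<cdot>\<^bsub>D\<^esub>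
          Str P (g \<star>\<^bsub>B\<^esub> f) (Z, Z')
        = Str P f (FOb (Pull L g) Z, FOb (Pull R g) Z') \<cdot>\<^bsub>D\<^esub> Str P g (Z, Z')"

locale tambara_morphism =
  source: tambara_representation B L R D P + target: tambara_representation B L R D Q
  for B :: "('a, 'f, 'm) bicat"
    and L :: "('a, 'f, 'm, 'lo, 'lr) indexed"
    and R :: "('a, 'f, 'm, 'ro, 'rr) indexed"
    and D :: "('do, 'dr) cat"
    and P Q :: "('a, 'f, 'lo, 'lr, 'ro, 'rr, 'do, 'dr) tamb_data" +
  fixes e :: "'a \<Rightarrow> 'lo \<times> 'ro \<Rightarrow> 'dr"
  assumes family_ext: "e \<in> extensional (Zero B)"
    and family_nat_trans: "A \<in> Zero B \<Longrightarrow>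
      nat_trans (prof_cat L R A) D (Prof P A) (Prof Q A) (e A)"
    and family_str: "f \<in> hom1 B A C \<Longrightarrow> Y \<in> Obj (Fib L C) \<Longrightarrow> Y' \<in> Obj (Fib R C) \<Longrightarrow>
      e A (FOb (Pull L f) Y, FOb (Pull R f) Y') \<cdot>\<^bsub>D\<^esub> Str P f (Y, Y')
        = Str Q f (Y, Y') \<cdot>\<^bsub>D\<^esub> e C (Y, Y')"

definition Tamb ::
  "('a, 'f, 'm) bicat \<Rightarrow> ('a, 'f, 'm, 'lo, 'lr) indexed \<Rightarrow> ('a, 'f, 'm, 'ro, 'rr) indexed \<Rightarrow>
   ('do, 'dr) cat \<Rightarrow>
   (('a, 'f, 'lo, 'lr, 'ro, 'rr, 'do, 'dr) tamb_data,
    ('a, 'f, 'lo, 'lr, 'ro, 'rr, 'do, 'dr) tamb_data \<times>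
    ('a, 'f, 'lo, 'lr, 'ro, 'rr, 'do, 'dr) tamb_data \<times> ('a \<Rightarrow> 'lo \<times> 'ro \<Rightarrow> 'dr)) cat" where
  "Tamb B L R D =
     \<lparr>Obj = {P. tambara_representation B L R D P},
      Arr = {(P, Q, e). tambara_morphism B L R D P Q e},
      Dom = (\<lambda>(P, Q, e). P),
      Cod = (\<lambda>(P, Q, e). Q),
      Ide = (\<lambda>P. (P, P, \<lambda>A\<in>Zero B. \<lambda>Z\<in>Obj (prof_cat L R A). Ide D (FOb (Prof P A) Z))),
      Cmp = (\<lambda>(Q', S, d) (P, Q, e).
               (P, S, \<lambda>A\<in>Zero B. \<lambda>Z\<in>Obj (prof_cat L R A). d A Z \<cdot>\<^bsub>D\<^esub> e A Z))\<rparr>"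

definition iota ::
  "('a, 'f, 'm) bicat \<Rightarrow> ('a, 'f, 'm, 'lo, 'lr) indexed \<Rightarrow> ('a, 'f, 'm, 'ro, 'rr) indexed \<Rightarrow> 'a \<Rightarrow>
   ('lo \<times> 'ro, 'lr \<times> 'rr,
    ('a, 'lo, 'ro) optic_obj, ('a, 'f, 'lo, 'lr, 'ro, 'rr) optic_arr) fun_data" where
  "iota B L R A =
     \<lparr>FOb = (\<lambda>(X, X')\<in>Obj (prod_cat (Fib L A) (op_cat (Fib R A))). (A, X, X')),
      FAr = (\<lambda>(l, r)\<in>Arr (prod_cat (Fib L A) (op_cat (Fib R A))).
               optic B L R (A, Dom (Fib L A) l, Cod (Fib R A) r) (A, Cod (Fib L A) l, Dom (Fib R A) r)
                 (One B A)
                 (ThId L A (Cod (Fib L A) l) \<cdot>\<^bsub>Fib L A\<^esub> l)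
                 (r \<cdot>\<^bsub>Fib R A\<^esub> inv_arrow (Fib R A) (ThId R A (Dom (Fib R A) r))))\<rparr>"

text \<open>
  The universal Tambara representation, with values in \<^term>\<open>op_cat (Optic B L R)\<close>; its functors
  are the opposites of \<^term>\<open>iota B L R A\<close>, which have the same data.
\<close>

definition iota_op ::
  "('a, 'f, 'm) bicat \<Rightarrow> ('a, 'f, 'm, 'lo, 'lr) indexed \<Rightarrow> ('a, 'f, 'm, 'ro, 'rr) indexed \<Rightarrow>
   ('a, 'f, 'lo, 'lr, 'ro, 'rr,
    ('a, 'lo, 'ro) optic_obj, ('a, 'f, 'lo, 'lr, 'ro, 'rr) optic_arr) tamb_data" where
  "iota_op B L R =
     \<lparr>Prof = (\<lambda>A\<in>Zero B. iota B L R A),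
      Str = (\<lambda>f\<in>Obj (Vert B). \<lambda>(Y, Y')\<in>Obj (prof_cat L R (Trg B f)).
               optic B L R (Src B f, FOb (Pull L f) Y, FOb (Pull R f) Y') (Trg B f, Y, Y') f
                 (Ide (Fib L (Src B f)) (FOb (Pull L f) Y))
                 (Ide (Fib R (Src B f)) (FOb (Pull R f) Y')))\<rparr>"

text \<open>Composition of a Tambara representation \<open>P\<close> with a functor \<open>F\<close> out of its value category.\<close>

definition tamb_comp ::
  "('a, 'f, 'm) bicat \<Rightarrow> ('a, 'f, 'm, 'lo, 'lr) indexed \<Rightarrow> ('a, 'f, 'm, 'ro, 'rr) indexed \<Rightarrow>
   ('eo, 'er, 'do, 'dr) fun_data \<Rightarrow> ('a, 'f, 'lo, 'lr, 'ro, 'rr, 'eo, 'er) tamb_data \<Rightarrow>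
   ('a, 'f, 'lo, 'lr, 'ro, 'rr, 'do, 'dr) tamb_data" where
  "tamb_comp B L R F P =
     \<lparr>Prof = (\<lambda>A\<in>Zero B. comp_functor (prof_cat L R A) F (Prof P A)),
      Str = (\<lambda>f\<in>Obj (Vert B). \<lambda>Z\<in>Obj (prof_cat L R (Trg B f)). FAr F (Str P f Z))\<rparr>"

text \<open>
  The functor \<open>- \<circ> \<iota>\<^sup>o\<^sup>p\<close> from \<^term>\<open>functor_category (op_cat (Optic B L R)) D\<close> to
  \<^term>\<open>Tamb B L R D\<close>.
\<close>

definition comp_iota_op ::
  "('a, 'f, 'm) bicat \<Rightarrow> ('a, 'f, 'm, 'lo, 'lr) indexed \<Rightarrow> ('a, 'f, 'm, 'ro, 'rr) indexed \<Rightarrow>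
   ('do, 'dr) cat \<Rightarrow>
   ((('a, 'lo, 'ro) optic_obj, ('a, 'f, 'lo, 'lr, 'ro, 'rr) optic_arr, 'do, 'dr) fun_data,
    (('a, 'lo, 'ro) optic_obj, ('a, 'f, 'lo, 'lr, 'ro, 'rr) optic_arr, 'do, 'dr) fun_data \<times>
    (('a, 'lo, 'ro) optic_obj, ('a, 'f, 'lo, 'lr, 'ro, 'rr) optic_arr, 'do, 'dr) fun_data \<times>
    (('a, 'lo, 'ro) optic_obj \<Rightarrow> 'dr),
    ('a, 'f, 'lo, 'lr, 'ro, 'rr, 'do, 'dr) tamb_data,
    ('a, 'f, 'lo, 'lr, 'ro, 'rr, 'do, 'dr) tamb_data \<times>
    ('a, 'f, 'lo, 'lr, 'ro, 'rr, 'do, 'dr) tamb_data \<times> ('a \<Rightarrow> 'lo \<times> 'ro \<Rightarrow> 'dr)) fun_data" where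
  "comp_iota_op B L R D =
     \<lparr>FOb = (\<lambda>F\<in>Obj (functor_category (op_cat (Optic B L R)) D). tamb_comp B L R F (iota_op B L R)),
      FAr = (\<lambda>(F, G, t)\<in>Arr (functor_category (op_cat (Optic B L R)) D).
               (tamb_comp B L R F (iota_op B L R), tamb_comp B L R G (iota_op B L R),
                \<lambda>A\<in>Zero B. \<lambda>Z\<in>Obj (prof_cat L R A). t (FOb (iota B L R A) Z)))\<rparr>"

end

theory Submission
  imports Defs
begin

text \<open>
  Every optic factors as \<open>\<langle>l|r\<rangle> = \<langle>id|id\<rangle>\<^sub>f \<circ> \<iota>(l,r)\<close>, where \<open>f\<close> is the representative.  A functor
  \<open>F\<close> on \<open>Optic\<^sup>o\<^sup>p\<close> is therefore determined by \<open>F \<circ> \<iota>\<^sup>o\<^sup>p\<close>.  Conversely, a Tambara representation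
  \<open>(P,\<zeta>)\<close> extends to \<open>\<langle>l|r\<rangle> \<mapsto> P(l,r) \<circ> \<zeta>\<^sub>f\<close>: extranaturality of \<open>\<zeta>\<close> says that this respects the
  coend relation, and the unit and composition laws of \<open>\<zeta>\<close> together with its naturality give
  functoriality.  The same factorisation turns a morphism of Tambara representations into a natural
  transformation with the same components.

  Composition with \<open>\<iota>(l,r)\<close> on either side acts by plain composition in the fibres, which is where
  the unit coherence of \<open>\<L>\<close> and \<open>\<R>\<close> enters; the unit laws of \<open>Optic\<close> are the special case of
  identities.
\<close>

section \<open>Functor categories and isomorphisms of categories\<close>

text \<open>The halves of an optic have opposite variance: \<open>L\<close> enters through theta,
  \<open>R\<close> through the inverse of theta'. The axioms of an indexed category speak of the
  forward isomorphisms only, so every coherence law wanted for \<open>R\<close> is first transposed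
  along invertible arrows. An isomorphism is claimed, not an equivalence, so all comparisons are
  equalities of data, and extensionality of every component map is what makes them provable.
  Bijectivity on objects and on arrows suffices; the inverse assignment, from Tambara
  representations to functors, need not be shown functorial separately. Two constructions refer to
  representatives of classes: the union that defines composition of optics, and the representative
  chosen in the extension of a Tambara representation. Both are controlled by checking generating
  steps only. Since \<open>iota_op\<close> is itself a Tambara representation, restriction along it
  is an instance of composing any Tambara representation with a functor.\<close>

context category
begin

lemma cmp_arr [simp]:
  assumes "f \<in> Arr C" "g \<in> Arr C" "Cod C f = Dom C g"
  shows "g \<cdot>\<^bsub>C\<^esub> f \<in> Arr C" "Dom C (g \<cdot>\<^bsub>C\<^esub> f) = Dom C f" "Cod C (g \<cdot>\<^bsub>C\<^esub> f) = Cod C g"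
  using cmp_hom[of f "Dom C f" "Cod C f" g "Cod C g"] assms by (auto simp: hom_def)

lemma ide_arr [simp]:
  assumes "X \<in> Obj C"
  shows "Ide C X \<in> Arr C" "Dom C (Ide C X) = X" "Cod C (Ide C X) = X"
  using ide_hom[OF assms] by (auto simp: hom_def)

lemma cmp_ide_left [simp]: "f \<in> Arr C \<Longrightarrow> Cod C f = X \<Longrightarrow> Ide C X \<cdot>\<^bsub>C\<^esub> f = f"
  using ide_left[of f] by (auto simp: hom_def)

lemma cmp_ide_right [simp]: "f \<in> Arr C \<Longrightarrow> Dom C f = X \<Longrightarrow> f \<cdot>\<^bsub>C\<^esub> Ide C X = f"
  using ide_right[of f] by (auto simp: hom_def)

lemma assoc:
  assumes "f \<in> Arr C" "g \<in> Arr C" "h \<in> Arr C" "Cod C f = Dom C g" "Cod C g = Dom C h"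
  shows "(h \<cdot>\<^bsub>C\<^esub> g) \<cdot>\<^bsub>C\<^esub> f = h \<cdot>\<^bsub>C\<^esub> (g \<cdot>\<^bsub>C\<^esub> f)"
  using cmp_assoc[of f _ _ g _ h] assms by (auto simp: hom_def)

declare dom_obj [simp] cod_obj [simp]

lemma inverse_unique:
  assumes "inverse_arrows C f g" "inverse_arrows C f h"
  shows "g = h"
proof -
  have "g = g \<cdot>\<^bsub>C\<^esub> (f \<cdot>\<^bsub>C\<^esub> h)"
    using assms by (auto simp: inverse_arrows_def hom_def)
  also have "\<dots> = (g \<cdot>\<^bsub>C\<^esub> f) \<cdot>\<^bsub>C\<^esub> h"
    using assms by (subst assoc) (auto simp: inverse_arrows_def hom_def)
  also have "\<dots> = h"
    using assms by (auto simp: inverse_arrows_def hom_def)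
  finally show ?thesis .
qed

text \<open>\<open>inv_arrow\<close> is a definite description, so its properties rest on the
  uniqueness of inverses.\<close>

lemma inverse_arrows_inv:
  assumes "iso_arrow C f"
  shows "inverse_arrows C f (inv_arrow C f)"
  using assms inverse_unique unfolding iso_arrow_def inv_arrow_def by (metis theI)

lemma inv_arr:
  assumes "iso_arrow C f"
  shows "inv_arrow C f \<in> Arr C" "Dom C (inv_arrow C f) = Cod C f" "Cod C (inv_arrow C f) = Dom C f"
    "inv_arrow C f \<cdot>\<^bsub>C\<^esub> f = Ide C (Dom C f)" "f \<cdot>\<^bsub>C\<^esub> inv_arrow C f = Ide C (Cod C f)"
    "f \<in> Arr C"
  using inverse_arrows_inv[OF assms] by (auto simp: inverse_arrows_def hom_def)

lemma inverse_arrows_ide: "X \<in> Obj C \<Longrightarrow> inverse_arrows C (Ide C X) (Ide C X)"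
  by (auto simp: inverse_arrows_def hom_def)

lemma inverse_arrows_cmp:
  assumes f: "inverse_arrows C f f'" and g: "inverse_arrows C g g'" and fg: "Cod C f = Dom C g"
  shows "inverse_arrows C (g \<cdot>\<^bsub>C\<^esub> f) (f' \<cdot>\<^bsub>C\<^esub> g')"
proof -
  have arr: "f \<in> Arr C" "f' \<in> Arr C" "g \<in> Arr C" "g' \<in> Arr C"
    "Dom C f' = Cod C f" "Cod C f' = Dom C f" "Dom C g' = Cod C g" "Cod C g' = Dom C g"
    using f g by (auto simp: inverse_arrows_def hom_def)
  have "(f' \<cdot>\<^bsub>C\<^esub> g') \<cdot>\<^bsub>C\<^esub> (g \<cdot>\<^bsub>C\<^esub> f) = f' \<cdot>\<^bsub>C\<^esub> ((g' \<cdot>\<^bsub>C\<^esub> g) \<cdot>\<^bsub>C\<^esub> f)"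
    "(g \<cdot>\<^bsub>C\<^esub> f) \<cdot>\<^bsub>C\<^esub> (f' \<cdot>\<^bsub>C\<^esub> g') = g \<cdot>\<^bsub>C\<^esub> ((f \<cdot>\<^bsub>C\<^esub> f') \<cdot>\<^bsub>C\<^esub> g')"
    using arr fg by (simp_all add: assoc)
  then show ?thesis
    using f g arr fg by (auto simp: inverse_arrows_def hom_def)
qed

text \<open>Inverting two parallel sides of a commuting square gives a commuting square again. With
  composites of theta as the inverted sides, this carries the axioms of an indexed category over to
  the inverse isomorphisms used by the backward half of an optic.\<close>

lemma transpose_square:
  assumes p: "inverse_arrows C p p'" and q: "inverse_arrows C q q'"
    and uv: "u \<in> Arr C" "v \<in> Arr C" "Dom C u = Cod C p" "Cod C u = Cod C q" "Dom C v = Dom C p"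
      "Cod C v = Dom C q" "u \<cdot>\<^bsub>C\<^esub> p = q \<cdot>\<^bsub>C\<^esub> v"
  shows "q' \<cdot>\<^bsub>C\<^esub> u = v \<cdot>\<^bsub>C\<^esub> p'"
proof -
  have arr: "p \<in> Arr C" "p' \<in> Arr C" "q \<in> Arr C" "q' \<in> Arr C"
    "Dom C p' = Cod C p" "Cod C p' = Dom C p" "Dom C q' = Cod C q" "Cod C q' = Dom C q"
    and inv: "p \<cdot>\<^bsub>C\<^esub> p' = Ide C (Cod C p)" "q' \<cdot>\<^bsub>C\<^esub> q = Ide C (Dom C q)"
    using p q by (auto simp: inverse_arrows_def hom_def)
  have "q' \<cdot>\<^bsub>C\<^esub> u = q' \<cdot>\<^bsub>C\<^esub> (u \<cdot>\<^bsub>C\<^esub> (p \<cdot>\<^bsub>C\<^esub> p'))"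
    unfolding inv using uv by simp
  also have "\<dots> = q' \<cdot>\<^bsub>C\<^esub> ((u \<cdot>\<^bsub>C\<^esub> p) \<cdot>\<^bsub>C\<^esub> p')"
    using arr uv(1-6) by (simp add: assoc)
  also have "\<dots> = (q' \<cdot>\<^bsub>C\<^esub> q) \<cdot>\<^bsub>C\<^esub> (v \<cdot>\<^bsub>C\<^esub> p')"
    unfolding uv(7) using arr uv(1-6) by (simp add: assoc)
  also have "\<dots> = v \<cdot>\<^bsub>C\<^esub> p'"
    unfolding inv using arr uv(1-6) by simp
  finally show ?thesis .
qed

end

section \<open>Opposite and product categories, functors and natural transformations\<close>

lemma op_cat_simps [simp]:
  "Obj (op_cat C) = Obj C" "Arr (op_cat C) = Arr C" "Dom (op_cat C) = Cod C"
  "Cod (op_cat C) = Dom C" "Ide (op_cat C) = Ide C" "g \<cdot>\<^bsub>op_cat C\<^esub> f = f \<cdot>\<^bsub>C\<^esub> g"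
  by (auto simp: op_cat_def)

lemma hom_op_cat [simp]: "hom (op_cat C) X Y = hom C Y X"
  by (auto simp: hom_def)

lemma prod_cat_simps [simp]:
  "Obj (prod_cat C D) = Obj C \<times> Obj D" "Arr (prod_cat C D) = Arr C \<times> Arr D"
  "Dom (prod_cat C D) (f, f') = (Dom C f, Dom D f')"
  "Cod (prod_cat C D) (f, f') = (Cod C f, Cod D f')"
  "Ide (prod_cat C D) (X, X') = (Ide C X, Ide D X')"
  "(g, g') \<cdot>\<^bsub>prod_cat C D\<^esub> (f, f') = (g \<cdot>\<^bsub>C\<^esub> f, g' \<cdot>\<^bsub>D\<^esub> f')"
  by (auto simp: prod_cat_def)

lemma hom_prod_cat [simp]: "hom (prod_cat C D) (X, X') (Y, Y') = hom C X Y \<times> hom D X' Y'"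
  by (auto simp: hom_def)

lemma category_op_cat: "category C \<Longrightarrow> category (op_cat C)"
  unfolding category_def by (auto simp: hom_def)

lemma category_prod_cat: "category C \<Longrightarrow> category D \<Longrightarrow> category (prod_cat C D)"
  unfolding category_def by (auto simp: hom_def)

context cat_functor
begin

lemma fun_arr [simp]:
  assumes "f \<in> Arr C"
  shows "FAr F f \<in> Arr D" "Dom D (FAr F f) = FOb F (Dom C f)" "Cod D (FAr F f) = FOb F (Cod C f)"
  using FAr_hom[of f "Dom C f" "Cod C f"] assms by (auto simp: hom_def)

lemma fun_cmp:
  assumes "f \<in> Arr C" "g \<in> Arr C" "Cod C f = Dom C g"
  shows "FAr F (g \<cdot>\<^bsub>C\<^esub> f) = FAr F g \<cdot>\<^bsub>D\<^esub> FAr F f"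
  using FAr_cmp[of f "Dom C f" "Cod C f" g "Cod C g"] assms by (auto simp: hom_def)

declare FOb_obj [simp] FAr_ide [simp]

lemma fun_inverse_arrows:
  assumes "inverse_arrows C f g"
  shows "inverse_arrows D (FAr F f) (FAr F g)"
  using assms fun_cmp[of f g] fun_cmp[of g f] by (auto simp: inverse_arrows_def hom_def)

end

context nat_trans
begin

lemma trans_arr [simp]:
  assumes "X \<in> Obj C"
  shows "t X \<in> Arr D" "Dom D (t X) = FOb F X" "Cod D (t X) = FOb G X"
  using comp_hom[OF assms] by (auto simp: hom_def)

lemma natural:
  assumes "f \<in> Arr C" 
  shows "FAr G f \<cdot>\<^bsub>D\<^esub> t (Dom C f) = t (Cod C f) \<cdot>\<^bsub>D\<^esub> FAr F f"
  using naturality[of f] assms by (auto simp: hom_def)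

end

lemma cat_functorI:
  assumes "category C" "category D"
    and "FOb F \<in> extensional (Obj C)" "FAr F \<in> extensional (Arr C)"
    and "\<And>X. X \<in> Obj C \<Longrightarrow> FOb F X \<in> Obj D"
    and "\<And>f. f \<in> Arr C \<Longrightarrow> FAr F f \<in> Arr D \<and> Dom D (FAr F f) = FOb F (Dom C f) \<and>
           Cod D (FAr F f) = FOb F (Cod C f)"
    and "\<And>X. X \<in> Obj C \<Longrightarrow> FAr F (Ide C X) = Ide D (FOb F X)"
    and "\<And>f g. f \<in> Arr C \<Longrightarrow> g \<in> Arr C \<Longrightarrow> Cod C f = Dom C g \<Longrightarrow>
           FAr F (g \<cdot>\<^bsub>C\<^esub> f) = FAr F g \<cdot>\<^bsub>D\<^esub> FAr F f"
  shows "cat_functor C D F"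
  using assms by (auto simp: cat_functor_def cat_functor_axioms_def hom_def)

lemma nat_transI:
  assumes "cat_functor C D F" "cat_functor C D G" "t \<in> extensional (Obj C)"
    and "\<And>X. X \<in> Obj C \<Longrightarrow> t X \<in> Arr D \<and> Dom D (t X) = FOb F X \<and> Cod D (t X) = FOb G X"
    and "\<And>f. f \<in> Arr C \<Longrightarrow> FAr G f \<cdot>\<^bsub>D\<^esub> t (Dom C f) = t (Cod C f) \<cdot>\<^bsub>D\<^esub> FAr F f"
  shows "nat_trans C D F G t"
  using assms by (auto simp: nat_trans_def nat_trans_axioms_def hom_def)

lemma comp_functor_simps [simp]:
  "X \<in> Obj C \<Longrightarrow> FOb (comp_functor C G F) X = FOb G (FOb F X)"
  "f \<in> Arr C \<Longrightarrow> FAr (comp_functor C G F) f = FAr G (FAr F f)"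
  by (auto simp: comp_functor_def)

lemma cat_functor_comp:
  assumes "cat_functor C D F" "cat_functor D E G"
  shows "cat_functor C E (comp_functor C G F)"
proof -
  interpret F: cat_functor C D F by fact
  interpret G: cat_functor D E G by fact
  show ?thesis
    by (rule cat_functorI) 
      (auto simp: F.source.category_axioms G.target.category_axioms F.fun_cmp G.fun_cmp,
       auto simp: comp_functor_def)
qed

text \<open>\<open>FAr F\<close> is injective on the arrows of \<open>C\<close>, so an equation
  between two of them may be checked after applying \<open>F\<close>; the functor laws of the
  inverse thereby reduce to those of \<open>F\<close>. The inverse maps are restricted to the
  objects and arrows of \<open>D\<close>, since a functor has to be extensional.\<close>

lemma isomorphism_of_categoriesI:
  assumes "cat_functor C D F"
    and ob: "bij_betw (FOb F) (Obj C) (Obj D)" and ar: "bij_betw (FAr F) (Arr C) (Arr D)"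
  shows "isomorphism_of_categories C D F"
proof -
  interpret F: cat_functor C D F by fact
  define G where "G = \<lparr>FOb = restrict (the_inv_into (Obj C) (FOb F)) (Obj D),
    FAr = restrict (the_inv_into (Arr C) (FAr F)) (Arr D)\<rparr>"
  have obG: "FOb G Y \<in> Obj C" "FOb F (FOb G Y) = Y" if "Y \<in> Obj D" for Y
    using that ob by (auto simp: G_def bij_betw_def f_the_inv_into_f intro: the_inv_into_into)
  have arG: "FAr G g \<in> Arr C" "FAr F (FAr G g) = g" if "g \<in> Arr D" for g
    using that ar by (auto simp: G_def bij_betw_def f_the_inv_into_f intro: the_inv_into_into)
  have obF: "FOb G (FOb F X) = X" if "X \<in> Obj C" for X
    using that ob by (auto simp: G_def bij_betw_def the_inv_into_f_f)
  have arF: "FAr G (FAr F f) = f" if "f \<in> Arr C" for f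
    using that ar by (auto simp: G_def bij_betw_def the_inv_into_f_f)
  have ob_eq: "X = FOb G Y" if "X \<in> Obj C" "FOb F X = Y" for X Y
    using that obF by auto
  have ar_eq: "f = FAr G g" if "f \<in> Arr C" "FAr F f = g" for f g
    using that arF by auto
  have hom: "Dom C (FAr G g) = FOb G (Dom D g)" "Cod C (FAr G g) = FOb G (Cod D g)"
    if "g \<in> Arr D" for g
    using arG[OF that] F.fun_arr[of "FAr G g"] by (auto intro!: ob_eq)
  have "cat_functor D C G"
  proof (rule cat_functorI)
    show "FAr G (Ide D X) = Ide C (FOb G X)" if "X \<in> Obj D" for X
      using obG[OF that] by (intro ar_eq[symmetric]) auto
    show "FAr G (g \<cdot>\<^bsub>D\<^esub> f) = FAr G g \<cdot>\<^bsub>C\<^esub> FAr G f"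
      if "f \<in> Arr D" "g \<in> Arr D" "Cod D f = Dom D g" for f g
      using that by (intro ar_eq[symmetric]) (auto simp: arG hom F.fun_cmp)
  qed (auto simp: obG arG hom F.source.category_axioms F.target.category_axioms, auto simp: G_def)
  moreover have "comp_functor C G F = id_functor C"
    by (auto simp: comp_functor_def id_functor_def obF arF intro!: restrict_ext)
  moreover have "comp_functor D F G = id_functor D"
    by (auto simp: comp_functor_def id_functor_def obG arG intro!: restrict_ext)
  ultimately show ?thesis
    using assms(1) by (auto simp: isomorphism_of_categories_def)
qed

section \<open>Functor categories\<close>

lemma functor_category_simps:
  "Obj (functor_category C D) = {F. cat_functor C D F}"
  "Arr (functor_category C D) = {(F, G, t). nat_trans C D F G t}"
  "Dom (functor_category C D) (F, G, t) = F"
  "Cod (functor_category C D) (F, G, t) = G"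
  "Ide (functor_category C D) F = (F, F, \<lambda>X\<in>Obj C. Ide D (FOb F X))"
  "(G', H, u) \<cdot>\<^bsub>functor_category C D\<^esub> (F, G, t) = (F, H, \<lambda>X\<in>Obj C. u X \<cdot>\<^bsub>D\<^esub> t X)"
  by (auto simp: functor_category_def)

lemma nat_trans_ide:
  assumes "cat_functor C D F"
  shows "nat_trans C D F F (\<lambda>X\<in>Obj C. Ide D (FOb F X))"
proof -
  interpret cat_functor C D F by fact
  show ?thesis by (rule nat_transI) (auto simp: assms)
qed

lemma nat_trans_cmp:
  assumes "nat_trans C D F G t" "nat_trans C D G H u"
  shows "nat_trans C D F H (\<lambda>X\<in>Obj C. u X \<cdot>\<^bsub>D\<^esub> t X)"
proof -
  interpret t: nat_trans C D F G t by fact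
  interpret u: nat_trans C D G H u by fact
  show ?thesis
  proof (rule nat_transI)
    fix f assume f: "f \<in> Arr C"
    have "FAr H f \<cdot>\<^bsub>D\<^esub> (u (Dom C f) \<cdot>\<^bsub>D\<^esub> t (Dom C f))
        = (FAr H f \<cdot>\<^bsub>D\<^esub> u (Dom C f)) \<cdot>\<^bsub>D\<^esub> t (Dom C f)"
      using f by (simp add: t.source.target.assoc)
    also have "\<dots> = u (Cod C f) \<cdot>\<^bsub>D\<^esub> (FAr G f \<cdot>\<^bsub>D\<^esub> t (Dom C f))"
      unfolding u.natural[OF f] using f by (simp add: t.source.target.assoc)
    also have "\<dots> = (u (Cod C f) \<cdot>\<^bsub>D\<^esub> t (Cod C f)) \<cdot>\<^bsub>D\<^esub> FAr F f"
      unfolding t.natural[OF f] using f by (simp add: t.source.target.assoc)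
    finally show "FAr H f \<cdot>\<^bsub>D\<^esub> (\<lambda>X\<in>Obj C. u X \<cdot>\<^bsub>D\<^esub> t X) (Dom C f)
        = (\<lambda>X\<in>Obj C. u X \<cdot>\<^bsub>D\<^esub> t X) (Cod C f) \<cdot>\<^bsub>D\<^esub> FAr F f"
      using f by simp
  qed (auto simp: t.source.cat_functor_axioms u.target.cat_functor_axioms)
qed

text \<open>Identities and composites are restricted to the objects of \<open>C\<close>; a unit law
  is an equality of functions because natural transformations are extensional there.\<close>

lemma category_functor_category: "category (functor_category C D)"
proof
  let ?V = "functor_category C D"
  show "Dom ?V f \<in> Obj ?V" "Cod ?V f \<in> Obj ?V" if "f \<in> Arr ?V" for f
    using that by (auto simp: functor_category_simps nat_trans_def)
  show "Ide ?V X \<in> hom ?V X X" if "X \<in> Obj ?V" for X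
    using that by (auto simp: hom_def functor_category_simps nat_trans_ide)
  show "g \<cdot>\<^bsub>?V\<^esub> f \<in> hom ?V X Z" if "f \<in> hom ?V X Y" "g \<in> hom ?V Y Z" for f g X Y Z
    using that by (auto simp: hom_def functor_category_simps nat_trans_cmp)
  show "Ide ?V Y \<cdot>\<^bsub>?V\<^esub> f = f" "f \<cdot>\<^bsub>?V\<^esub> Ide ?V X = f" if hom: "f \<in> hom ?V X Y" for f X Y
  proof -
    obtain t where f: "f = (X, Y, t)" "nat_trans C D X Y t"
      using hom by (auto simp: hom_def functor_category_simps)
    interpret nat_trans C D X Y t by fact
    show "Ide ?V Y \<cdot>\<^bsub>?V\<^esub> f = f" "f \<cdot>\<^bsub>?V\<^esub> Ide ?V X = f"
      using comp_ext by (auto simp: f functor_category_simps extensional_def)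
  qed
  show "(h \<cdot>\<^bsub>?V\<^esub> g) \<cdot>\<^bsub>?V\<^esub> f = h \<cdot>\<^bsub>?V\<^esub> (g \<cdot>\<^bsub>?V\<^esub> f)"
    if hom: "f \<in> hom ?V W X" "g \<in> hom ?V X Y" "h \<in> hom ?V Y Z" for f g h W X Y Z
  proof -
    obtain t u v where f: "f = (W, X, t)" "nat_trans C D W X t" "g = (X, Y, u)" "nat_trans C D X Y u"
      "h = (Y, Z, v)" "nat_trans C D Y Z v"
      using hom by (auto simp: hom_def functor_category_simps)
    interpret t: nat_trans C D W X t by fact
    interpret u: nat_trans C D X Y u by fact
    interpret v: nat_trans C D Y Z v by fact
    show ?thesis by (auto simp: f functor_category_simps t.source.target.assoc intro!: restrict_ext)
  qed
qed

section \<open>Indexed categories\<close>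

abbreviation id_inv :: "('a, 'f, 'm, 'o, 'r) indexed \<Rightarrow> 'a \<Rightarrow> 'o \<Rightarrow> 'r" where
  "id_inv L A X \<equiv> inv_arrow (Fib L A) (ThId L A X)"

text \<open>The object \<open>A\<close>, meant as the source of \<open>f\<close>, is an explicit
  argument: an inverse is taken in a given category, and \<open>ThCmp L f g Z\<close> does not name
  its fibre.\<close>

abbreviation cmp_inv :: "('a, 'f, 'm, 'o, 'r) indexed \<Rightarrow> 'a \<Rightarrow> 'f \<Rightarrow> 'f \<Rightarrow> 'o \<Rightarrow> 'r" where
  "cmp_inv L A f g Z \<equiv> inv_arrow (Fib L A) (ThCmp L f g Z)"

section \<open>Typing of 1-cells and 2-cells\<close>

context bicategory
begin

lemma hom1_iff: "f \<in> hom1 B A C \<longleftrightarrow> f \<in> Obj (Vert B) \<and> Src B f = A \<and> Trg B f = C"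
  by (auto simp: hom1_def)

lemma hom2_iff: "m \<in> hom2 B f g \<longleftrightarrow> m \<in> Arr (Vert B) \<and> Dom (Vert B) m = f \<and> Cod (Vert B) m = g"
  by (auto simp: hom_def)

lemma one_simps [simp]:
  assumes "A \<in> Zero B"
  shows "One B A \<in> Obj (Vert B)" "Src B (One B A) = A" "Trg B (One B A) = A"
  using one_hom1[OF assms] by (auto simp: hom1_iff)

lemma hcmp_simps [simp]:
  assumes "f \<in> Obj (Vert B)" "g \<in> Obj (Vert B)" "Trg B f = Src B g"
  shows "g \<star>\<^bsub>B\<^esub> f \<in> Obj (Vert B)" "Src B (g \<star>\<^bsub>B\<^esub> f) = Src B f" "Trg B (g \<star>\<^bsub>B\<^esub> f) = Trg B g"
  using hcmp_hom1[of f _ _ g] assms by (auto simp: hom1_iff)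

lemma hom1_zero:
  assumes "f \<in> hom1 B A C"
  shows "A \<in> Zero B" "C \<in> Zero B"
  using assms src_zero trg_zero by (auto simp: hom1_iff)

text \<open>A 2-cell joins parallel 1-cells only, so it is enough to type one end of it.\<close>

lemma cell_cod:
  assumes "f \<in> hom1 B A C" "m \<in> hom2 B f g"
  shows "g \<in> hom1 B A C"
  using src_two[OF assms(2)] trg_two[OF assms(2)] assms by (auto simp: hom1_iff hom2_iff)

end

section \<open>Fibres, pullbacks and the coherence isomorphisms\<close>

context indexed_category
begin

lemmas fib_simps [simp] =
  category.cmp_arr[OF fib_category] category.ide_arr[OF fib_category]
  category.cmp_ide_left[OF fib_category] category.cmp_ide_right[OF fib_category]
  category.dom_obj[OF fib_category] category.cod_obj[OF fib_category]

lemmas fib_assoc = category.assoc[OF fib_category]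

lemma pull_simps [simp]:
  assumes "f \<in> Obj (Vert B)" "Src B f = A" "u \<in> Arr (Fib L (Trg B f))"
  shows "FAr (Pull L f) u \<in> Arr (Fib L A)"
    "Dom (Fib L A) (FAr (Pull L f) u) = FOb (Pull L f) (Dom (Fib L (Trg B f)) u)"
    "Cod (Fib L A) (FAr (Pull L f) u) = FOb (Pull L f) (Cod (Fib L (Trg B f)) u)"
  using assms cat_functor.fun_arr[OF pull_functor, of f A "Trg B f" u]
  by (auto simp: base.hom1_iff)

lemma pull_obj [simp]:
  assumes "f \<in> Obj (Vert B)" "Src B f = A" "U \<in> Obj (Fib L (Trg B f))"
  shows "FOb (Pull L f) U \<in> Obj (Fib L A)"
  using assms cat_functor.FOb_obj[OF pull_functor, of f A "Trg B f" U]
  by (auto simp: base.hom1_iff)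

lemma pull_ide [simp]:
  assumes "f \<in> Obj (Vert B)" "Trg B f = C" "U \<in> Obj (Fib L C)"
  shows "FAr (Pull L f) (Ide (Fib L C) U) = Ide (Fib L (Src B f)) (FOb (Pull L f) U)"
  using assms cat_functor.FAr_ide[OF pull_functor, of f _ C U]
  by (auto simp: base.hom1_iff)

lemma pull_cmp:
  assumes "f \<in> Obj (Vert B)" "Trg B f = C" "u \<in> Arr (Fib L C)" "v \<in> Arr (Fib L C)"
    "Cod (Fib L C) u = Dom (Fib L C) v"
  shows "FAr (Pull L f) (v \<cdot>\<^bsub>Fib L C\<^esub> u) =
     FAr (Pull L f) v \<cdot>\<^bsub>Fib L (Src B f)\<^esub> FAr (Pull L f) u"
  using assms cat_functor.fun_cmp[OF pull_functor, of f _ C u v]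
  by (auto simp: base.hom1_iff)

lemma act_simps [simp]:
  assumes "m \<in> Arr (Vert B)" "Src B (Dom (Vert B) m) = A" "U \<in> Obj (Fib L (Trg B (Dom (Vert B) m)))"
  shows "Act L m U \<in> Arr (Fib L A)"
    "Dom (Fib L A) (Act L m U) = FOb (Pull L (Dom (Vert B) m)) U"
    "Cod (Fib L A) (Act L m U) = FOb (Pull L (Cod (Vert B) m)) U"
  using nat_trans.trans_arr[OF act_nat_trans, of "Dom (Vert B) m" A "Trg B (Dom (Vert B) m)" m _ U]
    assms by (auto simp: base.hom1_iff base.hom2_iff)

lemma act_natural:
  assumes "m \<in> hom2 B f g" "f \<in> hom1 B A C" "u \<in> hom (Fib L C) X Y"
  shows "FAr (Pull L g) u \<cdot>\<^bsub>Fib L A\<^esub> Act L m X = Act L m Y \<cdot>\<^bsub>Fib L A\<^esub> FAr (Pull L f) u"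
  using nat_trans.naturality[OF act_nat_trans] assms by blast

lemma th_id_simps [simp]:
  assumes "A \<in> Zero B" "X \<in> Obj (Fib L A)"
  shows "ThId L A X \<in> Arr (Fib L A)" "Dom (Fib L A) (ThId L A X) = X"
    "Cod (Fib L A) (ThId L A X) = FOb (Pull L (One B A)) X"
    "id_inv L A X \<in> Arr (Fib L A)" "Cod (Fib L A) (id_inv L A X) = X"
    "Dom (Fib L A) (id_inv L A X) = FOb (Pull L (One B A)) X"
    "id_inv L A X \<cdot>\<^bsub>Fib L A\<^esub> ThId L A X = Ide (Fib L A) X"
    "ThId L A X \<cdot>\<^bsub>Fib L A\<^esub> id_inv L A X = Ide (Fib L A) (FOb (Pull L (One B A)) X)"
proof -
  interpret nat_iso "Fib L A" "Fib L A" "id_functor (Fib L A)" "Pull L (One B A)" "ThId L A"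
    by (rule th_id) fact
  show "ThId L A X \<in> Arr (Fib L A)" and dom: "Dom (Fib L A) (ThId L A X) = X"
    and cod: "Cod (Fib L A) (ThId L A X) = FOb (Pull L (One B A)) X"
    using trans_arr[OF assms(2)] assms(2) by (auto simp: id_functor_def)
  note inv = category.inv_arr[OF fib_category[OF assms(1)] comp_iso[OF assms(2)]]
  show "id_inv L A X \<in> Arr (Fib L A)" "Cod (Fib L A) (id_inv L A X) = X"
    "Dom (Fib L A) (id_inv L A X) = FOb (Pull L (One B A)) X"
    "id_inv L A X \<cdot>\<^bsub>Fib L A\<^esub> ThId L A X = Ide (Fib L A) X"
    "ThId L A X \<cdot>\<^bsub>Fib L A\<^esub> id_inv L A X = Ide (Fib L A) (FOb (Pull L (One B A)) X)"
    using inv by (simp_all add: dom cod)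
qed

lemma th_id_natural:
  assumes "A \<in> Zero B" "u \<in> hom (Fib L A) X Y"
  shows "FAr (Pull L (One B A)) u \<cdot>\<^bsub>Fib L A\<^esub> ThId L A X = ThId L A Y \<cdot>\<^bsub>Fib L A\<^esub> u"
proof -
  interpret nat_iso "Fib L A" "Fib L A" "id_functor (Fib L A)" "Pull L (One B A)" "ThId L A"
    by (rule th_id) fact
  show ?thesis using naturality[OF assms(2)] assms(2) by (auto simp: id_functor_def hom_def)
qed

lemma th_cmp_simps [simp]:
  assumes "f \<in> Obj (Vert B)" "g \<in> Obj (Vert B)" "Trg B f = Src B g" "Src B f = A"
    "Z \<in> Obj (Fib L (Trg B g))"
  shows "ThCmp L f g Z \<in> Arr (Fib L A)"
    "Dom (Fib L A) (ThCmp L f g Z) = FOb (Pull L f) (FOb (Pull L g) Z)"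
    "Cod (Fib L A) (ThCmp L f g Z) = FOb (Pull L (g \<star>\<^bsub>B\<^esub> f)) Z"
    "cmp_inv L A f g Z \<in> Arr (Fib L A)"
    "Cod (Fib L A) (cmp_inv L A f g Z) = FOb (Pull L f) (FOb (Pull L g) Z)"
    "Dom (Fib L A) (cmp_inv L A f g Z) = FOb (Pull L (g \<star>\<^bsub>B\<^esub> f)) Z"
    "cmp_inv L A f g Z \<cdot>\<^bsub>Fib L A\<^esub> ThCmp L f g Z = Ide (Fib L A) (FOb (Pull L f) (FOb (Pull L g) Z))"
    "ThCmp L f g Z \<cdot>\<^bsub>Fib L A\<^esub> cmp_inv L A f g Z = Ide (Fib L A) (FOb (Pull L (g \<star>\<^bsub>B\<^esub> f)) Z)"
proof -
  have A: "A \<in> Zero B" using assms base.src_zero by auto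
  interpret nat_iso "Fib L (Trg B g)" "Fib L A" "comp_functor (Fib L (Trg B g)) (Pull L f) (Pull L g)"
    "Pull L (g \<star>\<^bsub>B\<^esub> f)" "ThCmp L f g"
    using assms by (intro th_cmp) (auto simp: base.hom1_iff)
  show "ThCmp L f g Z \<in> Arr (Fib L A)"
    and dom: "Dom (Fib L A) (ThCmp L f g Z) = FOb (Pull L f) (FOb (Pull L g) Z)"
    and cod: "Cod (Fib L A) (ThCmp L f g Z) = FOb (Pull L (g \<star>\<^bsub>B\<^esub> f)) Z"
    using trans_arr[OF assms(5)] assms(5) by auto
  note inv = category.inv_arr[OF fib_category[OF A] comp_iso[OF assms(5)]]
  show "cmp_inv L A f g Z \<in> Arr (Fib L A)"
    "Cod (Fib L A) (cmp_inv L A f g Z) = FOb (Pull L f) (FOb (Pull L g) Z)"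
    "Dom (Fib L A) (cmp_inv L A f g Z) = FOb (Pull L (g \<star>\<^bsub>B\<^esub> f)) Z"
    "cmp_inv L A f g Z \<cdot>\<^bsub>Fib L A\<^esub> ThCmp L f g Z = Ide (Fib L A) (FOb (Pull L f) (FOb (Pull L g) Z))"
    "ThCmp L f g Z \<cdot>\<^bsub>Fib L A\<^esub> cmp_inv L A f g Z = Ide (Fib L A) (FOb (Pull L (g \<star>\<^bsub>B\<^esub> f)) Z)"
    using inv by (simp_all add: dom cod)
qed

lemma th_cmp_natural:
  assumes "f \<in> hom1 B A C" "g \<in> hom1 B C E" "u \<in> hom (Fib L E) X Y"
  shows "FAr (Pull L (g \<star>\<^bsub>B\<^esub> f)) u \<cdot>\<^bsub>Fib L A\<^esub> ThCmp L f g X =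
    ThCmp L f g Y \<cdot>\<^bsub>Fib L A\<^esub> FAr (Pull L f) (FAr (Pull L g) u)"
proof -
  interpret nat_iso "Fib L E" "Fib L A" "comp_functor (Fib L E) (Pull L f) (Pull L g)"
    "Pull L (g \<star>\<^bsub>B\<^esub> f)" "ThCmp L f g"
    using assms by (intro th_cmp) auto
  show ?thesis using naturality[OF assms(3)] assms(3) by (auto simp: hom_def)
qed

section \<open>Coherence laws for the inverse isomorphisms\<close>

lemmas transpose = category.transpose_square[OF fib_category]

lemma th_id_inverse:
  assumes "A \<in> Zero B" "X \<in> Obj (Fib L A)"
  shows "inverse_arrows (Fib L A) (ThId L A X) (id_inv L A X)"
  using assms by (simp add: inverse_arrows_def hom_def)

lemma th_cmp_inverse:
  assumes "f \<in> hom1 B A C" "g \<in> hom1 B C E" "Z \<in> Obj (Fib L E)"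
  shows "inverse_arrows (Fib L A) (ThCmp L f g Z) (cmp_inv L A f g Z)"
  using assms by (simp add: inverse_arrows_def hom_def base.hom1_iff)

lemma pull_inverse:
  assumes "f \<in> hom1 B A C" "inverse_arrows (Fib L C) u v"
  shows "inverse_arrows (Fib L A) (FAr (Pull L f) u) (FAr (Pull L f) v)"
  using cat_functor.fun_inverse_arrows[OF pull_functor] assms .

lemma fib_obj:
  assumes "u \<in> hom (Fib L A) X Y" "A \<in> Zero B"
  shows "X \<in> Obj (Fib L A)" "Y \<in> Obj (Fib L A)"
  using assms fib_simps by (auto simp: hom_def)

text \<open>Naturality of theta_A, transposed.\<close>

lemma id_inv_natural:
  assumes "A \<in> Zero B" "u \<in> hom (Fib L A) X Y"
  shows "id_inv L A Y \<cdot>\<^bsub>Fib L A\<^esub> FAr (Pull L (One B A)) u = u \<cdot>\<^bsub>Fib L A\<^esub> id_inv L A X"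
  using fib_obj[OF assms(2,1)] assms
  by (intro transpose[OF _ th_id_inverse th_id_inverse] th_id_natural) (simp_all add: hom_def)

text \<open>Naturality of theta_{f,g} in the fibre arrow, transposed.\<close>

lemma cmp_inv_natural:
  assumes "f \<in> hom1 B A C" "g \<in> hom1 B C E" "u \<in> hom (Fib L E) X Y"
  shows "cmp_inv L A f g Y \<cdot>\<^bsub>Fib L A\<^esub> FAr (Pull L (g \<star>\<^bsub>B\<^esub> f)) u =
    FAr (Pull L f) (FAr (Pull L g) u) \<cdot>\<^bsub>Fib L A\<^esub> cmp_inv L A f g X"
proof -
  have "A \<in> Zero B" "E \<in> Zero B"
    using base.hom1_zero assms(1,2) by blast+
  with fib_obj[OF assms(3)] assms show ?thesis
    by (intro transpose[OF _ th_cmp_inverse th_cmp_inverse] th_cmp_natural)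
      (simp_all add: hom_def base.hom1_iff)
qed

text \<open>Naturality of theta_{f,g} in the 1-cells, transposed. It is what makes the backward half
  of a composite optic respect the coend relation.\<close>

lemma cmp_inv_natural_cells:
  assumes f: "f \<in> hom1 B A C" and g: "g \<in> hom1 B C E"
    and m: "m \<in> hom2 B f f'" and n: "n \<in> hom2 B g g'" and U: "U \<in> Obj (Fib L E)"
  shows "cmp_inv L A f' g' U \<cdot>\<^bsub>Fib L A\<^esub> Act L (n \<diamondop>\<^bsub>B\<^esub> m) U =
    (Act L m (FOb (Pull L g') U) \<cdot>\<^bsub>Fib L A\<^esub> FAr (Pull L f) (Act L n U)) \<cdot>\<^bsub>Fib L A\<^esub>
      cmp_inv L A f g U"
proof -
  have 0: "A \<in> Zero B" by (rule base.hom1_zero[OF f])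
  have f': "f' \<in> hom1 B A C" and g': "g' \<in> hom1 B C E"
    using f g m n base.cell_cod by blast+
  show ?thesis
    using base.hcmp2_hom2[OF f g m n] assms f' g' 0
    by (intro transpose[OF 0 th_cmp_inverse[OF f g U] th_cmp_inverse[OF f' g' U]] th_natural[OF assms])
      (simp_all add: hom_def base.hom1_iff)
qed

text \<open>The associativity axiom relates the two composites of thetas out of the threefold
  pullback by the action of the associator; passing to the inverses of both composites turns it into
  this law.\<close>

lemma cmp_inv_assoc:
  assumes f: "f \<in> hom1 B W X" and g: "g \<in> hom1 B X Y" and h: "h \<in> hom1 B Y Z"
    and U: "U \<in> Obj (Fib L Z)"
  shows "(cmp_inv L W f g (FOb (Pull L h) U) \<cdot>\<^bsub>Fib L W\<^esub> cmp_inv L W (g \<star>\<^bsub>B\<^esub> f) h U) \<cdot>\<^bsub>Fib L W\<^esub>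
      Act L (Assoc B h g f) U =
    FAr (Pull L f) (cmp_inv L X g h U) \<cdot>\<^bsub>Fib L W\<^esub> cmp_inv L W f (h \<star>\<^bsub>B\<^esub> g) U"
proof -
  have 0: "W \<in> Zero B" by (rule base.hom1_zero[OF f])
  have hU: "FOb (Pull L h) U \<in> Obj (Fib L Y)"
    using h U by (simp add: base.hom1_iff)
  have hg: "h \<star>\<^bsub>B\<^esub> g \<in> hom1 B X Z" and gf: "g \<star>\<^bsub>B\<^esub> f \<in> hom1 B W Y"
    using f g h by (auto simp: base.hom1_iff)
  note cmp = category.inverse_arrows_cmp[OF fib_category[OF 0]]
  note simps = hom_def base.hom1_iff
  let ?p = "ThCmp L f (h \<star>\<^bsub>B\<^esub> g) U \<cdot>\<^bsub>Fib L W\<^esub> FAr (Pull L f) (ThCmp L g h U)"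
  let ?p' = "FAr (Pull L f) (cmp_inv L X g h U) \<cdot>\<^bsub>Fib L W\<^esub> cmp_inv L W f (h \<star>\<^bsub>B\<^esub> g) U"
  let ?q = "ThCmp L (g \<star>\<^bsub>B\<^esub> f) h U \<cdot>\<^bsub>Fib L W\<^esub> ThCmp L f g (FOb (Pull L h) U)"
  let ?q' = "cmp_inv L W f g (FOb (Pull L h) U) \<cdot>\<^bsub>Fib L W\<^esub> cmp_inv L W (g \<star>\<^bsub>B\<^esub> f) h U"
  have p: "inverse_arrows (Fib L W) ?p ?p'"
    using f g h U by (intro cmp pull_inverse[OF f] th_cmp_inverse[OF g h U] th_cmp_inverse[OF f hg U])
       (simp add: simps)
  have q: "inverse_arrows (Fib L W) ?q ?q'"
    using f g h U by (intro cmp th_cmp_inverse[OF f g hU] th_cmp_inverse[OF gf h U])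
       (simp add: simps)
  \<comment> \<open>The axiom is read as a square with sides \<open>?p\<close> and \<open>?q\<close>
    whose fourth side is the identity of the threefold pullback.\<close>
  have "?q' \<cdot>\<^bsub>Fib L W\<^esub> Act L (Assoc B h g f) U =
      Ide (Fib L W) (FOb (Pull L f) (FOb (Pull L g) (FOb (Pull L h) U))) \<cdot>\<^bsub>Fib L W\<^esub> ?p'"
    using f g h U 0 base.assoc_hom2[OF f g h] th_assoc[OF f g h U]
    by (intro transpose[OF 0 p q]) (simp_all add: simps)
  then show ?thesis
    using f g h U 0 by (simp add: simps)
qed

text \<open>By \<open>th_lunit\<close> the action of the unitor is a left inverse of an invertible
  composite of thetas, hence is its inverse. The explicit formula serves to reduce backward
  halves.\<close>

lemma act_lunit:
  assumes f: "f \<in> hom1 B A C" and U: "U \<in> Obj (Fib L C)"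
  shows "Act L (LUnit B f) U =
    FAr (Pull L f) (id_inv L C U) \<cdot>\<^bsub>Fib L A\<^esub> cmp_inv L A f (One B C) U"
proof -
  have 0: "A \<in> Zero B" and C: "C \<in> Zero B"
    using base.hom1_zero[OF f] .
  note cmp = category.inverse_arrows_cmp[OF fib_category[OF 0]]
  note ide = category.inverse_arrows_ide[OF fib_category[OF 0]]
  note simps = hom_def base.hom1_iff
  let ?p = "ThCmp L f (One B C) U \<cdot>\<^bsub>Fib L A\<^esub> FAr (Pull L f) (ThId L C U)"
  let ?p' = "FAr (Pull L f) (id_inv L C U) \<cdot>\<^bsub>Fib L A\<^esub> cmp_inv L A f (One B C) U"
  let ?i = "Ide (Fib L A) (FOb (Pull L f) U)"
  have p: "inverse_arrows (Fib L A) ?p ?p'"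
    using f U C
    by (intro cmp pull_inverse[OF f] th_id_inverse th_cmp_inverse[OF f base.one_hom1[OF C] U])
       (simp_all add: simps)
  have q: "inverse_arrows (Fib L A) ?i ?i"
    using f U by (intro ide) (simp add: simps)
  have "?i \<cdot>\<^bsub>Fib L A\<^esub> Act L (LUnit B f) U = ?i \<cdot>\<^bsub>Fib L A\<^esub> ?p'"
    using f U 0 C base.lunit_hom2[OF f] th_lunit[OF f U]
    by (intro transpose[OF 0 p q]) (simp_all add: simps)
  then show ?thesis
    using f U 0 C base.lunit_hom2[OF f] by (simp add: simps)
qed

text \<open>As for \<open>act_lunit\<close>, from \<open>th_runit\<close>.\<close>

lemma act_runit:
  assumes f: "f \<in> hom1 B A C" and U: "U \<in> Obj (Fib L C)"
  shows "Act L (RUnit B f) U =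
    id_inv L A (FOb (Pull L f) U) \<cdot>\<^bsub>Fib L A\<^esub> cmp_inv L A (One B A) f U"
proof -
  have 0: "A \<in> Zero B"
    by (rule base.hom1_zero[OF f])
  note cmp = category.inverse_arrows_cmp[OF fib_category[OF 0]]
  note ide = category.inverse_arrows_ide[OF fib_category[OF 0]]
  note simps = hom_def base.hom1_iff
  let ?p = "ThCmp L (One B A) f U \<cdot>\<^bsub>Fib L A\<^esub> ThId L A (FOb (Pull L f) U)"
  let ?p' = "id_inv L A (FOb (Pull L f) U) \<cdot>\<^bsub>Fib L A\<^esub> cmp_inv L A (One B A) f U"
  let ?i = "Ide (Fib L A) (FOb (Pull L f) U)"
  have p: "inverse_arrows (Fib L A) ?p ?p'"
    using f U 0
    by (intro cmp th_id_inverse th_cmp_inverse[OF base.one_hom1[OF 0] f U]) (simp_all add: simps)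
  have q: "inverse_arrows (Fib L A) ?i ?i"
    using f U by (intro ide) (simp add: simps)
  have "?i \<cdot>\<^bsub>Fib L A\<^esub> Act L (RUnit B f) U = ?i \<cdot>\<^bsub>Fib L A\<^esub> ?p'"
    using f U 0 base.runit_hom2[OF f] th_runit[OF f U]
    by (intro transpose[OF 0 p q]) (simp_all add: simps)
  then show ?thesis
    using f U 0 base.runit_hom2[OF f] by (simp add: simps)
qed

end

section \<open>Optics\<close>

text \<open>There is no value category here: facts about optics are used inside every Tambara
  representation, and also for \<open>iota_op\<close>, whose values are the optics
  themselves.\<close>

locale optics = left: indexed_category B L + right: indexed_category B R
  for B :: "('a, 'f, 'm) bicat"
    and L :: "('a, 'f, 'm, 'lo, 'lr) indexed"
    and R :: "('a, 'f, 'm, 'ro, 'rr) indexed"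
begin

abbreviation "opt \<equiv> optic B L R"
abbreviation "reps \<equiv> optic_reps B L R"
abbreviation "step \<equiv> optic_step B L R"
abbreviation "cls \<equiv> optic_class B L R"
abbreviation "rcmp \<equiv> optic_rep_cmp B L R"
abbreviation "OptOb \<equiv> Obj (Optic B L R)"

section \<open>Representatives and the generating relation\<close>

lemma reps_iff:
  "(f, l, r) \<in> reps (A, X, X') (C, Y, Y') \<longleftrightarrow> f \<in> hom1 B A C \<and>
     l \<in> hom (Fib L A) X (FOb (Pull L f) Y) \<and> r \<in> hom (Fib R A) (FOb (Pull R f) Y') X'"
  by (simp add: optic_reps_def)

lemma Optic_obj_iff:
  "(A, X, X') \<in> OptOb \<longleftrightarrow> A \<in> Zero B \<and> X \<in> Obj (Fib L A) \<and> X' \<in> Obj (Fib R A)"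
  by (simp add: Optic_def)

text \<open>\<open>l'\<close> and \<open>r'\<close> are variables bound by equations, so that a step
  can be recognised between pairs that are not literally of the generating shape.\<close>

lemma stepI:
  assumes "f \<in> hom1 B A C" "m \<in> hom2 B f g" "l \<in> hom (Fib L A) X (FOb (Pull L f) Y)"
    "r \<in> hom (Fib R A) (FOb (Pull R g) Y') X'"
    "l' = Act L m Y \<cdot>\<^bsub>Fib L A\<^esub> l" "r' = r \<cdot>\<^bsub>Fib R A\<^esub> Act R m Y'"
  shows "step (A, X, X') (C, Y, Y') (g, l', r) (f, l, r')"
  unfolding assms(5,6) using assms(1-4) left.base.cell_cod[OF assms(1,2)] by (intro optic_step.intros)

text \<open>The identity 2-cell gives a step from a representative to itself. Reflexivity of the
  generating relation, before any closure, later allows one factor of a composite to stay fixed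
  while the other moves.\<close>

lemma step_refl:
  assumes "t \<in> reps S T" "T \<in> OptOb"
  shows "step S T t t"
proof -
  obtain A X X' where S: "S = (A, X, X')" by (cases S)
  obtain C Y Y' where T: "T = (C, Y, Y')" by (cases T)
  obtain f l r where t: "t = (f, l, r)" by (cases t)
  have *: "f \<in> hom1 B A C" "l \<in> hom (Fib L A) X (FOb (Pull L f) Y)"
      "r \<in> hom (Fib R A) (FOb (Pull R f) Y') X'"
    using assms(1) by (auto simp: S T t reps_iff)
  have "A \<in> Zero B" using left.base.hom1_zero *(1) by blast
  then show ?thesis
    unfolding S T t using * assms(2)
    by (intro stepI[where m = "Ide (Vert B) f"])
      (auto simp: T Optic_obj_iff hom_def left.base.hom1_iff left.act_ide[of f A C] right.act_ide[of f A C])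
qed

lemma step_reps:
  assumes "step S T t u" "T \<in> OptOb"
  shows "t \<in> reps S T" "u \<in> reps S T"
  using assms
  by (cases; auto simp: reps_iff Optic_obj_iff hom_def left.base.hom1_iff left.base.src_zero)+

lemma class_eq_iff: "cls S T t = cls S T u \<longleftrightarrow> equivclp (step S T) t u"
  unfolding optic_class_def
  by (auto intro: equivclp_sym equivclp_trans dest: equivclp_sym equivclp_trans)

lemma class_eqI: "step S T t u \<Longrightarrow> cls S T t = cls S T u"
  unfolding class_eq_iff by (rule r_into_equivclp)

lemma in_class_self: "t \<in> cls S T t"
  by (simp add: optic_class_def)

lemma class_reps:
  assumes "u \<in> cls S T t" "t \<in> reps S T" "T \<in> OptOb"
  shows "u \<in> reps S T"
proof -
  have "equivclp (step S T) t u" using assms(1) by (simp add: optic_class_def)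
  then show ?thesis
    using assms(2) by (induction rule: equivclp_induct) (auto dest: step_reps[OF _ assms(3)])
qed

lemma rcmp_reps:
  assumes "t \<in> reps S T" "u \<in> reps T U" "S \<in> OptOb" "T \<in> OptOb" "U \<in> OptOb"
  shows "rcmp S U u t \<in> reps S U"
proof -
  obtain A X X' where S: "S = (A, X, X')" by (cases S)
  obtain C Y Y' where T: "T = (C, Y, Y')" by (cases T)
  obtain E Z Z' where U: "U = (E, Z, Z')" by (cases U)
  show ?thesis
    using assms unfolding S T U
    by (cases t; cases u)
      (auto simp: reps_iff optic_rep_cmp_def Optic_obj_iff hom_def left.base.hom1_iff)
qed

text \<open>Steps along \<open>m\<close> and \<open>n\<close> combine to a step along the horizontal
  composite of \<open>n\<close> and \<open>m\<close>. The forward half uses naturality of theta in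
  the 1-cells and naturality of the action of \<open>m\<close>; the backward half uses the
  transposed form of the former and the latter for \<open>R\<close>. Both factors move at once, and
  \<open>step_refl\<close> recovers the case where only one does.\<close>

lemma step_rcmp:
  assumes t: "step S T t1 t0" and u: "step T U u1 u0"
    and ob: "S \<in> OptOb" "T \<in> OptOb" "U \<in> OptOb"
  shows "step S U (rcmp S U u1 t1) (rcmp S U u0 t0)"
proof -
  obtain E Z Z' where U: "U = (E, Z, Z')" by (cases U)
  from t obtain A X X' C Y Y' f f' m l1 r1 where t': "f \<in> hom1 B A C" "m \<in> hom2 B f f'"
    "l1 \<in> hom (Fib L A) X (FOb (Pull L f) Y)" "r1 \<in> hom (Fib R A) (FOb (Pull R f') Y') X'"
    and t_eq: "S = (A, X, X')" "T = (C, Y, Y')"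
      "t1 = (f', Act L m Y \<cdot>\<^bsub>Fib L A\<^esub> l1, r1)" "t0 = (f, l1, r1 \<cdot>\<^bsub>Fib R A\<^esub> Act R m Y')"
    by cases blast
  from u obtain g g' n l2 r2 where u': "g \<in> hom1 B C E" "n \<in> hom2 B g g'"
    "l2 \<in> hom (Fib L C) Y (FOb (Pull L g) Z)" "r2 \<in> hom (Fib R C) (FOb (Pull R g') Z') Y'"
    and u_eq: "u1 = (g', Act L n Z \<cdot>\<^bsub>Fib L C\<^esub> l2, r2)" "u0 = (g, l2, r2 \<cdot>\<^bsub>Fib R C\<^esub> Act R n Z')"
    unfolding U t_eq by cases blast
  have f': "f' \<in> hom1 B A C" and g': "g' \<in> hom1 B C E"
    using t' u' left.base.cell_cod by blast+
  have obj: "A \<in> Zero B" "X \<in> Obj (Fib L A)" "X' \<in> Obj (Fib R A)"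
    "C \<in> Zero B" "Y \<in> Obj (Fib L C)" "Y' \<in> Obj (Fib R C)"
    "E \<in> Zero B" "Z \<in> Obj (Fib L E)" "Z' \<in> Obj (Fib R E)"
    using ob by (auto simp: U t_eq Optic_obj_iff)
  note cells = left.base.hcmp2_hom2[OF t'(1) u'(1) t'(2) u'(2)]
  note simps = hom_def left.base.hom1_iff left.fib_assoc right.fib_assoc left.pull_cmp right.pull_cmp
  show ?thesis
    unfolding t_eq u_eq U optic_rep_cmp_def prod.case
  proof (intro stepI[where m = "n \<diamondop>\<^bsub>B\<^esub> m"] cells)
    let ?Act = "Act L (n \<diamondop>\<^bsub>B\<^esub> m) Z" and ?th = "ThCmp L f g Z" and ?th' = "ThCmp L f' g' Z"
    have "?Act \<cdot>\<^bsub>Fib L A\<^esub> (?th \<cdot>\<^bsub>Fib L A\<^esub> (FAr (Pull L f) l2 \<cdot>\<^bsub>Fib L A\<^esub> l1)) =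
      (?Act \<cdot>\<^bsub>Fib L A\<^esub> ?th) \<cdot>\<^bsub>Fib L A\<^esub> (FAr (Pull L f) l2 \<cdot>\<^bsub>Fib L A\<^esub> l1)"
      using t' u' f' g' cells obj by (simp add: simps)
    also have "\<dots> = ?th' \<cdot>\<^bsub>Fib L A\<^esub> ((Act L m (FOb (Pull L g') Z) \<cdot>\<^bsub>Fib L A\<^esub>
        FAr (Pull L f) (Act L n Z \<cdot>\<^bsub>Fib L C\<^esub> l2)) \<cdot>\<^bsub>Fib L A\<^esub> l1)"
      unfolding left.th_natural[OF t'(1) u'(1) t'(2) u'(2) obj(8)]
      using t' u' f' g' obj by (simp add: simps)
    \<comment> \<open>The action of \<open>m\<close> passes the pulled-back arrow, which changes the
      pullback along \<open>f\<close> into the pullback along \<open>f'\<close>.\<close>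
    also have "Act L m (FOb (Pull L g') Z) \<cdot>\<^bsub>Fib L A\<^esub> FAr (Pull L f) (Act L n Z \<cdot>\<^bsub>Fib L C\<^esub> l2) =
        FAr (Pull L f') (Act L n Z \<cdot>\<^bsub>Fib L C\<^esub> l2) \<cdot>\<^bsub>Fib L A\<^esub> Act L m Y"
      using t' u' f' g' obj by (intro left.act_natural[OF t'(2,1), symmetric]) (simp_all add: simps)
    also have "?th' \<cdot>\<^bsub>Fib L A\<^esub> ((FAr (Pull L f') (Act L n Z \<cdot>\<^bsub>Fib L C\<^esub> l2) \<cdot>\<^bsub>Fib L A\<^esub> Act L m Y)
          \<cdot>\<^bsub>Fib L A\<^esub> l1) =
        ?th' \<cdot>\<^bsub>Fib L A\<^esub> (FAr (Pull L f') (Act L n Z \<cdot>\<^bsub>Fib L C\<^esub> l2) \<cdot>\<^bsub>Fib L A\<^esub>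
          (Act L m Y \<cdot>\<^bsub>Fib L A\<^esub> l1))"
      using t' u' f' g' obj by (simp add: simps)
    finally show "?th' \<cdot>\<^bsub>Fib L A\<^esub> (FAr (Pull L f') (Act L n Z \<cdot>\<^bsub>Fib L C\<^esub> l2) \<cdot>\<^bsub>Fib L A\<^esub>
          (Act L m Y \<cdot>\<^bsub>Fib L A\<^esub> l1)) =
        ?Act \<cdot>\<^bsub>Fib L A\<^esub> (?th \<cdot>\<^bsub>Fib L A\<^esub> (FAr (Pull L f) l2 \<cdot>\<^bsub>Fib L A\<^esub> l1))" ..
    let ?Act = "Act R (n \<diamondop>\<^bsub>B\<^esub> m) Z'" and ?th = "cmp_inv R A f g Z'" and ?th' = "cmp_inv R A f' g' Z'"
    have "(r1 \<cdot>\<^bsub>Fib R A\<^esub> (FAr (Pull R f') r2 \<cdot>\<^bsub>Fib R A\<^esub> ?th')) \<cdot>\<^bsub>Fib R A\<^esub> ?Act =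
      (r1 \<cdot>\<^bsub>Fib R A\<^esub> FAr (Pull R f') r2) \<cdot>\<^bsub>Fib R A\<^esub> (?th' \<cdot>\<^bsub>Fib R A\<^esub> ?Act)"
      using t' u' f' g' cells obj by (simp add: simps)
    also have "\<dots> = r1 \<cdot>\<^bsub>Fib R A\<^esub> ((FAr (Pull R f') r2 \<cdot>\<^bsub>Fib R A\<^esub> Act R m (FOb (Pull R g') Z')) \<cdot>\<^bsub>Fib R A\<^esub>
        (FAr (Pull R f) (Act R n Z') \<cdot>\<^bsub>Fib R A\<^esub> ?th))"
      unfolding right.cmp_inv_natural_cells[OF t'(1) u'(1) t'(2) u'(2) obj(9)]
      using t' u' f' g' obj by (simp add: simps)
    \<comment> \<open>The exchange now runs the other way, from the pullback along \<open>f'\<close>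
      to the pullback along \<open>f\<close>.\<close>
    also have "FAr (Pull R f') r2 \<cdot>\<^bsub>Fib R A\<^esub> Act R m (FOb (Pull R g') Z') =
        Act R m Y' \<cdot>\<^bsub>Fib R A\<^esub> FAr (Pull R f) r2"
      using t' u' f' g' obj by (intro right.act_natural[OF t'(2,1)]) (simp_all add: simps)
    also have "r1 \<cdot>\<^bsub>Fib R A\<^esub> ((Act R m Y' \<cdot>\<^bsub>Fib R A\<^esub> FAr (Pull R f) r2) \<cdot>\<^bsub>Fib R A\<^esub>
          (FAr (Pull R f) (Act R n Z') \<cdot>\<^bsub>Fib R A\<^esub> ?th)) =
        (r1 \<cdot>\<^bsub>Fib R A\<^esub> Act R m Y') \<cdot>\<^bsub>Fib R A\<^esub>
          (FAr (Pull R f) (r2 \<cdot>\<^bsub>Fib R C\<^esub> Act R n Z') \<cdot>\<^bsub>Fib R A\<^esub> ?th)"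
      using t' u' f' g' obj by (simp add: simps)
    finally show "(r1 \<cdot>\<^bsub>Fib R A\<^esub> Act R m Y') \<cdot>\<^bsub>Fib R A\<^esub>
          (FAr (Pull R f) (r2 \<cdot>\<^bsub>Fib R C\<^esub> Act R n Z') \<cdot>\<^bsub>Fib R A\<^esub> ?th) =
        (r1 \<cdot>\<^bsub>Fib R A\<^esub> (FAr (Pull R f') r2 \<cdot>\<^bsub>Fib R A\<^esub> ?th')) \<cdot>\<^bsub>Fib R A\<^esub> ?Act" ..
  qed (use t' u' f' g' obj in \<open>simp_all add: simps\<close>)
qed

text \<open>One factor is exchanged at a time, the fixed one moving along a reflexive step, so that
  induction along the equivalence closure needs only \<open>step_rcmp\<close>.\<close>

lemma class_rcmp:
  assumes "t \<in> reps S T" "u \<in> reps T U" "t' \<in> cls S T t" "u' \<in> cls T U u"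
    and ob: "S \<in> OptOb" "T \<in> OptOb" "U \<in> OptOb"
  shows "cls S U (rcmp S U u' t') = cls S U (rcmp S U u t)"
proof -
  have "equivclp (step S T) t t'" "equivclp (step T U) u u'"
    using assms by (auto simp: optic_class_def)
  have "cls S U (rcmp S U u t') = cls S U (rcmp S U u t)"
    using \<open>equivclp (step S T) t t'\<close>
  proof (induction rule: equivclp_induct)
    case (step y z)
    have "cls S U (rcmp S U u y) = cls S U (rcmp S U u z)"
      using step(2) step_rcmp[OF _ step_refl[OF assms(2) ob(3)] ob] class_eqI by metis
    with step(3) show ?case by simp
  qed simp
  \<comment> \<open>The second pass keeps \<open>t'\<close> fixed, so \<open>t'\<close> itself has
    to be a representative.\<close>
  moreover have t': "t' \<in> reps S T"
    using assms class_reps by blast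
  have "cls S U (rcmp S U u' t') = cls S U (rcmp S U u t')"
    using \<open>equivclp (step T U) u u'\<close>
  proof (induction rule: equivclp_induct)
    case (step y z)
    have "cls S U (rcmp S U y t') = cls S U (rcmp S U z t')"
      using step(2) step_rcmp[OF step_refl[OF t' ob(2)] _ ob] class_eqI by metis
    with step(3) show ?case by simp
  qed simp
  ultimately show ?thesis by simp
qed

section \<open>Arrows of \<open>Optic\<close> and their composition\<close>

lemma Optic_simps [simp]:
  "Dom (Optic B L R) (S, T, c) = S" "Cod (Optic B L R) (S, T, c) = T"
  "Dom (Optic B L R) (opt S T f l r) = S" "Cod (Optic B L R) (opt S T f l r) = T"
  by (simp_all add: Optic_def optic_def)

lemma optic_arr [simp]:
  assumes "(f, l, r) \<in> reps S T" "S \<in> OptOb" "T \<in> OptOb"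
  shows "opt S T f l r \<in> Arr (Optic B L R)"
  using assms by (auto simp: Optic_def optic_def optic_coend_def)

lemma Optic_arrE:
  assumes "x \<in> Arr (Optic B L R)"
  obtains S T f l r where "S \<in> OptOb" "T \<in> OptOb" "(f, l, r) \<in> reps S T" "x = opt S T f l r"
  using assms by (force simp: Optic_def optic_def optic_coend_def)

text \<open>By \<open>class_rcmp\<close> the union that defines composition runs over a constant
  family; the index sets are nonempty, since a class contains the triple it is formed from. The
  resulting triple is a variable, so a composite can be named before it is expanded.\<close>

lemma optic_cmp:
  assumes "(f, l1, r1) \<in> reps S T" "(g, l2, r2) \<in> reps T U"
    and ob: "S \<in> OptOb" "T \<in> OptOb" "U \<in> OptOb"
    and eq: "rcmp S U (g, l2, r2) (f, l1, r1) = (h, l, r)"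
  shows "opt T U g l2 r2 \<cdot>\<^bsub>Optic B L R\<^esub> opt S T f l1 r1 = opt S U h l r"
proof -
  have "(\<Union>u\<in>cls T U (g, l2, r2). \<Union>t\<in>cls S T (f, l1, r1). cls S U (rcmp S U u t)) =
    (\<Union>u\<in>cls T U (g, l2, r2). \<Union>t\<in>cls S T (f, l1, r1). cls S U (h, l, r))"
    using class_rcmp[OF assms(1,2) _ _ ob] by (intro SUP_cong refl) (simp add: eq)
  also have "\<dots> = cls S U (h, l, r)"
  proof -
    have "cls T U (g, l2, r2) \<noteq> {}" "cls S T (f, l1, r1) \<noteq> {}"
      using in_class_self by blast+
    then show ?thesis by simp
  qed
  finally show ?thesis
    by (simp add: optic_def Optic_def)
qed

text \<open>Optics with different representatives are identified below along a 2-cell: a right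
  unitor, a left unitor, an associator, or an arbitrary 2-cell in the case of
  extranaturality.\<close>

lemma optic_eqI:
  assumes "f \<in> hom1 B A C" "m \<in> hom2 B f g" "l \<in> hom (Fib L A) X (FOb (Pull L f) Y)"
    "r \<in> hom (Fib R A) (FOb (Pull R g) Y') X'"
    "l' = Act L m Y \<cdot>\<^bsub>Fib L A\<^esub> l" "r' = r \<cdot>\<^bsub>Fib R A\<^esub> Act R m Y'"
  shows "opt (A, X, X') (C, Y, Y') g l' r = opt (A, X, X') (C, Y, Y') f l r'"
  using class_eqI[OF stepI[OF assms]] by (simp add: optic_def)

section \<open>Composition with the image of \<open>iota\<close>\<close>

lemmas hom_simps = hom_def left.base.hom1_iff

lemma iota_obj [simp]:
  "X \<in> Obj (Fib L A) \<Longrightarrow> X' \<in> Obj (Fib R A) \<Longrightarrow> FOb (iota B L R A) (X, X') = (A, X, X')"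
  by (simp add: iota_def)

lemma iota_arr:
  assumes "u \<in> hom (Fib L A) X Y" "v \<in> hom (Fib R A) Y' X'"
  shows "FAr (iota B L R A) (u, v) = opt (A, X, X') (A, Y, Y') (One B A)
    (ThId L A Y \<cdot>\<^bsub>Fib L A\<^esub> u) (v \<cdot>\<^bsub>Fib R A\<^esub> id_inv R A Y')"
  using assms by (simp add: iota_def hom_def)

lemma iota_reps:
  assumes "A \<in> Zero B" "u \<in> hom (Fib L A) X Y" "v \<in> hom (Fib R A) Y' X'"
  shows "(One B A, ThId L A Y \<cdot>\<^bsub>Fib L A\<^esub> u, v \<cdot>\<^bsub>Fib R A\<^esub> id_inv R A Y') \<in> reps (A, X, X') (A, Y, Y')"
  using left.fib_obj[OF assms(2,1)] right.fib_obj[OF assms(3,1)] assms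
  by (simp add: reps_iff hom_simps)

text \<open>The composite has representative \<open>f\<close> after an identity 1-cell, so the claim
  is an equality along the right unitor. Naturality of theta_A frees \<open>l\<close> from the
  pullback along the identity, and the right unit coherence then cancels the thetas;
  \<open>id_inv_natural\<close> and \<open>act_runit\<close> do the same for the backward
  half.\<close>

lemma optic_cmp_iota:
  assumes f: "(f, l, r) \<in> reps (A, Y, Y') T" and T: "T \<in> OptOb" and A: "A \<in> Zero B"
    and u: "u \<in> hom (Fib L A) X Y" and v: "v \<in> hom (Fib R A) Y' X'"
  shows "opt (A, Y, Y') T f l r \<cdot>\<^bsub>Optic B L R\<^esub> FAr (iota B L R A) (u, v) =
    opt (A, X, X') T f (l \<cdot>\<^bsub>Fib L A\<^esub> u) (v \<cdot>\<^bsub>Fib R A\<^esub> r)"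
proof -
  obtain C Z Z' where T_eq: "T = (C, Z, Z')" by (cases T)
  have obj: "X \<in> Obj (Fib L A)" "X' \<in> Obj (Fib R A)" "Y \<in> Obj (Fib L A)" "Y' \<in> Obj (Fib R A)"
    "C \<in> Zero B" "Z \<in> Obj (Fib L C)" "Z' \<in> Obj (Fib R C)"
    using left.fib_obj[OF u A] right.fib_obj[OF v A] T by (auto simp: T_eq Optic_obj_iff)
  have f': "f \<in> hom1 B A C" "l \<in> hom (Fib L A) Y (FOb (Pull L f) Z)"
    "r \<in> hom (Fib R A) (FOb (Pull R f) Z') Y'"
    using f by (auto simp: T_eq reps_iff)
  note run = left.base.runit_hom2[OF f'(1)]
  note typing = f' u v A obj run
  note simps = hom_simps left.fib_assoc right.fib_assoc
  \<comment> \<open>\<open>l'\<close> and \<open>r'\<close> are the halves of the composite before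
    the unitor removes the extra identity 1-cell.\<close>
  define l' where "l' = ThCmp L (One B A) f Z \<cdot>\<^bsub>Fib L A\<^esub>
    (FAr (Pull L (One B A)) l \<cdot>\<^bsub>Fib L A\<^esub> (ThId L A Y \<cdot>\<^bsub>Fib L A\<^esub> u))"
  define r' where "r' = (v \<cdot>\<^bsub>Fib R A\<^esub> id_inv R A Y') \<cdot>\<^bsub>Fib R A\<^esub>
    (FAr (Pull R (One B A)) r \<cdot>\<^bsub>Fib R A\<^esub> cmp_inv R A (One B A) f Z')"
  have "opt (A, Y, Y') T f l r \<cdot>\<^bsub>Optic B L R\<^esub> FAr (iota B L R A) (u, v) =
      opt (A, X, X') T (f \<star>\<^bsub>B\<^esub> One B A) l' r'"
    unfolding iota_arr[OF u v] using f iota_reps[OF A u v] T A obj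
    by (intro optic_cmp) (auto simp: Optic_obj_iff optic_rep_cmp_def T_eq l'_def r'_def)
  also have "\<dots> = opt (A, X, X') T f (l \<cdot>\<^bsub>Fib L A\<^esub> u) (v \<cdot>\<^bsub>Fib R A\<^esub> r)"
    unfolding T_eq
  proof (rule optic_eqI[symmetric, OF _ run])
    have "l' = ThCmp L (One B A) f Z \<cdot>\<^bsub>Fib L A\<^esub>
      ((FAr (Pull L (One B A)) l \<cdot>\<^bsub>Fib L A\<^esub> ThId L A Y) \<cdot>\<^bsub>Fib L A\<^esub> u)"
      using typing by (simp add: l'_def simps)
    also have "\<dots> = (ThCmp L (One B A) f Z \<cdot>\<^bsub>Fib L A\<^esub> ThId L A (FOb (Pull L f) Z)) \<cdot>\<^bsub>Fib L A\<^esub>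
        (l \<cdot>\<^bsub>Fib L A\<^esub> u)"
      unfolding left.th_id_natural[OF A f'(2)] using typing by (simp add: simps)
    finally have "Act L (RUnit B f) Z \<cdot>\<^bsub>Fib L A\<^esub> l' =
        (Act L (RUnit B f) Z \<cdot>\<^bsub>Fib L A\<^esub> (ThCmp L (One B A) f Z \<cdot>\<^bsub>Fib L A\<^esub>
          ThId L A (FOb (Pull L f) Z))) \<cdot>\<^bsub>Fib L A\<^esub> (l \<cdot>\<^bsub>Fib L A\<^esub> u)"
      using typing by (simp add: simps)
    then show "l \<cdot>\<^bsub>Fib L A\<^esub> u = Act L (RUnit B f) Z \<cdot>\<^bsub>Fib L A\<^esub> l'"
      unfolding left.th_runit[OF f'(1) obj(6)] using typing by (simp add: simps)
    have "r' = v \<cdot>\<^bsub>Fib R A\<^esub> ((id_inv R A Y' \<cdot>\<^bsub>Fib R A\<^esub> FAr (Pull R (One B A)) r) \<cdot>\<^bsub>Fib R A\<^esub>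
        cmp_inv R A (One B A) f Z')"
      using typing by (simp add: r'_def simps)
    also have "\<dots> = (v \<cdot>\<^bsub>Fib R A\<^esub> r) \<cdot>\<^bsub>Fib R A\<^esub> Act R (RUnit B f) Z'"
      unfolding right.id_inv_natural[OF A f'(3)] right.act_runit[OF f'(1) obj(7)]
      using typing by (simp add: simps)
    finally show "r' = (v \<cdot>\<^bsub>Fib R A\<^esub> r) \<cdot>\<^bsub>Fib R A\<^esub> Act R (RUnit B f) Z'" .
  qed (use typing in \<open>simp_all add: simps l'_def\<close>)
  finally show ?thesis .
qed

text \<open>The counterpart of \<open>optic_cmp_iota\<close> along the left unitor. Here theta_C
  already sits inside the pullback along \<open>f\<close>, as in the left unit coherence, which
  therefore applies directly.\<close>

lemma iota_cmp_optic:
  assumes f: "(f, l, r) \<in> reps (A, X, X') (C, Y, Y')" and S: "(A, X, X') \<in> OptOb" and C: "C \<in> Zero B"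
    and u: "u \<in> hom (Fib L C) Y Z" and v: "v \<in> hom (Fib R C) Z' Y'"
  shows "FAr (iota B L R C) (u, v) \<cdot>\<^bsub>Optic B L R\<^esub> opt (A, X, X') (C, Y, Y') f l r =
    opt (A, X, X') (C, Z, Z') f (FAr (Pull L f) u \<cdot>\<^bsub>Fib L A\<^esub> l) (r \<cdot>\<^bsub>Fib R A\<^esub> FAr (Pull R f) v)"
proof -
  have obj: "A \<in> Zero B" "X \<in> Obj (Fib L A)" "X' \<in> Obj (Fib R A)" "Y \<in> Obj (Fib L C)" "Y' \<in> Obj (Fib R C)"
    "Z \<in> Obj (Fib L C)" "Z' \<in> Obj (Fib R C)"
    using left.fib_obj[OF u C] right.fib_obj[OF v C] S by (auto simp: Optic_obj_iff)
  have f': "f \<in> hom1 B A C" "l \<in> hom (Fib L A) X (FOb (Pull L f) Y)"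
    "r \<in> hom (Fib R A) (FOb (Pull R f) Y') X'"
    using f by (auto simp: reps_iff)
  note lun = left.base.lunit_hom2[OF f'(1)]
  note typing = f' u v C obj lun
  note simps = hom_simps left.fib_assoc right.fib_assoc left.pull_cmp right.pull_cmp
  define l' where "l' = ThCmp L f (One B C) Z \<cdot>\<^bsub>Fib L A\<^esub>
    (FAr (Pull L f) (ThId L C Z \<cdot>\<^bsub>Fib L C\<^esub> u) \<cdot>\<^bsub>Fib L A\<^esub> l)"
  define r' where "r' = r \<cdot>\<^bsub>Fib R A\<^esub>
    (FAr (Pull R f) (v \<cdot>\<^bsub>Fib R C\<^esub> id_inv R C Z') \<cdot>\<^bsub>Fib R A\<^esub> cmp_inv R A f (One B C) Z')"
  have "FAr (iota B L R C) (u, v) \<cdot>\<^bsub>Optic B L R\<^esub> opt (A, X, X') (C, Y, Y') f l r =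
      opt (A, X, X') (C, Z, Z') (One B C \<star>\<^bsub>B\<^esub> f) l' r'"
    unfolding iota_arr[OF u v] using f iota_reps[OF C u v] C obj
    by (intro optic_cmp) (auto simp: Optic_obj_iff optic_rep_cmp_def l'_def r'_def)
  also have "\<dots> = opt (A, X, X') (C, Z, Z') f (FAr (Pull L f) u \<cdot>\<^bsub>Fib L A\<^esub> l)
      (r \<cdot>\<^bsub>Fib R A\<^esub> FAr (Pull R f) v)"
  proof (rule optic_eqI[symmetric, OF _ lun])
    have "Act L (LUnit B f) Z \<cdot>\<^bsub>Fib L A\<^esub> l' =
        (Act L (LUnit B f) Z \<cdot>\<^bsub>Fib L A\<^esub> (ThCmp L f (One B C) Z \<cdot>\<^bsub>Fib L A\<^esub>
          FAr (Pull L f) (ThId L C Z))) \<cdot>\<^bsub>Fib L A\<^esub> (FAr (Pull L f) u \<cdot>\<^bsub>Fib L A\<^esub> l)"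
      using typing by (simp add: l'_def simps)
    then show "FAr (Pull L f) u \<cdot>\<^bsub>Fib L A\<^esub> l = Act L (LUnit B f) Z \<cdot>\<^bsub>Fib L A\<^esub> l'"
      unfolding left.th_lunit[OF f'(1) obj(6)] using typing by (simp add: simps)
    show "r' = (r \<cdot>\<^bsub>Fib R A\<^esub> FAr (Pull R f) v) \<cdot>\<^bsub>Fib R A\<^esub> Act R (LUnit B f) Z'"
      unfolding right.act_lunit[OF f'(1) obj(7)] using typing by (simp add: r'_def simps)
  qed (use typing in \<open>simp_all add: simps l'_def\<close>)
  finally show ?thesis .
qed

text \<open>The halves of the identity optic are theta_A and the inverse of theta'_A; composing them
  with identities changes nothing. In this form the unit laws are instances of
  \<open>optic_cmp_iota\<close> and \<open>iota_cmp_optic\<close>.\<close>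

lemma Ide_Optic:
  assumes "(A, X, X') \<in> OptOb"
  shows "Ide (Optic B L R) (A, X, X') = FAr (iota B L R A) (Ide (Fib L A) X, Ide (Fib R A) X')"
  using assms
  by (subst iota_arr[of _ _ X X _ X' X']) (simp_all add: Optic_def hom_def)

text \<open>The representatives of the two bracketings are linked by the associator. For the forward
  halves its action is absorbed by the associativity coherence of theta, together with naturality of
  theta_{f,g} at \<open>l3\<close>; for the backward halves the transposed forms of both laws are
  used, at \<open>r3\<close>.\<close>

lemma optic_assoc:
  assumes f: "(f, l1, r1) \<in> reps S T" and g: "(g, l2, r2) \<in> reps T U" and h: "(h, l3, r3) \<in> reps U V"
    and ob: "S \<in> OptOb" "T \<in> OptOb" "U \<in> OptOb" "V \<in> OptOb"
  shows "(opt U V h l3 r3 \<cdot>\<^bsub>Optic B L R\<^esub> opt T U g l2 r2) \<cdot>\<^bsub>Optic B L R\<^esub> opt S T f l1 r1 =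
    opt U V h l3 r3 \<cdot>\<^bsub>Optic B L R\<^esub> (opt T U g l2 r2 \<cdot>\<^bsub>Optic B L R\<^esub> opt S T f l1 r1)"
proof -
  obtain A X X' where S: "S = (A, X, X')" by (cases S)
  obtain C Y Y' where T: "T = (C, Y, Y')" by (cases T)
  obtain E Z Z' where U: "U = (E, Z, Z')" by (cases U)
  obtain G W W' where V: "V = (G, W, W')" by (cases V)
  have f': "f \<in> hom1 B A C" "l1 \<in> hom (Fib L A) X (FOb (Pull L f) Y)"
    "r1 \<in> hom (Fib R A) (FOb (Pull R f) Y') X'"
    and g': "g \<in> hom1 B C E" "l2 \<in> hom (Fib L C) Y (FOb (Pull L g) Z)"
    "r2 \<in> hom (Fib R C) (FOb (Pull R g) Z') Y'"
    and h': "h \<in> hom1 B E G" "l3 \<in> hom (Fib L E) Z (FOb (Pull L h) W)"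
    "r3 \<in> hom (Fib R E) (FOb (Pull R h) W') Z'"
    using f g h by (auto simp: S T U V reps_iff)
  have obj: "A \<in> Zero B" "X \<in> Obj (Fib L A)" "X' \<in> Obj (Fib R A)"
    "C \<in> Zero B" "Y \<in> Obj (Fib L C)" "Y' \<in> Obj (Fib R C)"
    "E \<in> Zero B" "Z \<in> Obj (Fib L E)" "Z' \<in> Obj (Fib R E)"
    "G \<in> Zero B" "W \<in> Obj (Fib L G)" "W' \<in> Obj (Fib R G)"
    using ob by (auto simp: S T U V Optic_obj_iff)
  note ass = left.base.assoc_hom2[OF f'(1) g'(1) h'(1)]
  note typing = f' g' h' obj ass
  note simps = hom_simps left.fib_assoc right.fib_assoc left.pull_cmp right.pull_cmp
  \<comment> \<open>The partial composites are kept as opaque triples: their typing comes from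
    \<open>rcmp_reps\<close>, and they are expanded only where a coherence law is applied.\<close>
  obtain hg l32 r32 where c32: "rcmp T V (h, l3, r3) (g, l2, r2) = (hg, l32, r32)"
    by (metis prod_cases3)
  obtain gf l21 r21 where c21: "rcmp S U (g, l2, r2) (f, l1, r1) = (gf, l21, r21)"
    by (metis prod_cases3)
  obtain p lp rp where cp: "rcmp S V (hg, l32, r32) (f, l1, r1) = (p, lp, rp)"
    by (metis prod_cases3)
  obtain q lq rq where cq: "rcmp S V (h, l3, r3) (gf, l21, r21) = (q, lq, rq)"
    by (metis prod_cases3)
  have reps: "(hg, l32, r32) \<in> reps T V" "(gf, l21, r21) \<in> reps S U"
    "(p, lp, rp) \<in> reps S V" "(q, lq, rq) \<in> reps S V"
    using rcmp_reps[OF g h] rcmp_reps[OF f g] ob c32 c21 rcmp_reps[OF f, of "(hg, l32, r32)" V]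
      rcmp_reps[of "(gf, l21, r21)" S U "(h, l3, r3)" V] h cp cq by auto
  note c = c32[symmetric] c21[symmetric] cp[symmetric] cq[symmetric]
  have 32: "hg = h \<star>\<^bsub>B\<^esub> g" "l32 = ThCmp L g h W \<cdot>\<^bsub>Fib L C\<^esub> (FAr (Pull L g) l3 \<cdot>\<^bsub>Fib L C\<^esub> l2)"
    "r32 = r2 \<cdot>\<^bsub>Fib R C\<^esub> (FAr (Pull R g) r3 \<cdot>\<^bsub>Fib R C\<^esub> cmp_inv R C g h W')"
    and 21: "gf = g \<star>\<^bsub>B\<^esub> f" "l21 = ThCmp L f g Z \<cdot>\<^bsub>Fib L A\<^esub> (FAr (Pull L f) l2 \<cdot>\<^bsub>Fib L A\<^esub> l1)"
    "r21 = r1 \<cdot>\<^bsub>Fib R A\<^esub> (FAr (Pull R f) r2 \<cdot>\<^bsub>Fib R A\<^esub> cmp_inv R A f g Z')"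
    using c by (simp_all add: S T U V optic_rep_cmp_def)
  have pq: "p = hg \<star>\<^bsub>B\<^esub> f" "lp = ThCmp L f hg W \<cdot>\<^bsub>Fib L A\<^esub> (FAr (Pull L f) l32 \<cdot>\<^bsub>Fib L A\<^esub> l1)"
    "rp = r1 \<cdot>\<^bsub>Fib R A\<^esub> (FAr (Pull R f) r32 \<cdot>\<^bsub>Fib R A\<^esub> cmp_inv R A f hg W')"
    "q = h \<star>\<^bsub>B\<^esub> gf" "lq = ThCmp L gf h W \<cdot>\<^bsub>Fib L A\<^esub> (FAr (Pull L gf) l3 \<cdot>\<^bsub>Fib L A\<^esub> l21)"
    "rq = r21 \<cdot>\<^bsub>Fib R A\<^esub> (FAr (Pull R gf) r3 \<cdot>\<^bsub>Fib R A\<^esub> cmp_inv R A gf h W')"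
    using c by (simp_all add: S T U V optic_rep_cmp_def)
  \<comment> \<open>The associator runs from \<open>p\<close>, which represents the left bracketing,
    to \<open>q\<close>; this fixes the orientation in which the halves are compared.\<close>
  have "opt S V q lq rq = opt S V p lp rp"
    unfolding S V
  proof (rule optic_eqI[where m = "Assoc B h g f"])
    show "Assoc B h g f \<in> hom2 B p q" using ass by (simp add: pq 32 21)
    show "p \<in> hom1 B A G" "lp \<in> hom (Fib L A) X (FOb (Pull L p) W)"
      "rq \<in> hom (Fib R A) (FOb (Pull R q) W') X'"
      using reps by (auto simp: S V reps_iff)
    have "Act L (Assoc B h g f) W \<cdot>\<^bsub>Fib L A\<^esub> lp =
        (Act L (Assoc B h g f) W \<cdot>\<^bsub>Fib L A\<^esub> (ThCmp L f (h \<star>\<^bsub>B\<^esub> g) W \<cdot>\<^bsub>Fib L A\<^esub>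
          FAr (Pull L f) (ThCmp L g h W))) \<cdot>\<^bsub>Fib L A\<^esub>
        (FAr (Pull L f) (FAr (Pull L g) l3) \<cdot>\<^bsub>Fib L A\<^esub> (FAr (Pull L f) l2 \<cdot>\<^bsub>Fib L A\<^esub> l1))"
      unfolding pq 32 using typing by (simp add: simps)
    also have "\<dots> = ThCmp L (g \<star>\<^bsub>B\<^esub> f) h W \<cdot>\<^bsub>Fib L A\<^esub> ((ThCmp L f g (FOb (Pull L h) W) \<cdot>\<^bsub>Fib L A\<^esub>
        FAr (Pull L f) (FAr (Pull L g) l3)) \<cdot>\<^bsub>Fib L A\<^esub> (FAr (Pull L f) l2 \<cdot>\<^bsub>Fib L A\<^esub> l1))"
      unfolding left.th_assoc[OF f'(1) g'(1) h'(1) obj(11)] using typing by (simp add: simps)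
    also have "\<dots> = lq"
      unfolding left.th_cmp_natural[OF f'(1) g'(1) h'(2), symmetric] pq 21
      using typing by (simp add: simps)
    finally show "lq = Act L (Assoc B h g f) W \<cdot>\<^bsub>Fib L A\<^esub> lp" ..
    have "rq = (r1 \<cdot>\<^bsub>Fib R A\<^esub> FAr (Pull R f) r2) \<cdot>\<^bsub>Fib R A\<^esub>
        ((cmp_inv R A f g Z' \<cdot>\<^bsub>Fib R A\<^esub> FAr (Pull R (g \<star>\<^bsub>B\<^esub> f)) r3) \<cdot>\<^bsub>Fib R A\<^esub>
          cmp_inv R A (g \<star>\<^bsub>B\<^esub> f) h W')"
      unfolding pq 21 using typing by (simp add: simps)
    also have "\<dots> = (r1 \<cdot>\<^bsub>Fib R A\<^esub> FAr (Pull R f) r2) \<cdot>\<^bsub>Fib R A\<^esub> (FAr (Pull R f) (FAr (Pull R g) r3) \<cdot>\<^bsub>Fib R A\<^esub>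
        (cmp_inv R A f g (FOb (Pull R h) W') \<cdot>\<^bsub>Fib R A\<^esub> cmp_inv R A (g \<star>\<^bsub>B\<^esub> f) h W'))"
      unfolding right.cmp_inv_natural[OF f'(1) g'(1) h'(3)] using typing by (simp add: simps)
    finally have "rq \<cdot>\<^bsub>Fib R A\<^esub> Act R (Assoc B h g f) W' =
        (r1 \<cdot>\<^bsub>Fib R A\<^esub> FAr (Pull R f) r2) \<cdot>\<^bsub>Fib R A\<^esub> (FAr (Pull R f) (FAr (Pull R g) r3) \<cdot>\<^bsub>Fib R A\<^esub>
        ((cmp_inv R A f g (FOb (Pull R h) W') \<cdot>\<^bsub>Fib R A\<^esub> cmp_inv R A (g \<star>\<^bsub>B\<^esub> f) h W')
          \<cdot>\<^bsub>Fib R A\<^esub> Act R (Assoc B h g f) W'))"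
      using typing by (simp add: simps)
    then show "rp = rq \<cdot>\<^bsub>Fib R A\<^esub> Act R (Assoc B h g f) W'"
      unfolding right.cmp_inv_assoc[OF f'(1) g'(1) h'(1) obj(12)] pq 32
      using typing by (simp add: simps)
  qed
  then show ?thesis
    using optic_cmp[OF g h ob(2-4) c32] optic_cmp[OF f g ob(1-3) c21]
      optic_cmp[OF f reps(1) ob(1,2,4) cp] optic_cmp[OF reps(2) h ob(1,3,4) cq] by simp
qed

section \<open>The category of optics\<close>

lemma Optic_homE:
  assumes "x \<in> hom (Optic B L R) S T"
  obtains f l r where "S \<in> OptOb" "T \<in> OptOb" "(f, l, r) \<in> reps S T" "x = opt S T f l r"
  using assms by (auto simp: hom_def elim: Optic_arrE)

lemma optic_hom:
  assumes "(f, l, r) \<in> reps S T" "S \<in> OptOb" "T \<in> OptOb"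
  shows "opt S T f l r \<in> hom (Optic B L R) S T"
  using assms by (simp add: hom_def)

lemma iota_hom:
  assumes "A \<in> Zero B" "u \<in> hom (Fib L A) X Y" "v \<in> hom (Fib R A) Y' X'"
  shows "FAr (iota B L R A) (u, v) \<in> hom (Optic B L R) (A, X, X') (A, Y, Y')"
  unfolding iota_arr[OF assms(2,3)] using assms left.fib_obj[OF assms(2,1)] right.fib_obj[OF assms(3,1)]
  by (intro optic_hom iota_reps) (auto simp: Optic_obj_iff)

lemma category_Optic: "category (Optic B L R)"
proof
  let ?O = "Optic B L R"
  show "Dom ?O f \<in> Obj ?O" "Cod ?O f \<in> Obj ?O" if "f \<in> Arr ?O" for f
    using that by (auto elim: Optic_arrE)
  show "Ide ?O S \<in> hom ?O S S" if "S \<in> Obj ?O" for S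
    using that by (cases S) (auto simp: Ide_Optic Optic_obj_iff hom_def[of "Fib _ _"] intro!: iota_hom)
  show "g \<cdot>\<^bsub>?O\<^esub> f \<in> hom ?O S U" if "f \<in> hom ?O S T" "g \<in> hom ?O T U" for f g S T U
  proof -
    from that(1) obtain f' l1 r1 where f: "S \<in> OptOb" "T \<in> OptOb" "(f', l1, r1) \<in> reps S T" "f = opt S T f' l1 r1"
      by (rule Optic_homE)
    from that(2) obtain g' l2 r2 where g: "U \<in> OptOb" "(g', l2, r2) \<in> reps T U" "g = opt T U g' l2 r2"
      by (rule Optic_homE)
    obtain h l r where "rcmp S U (g', l2, r2) (f', l1, r1) = (h, l, r)" by (metis prod_cases3)
    with f g show ?thesis
      using optic_cmp[of f' l1 r1 S T g' l2 r2 U h l r] rcmp_reps[of "(f', l1, r1)" S T "(g', l2, r2)" U]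
      by (auto intro: optic_hom)
  qed
  show "Ide ?O T \<cdot>\<^bsub>?O\<^esub> f = f" "f \<cdot>\<^bsub>?O\<^esub> Ide ?O S = f" if "f \<in> hom ?O S T" for f S T
  proof -
    obtain A X X' where S: "S = (A, X, X')" by (cases S)
    obtain C Y Y' where T: "T = (C, Y, Y')" by (cases T)
    from that obtain f' l r where f: "S \<in> OptOb" "T \<in> OptOb" "(f', l, r) \<in> reps S T" "f = opt S T f' l r"
      by (rule Optic_homE)
    have "Ide (Fib L A) X \<in> hom (Fib L A) X X" "Ide (Fib R A) X' \<in> hom (Fib R A) X' X'"
      "Ide (Fib L C) Y \<in> hom (Fib L C) Y Y" "Ide (Fib R C) Y' \<in> hom (Fib R C) Y' Y'"
      using f by (auto simp: S T Optic_obj_iff hom_def)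
    with f show "Ide ?O T \<cdot>\<^bsub>?O\<^esub> f = f" "f \<cdot>\<^bsub>?O\<^esub> Ide ?O S = f"
      using optic_cmp_iota[of f' l r A X X' T] iota_cmp_optic[of f' l r A X X' C Y Y']
      by (auto simp: S T Ide_Optic Optic_obj_iff reps_iff hom_simps)
  qed
  show "(h \<cdot>\<^bsub>?O\<^esub> g) \<cdot>\<^bsub>?O\<^esub> f = h \<cdot>\<^bsub>?O\<^esub> (g \<cdot>\<^bsub>?O\<^esub> f)"
    if "f \<in> hom ?O S T" "g \<in> hom ?O T U" "h \<in> hom ?O U V" for f g h S T U V
    using that by (elim Optic_homE) (simp add: optic_assoc)
qed

end

section \<open>Tambara representations\<close>

lemma prod_functor_simps [simp]:
  "(X, X') \<in> Obj C \<Longrightarrow> FOb (prod_functor C F G) (X, X') = (FOb F X, FOb G X')"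
  "(u, u') \<in> Arr C \<Longrightarrow> FAr (prod_functor C F G) (u, u') = (FAr F u, FAr G u')"
  by (auto simp: prod_functor_def)

section \<open>\<open>iota\<close> as a functor and the factorisation of optics\<close>

context optics
begin

lemma category_prof_cat: "A \<in> Zero B \<Longrightarrow> category (prof_cat L R A)"
  by (intro category_prod_cat category_op_cat left.fib_category right.fib_category)

lemma pull2_functor:
  assumes f: "f \<in> hom1 B A C"
  shows "cat_functor (prof_cat L R C) (prof_cat L R A) (pull2 B L R f)"
proof (rule cat_functorI)
  show "category (prof_cat L R C)" "category (prof_cat L R A)"
    using left.base.hom1_zero[OF f] by (simp_all add: category_prof_cat)
qed (use f left.base.hom1_zero[OF f] in \<open>auto simp: left.base.hom1_iff left.pull_cmp right.pull_cmp\<close>,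
    use f in \<open>auto simp: prod_functor_def left.base.hom1_iff\<close>)

text \<open>The outer factor is itself an optic, represented by an identity 1-cell, so this is
  \<open>optic_cmp_iota\<close> followed by rebracketing.\<close>

lemma iota_cmp:
  assumes A: "A \<in> Zero B" and u: "u1 \<in> hom (Fib L A) X Y" "u2 \<in> hom (Fib L A) Y Z"
    and v: "v1 \<in> hom (Fib R A) Y' X'" "v2 \<in> hom (Fib R A) Z' Y'"
  shows "FAr (iota B L R A) (u2, v2) \<cdot>\<^bsub>Optic B L R\<^esub> FAr (iota B L R A) (u1, v1) =
    FAr (iota B L R A) (u2 \<cdot>\<^bsub>Fib L A\<^esub> u1, v1 \<cdot>\<^bsub>Fib R A\<^esub> v2)"
proof -
  have obj: "X \<in> Obj (Fib L A)" "Y \<in> Obj (Fib L A)" "Z \<in> Obj (Fib L A)"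
    "X' \<in> Obj (Fib R A)" "Y' \<in> Obj (Fib R A)" "Z' \<in> Obj (Fib R A)"
    using left.fib_obj[OF _ A] right.fib_obj[OF _ A] u v by blast+
  have uv: "u2 \<cdot>\<^bsub>Fib L A\<^esub> u1 \<in> hom (Fib L A) X Z" "v1 \<cdot>\<^bsub>Fib R A\<^esub> v2 \<in> hom (Fib R A) Z' X'"
    using u v A by (auto simp: hom_def)
  have "(One B A, ThId L A Z \<cdot>\<^bsub>Fib L A\<^esub> u2, v2 \<cdot>\<^bsub>Fib R A\<^esub> id_inv R A Z') \<in> reps (A, Y, Y') (A, Z, Z')"
    by (rule iota_reps[OF A u(2) v(2)])
  then show ?thesis
    unfolding iota_arr[OF u(2) v(2)] iota_arr[OF uv]
    using optic_cmp_iota[OF _ _ A u(1) v(1)] obj A u v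
    by (simp add: Optic_obj_iff left.fib_assoc right.fib_assoc hom_def)
qed

text \<open>The target is the opposite category, to match the variance of a Tambara representation.
  The maps are extensional for \<open>prof_cat\<close>, because passing to opposites changes neither
  objects nor arrows.\<close>

lemma iota_functor:
  assumes A: "A \<in> Zero B"
  shows "cat_functor (prof_cat L R A) (op_cat (Optic B L R)) (iota B L R A)"
proof (rule cat_functorI)
  let ?I = "FAr (iota B L R A)"
  fix f assume f: "f \<in> Arr (prof_cat L R A)"
  obtain u v where uv: "f = (u, v)" by (cases f)
  have "?I (u, v) \<in> hom (Optic B L R) (A, Dom (Fib L A) u, Cod (Fib R A) v) (A, Cod (Fib L A) u, Dom (Fib R A) v)"
    using f A by (intro iota_hom) (auto simp: uv hom_def)
  then show "?I f \<in> Arr (op_cat (Optic B L R)) \<and>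
      Dom (op_cat (Optic B L R)) (?I f) = FOb (iota B L R A) (Dom (prof_cat L R A) f) \<and>
      Cod (op_cat (Optic B L R)) (?I f) = FOb (iota B L R A) (Cod (prof_cat L R A) f)"
    using f A by (auto simp: uv hom_def)
next
  fix f g assume "f \<in> Arr (prof_cat L R A)" "g \<in> Arr (prof_cat L R A)"
    "Cod (prof_cat L R A) f = Dom (prof_cat L R A) g"
  then show "FAr (iota B L R A) (g \<cdot>\<^bsub>prof_cat L R A\<^esub> f) =
      FAr (iota B L R A) g \<cdot>\<^bsub>op_cat (Optic B L R)\<^esub> FAr (iota B L R A) f"
    using A by (cases f; cases g) (auto simp: hom_def iota_cmp)
qed (use A in \<open>auto simp: category_prof_cat category_op_cat category_Optic Ide_Optic Optic_obj_iff\<close>,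
    auto simp: iota_def)

lemma Str_iota_op:
  assumes "f \<in> hom1 B A C" "Y \<in> Obj (Fib L C)" "Y' \<in> Obj (Fib R C)"
  shows "Str (iota_op B L R) f (Y, Y') =
    opt (A, FOb (Pull L f) Y, FOb (Pull R f) Y') (C, Y, Y') f
      (Ide (Fib L A) (FOb (Pull L f) Y)) (Ide (Fib R A) (FOb (Pull R f) Y'))"
  using assms by (auto simp: iota_op_def left.base.hom1_iff)

lemma Prof_iota_op: "A \<in> Zero B \<Longrightarrow> Prof (iota_op B L R) A = iota B L R A"
  by (simp add: iota_op_def)

lemma Str_iota_reps:
  assumes "f \<in> hom1 B A C" "Y \<in> Obj (Fib L C)" "Y' \<in> Obj (Fib R C)"
  shows "(f, Ide (Fib L A) (FOb (Pull L f) Y), Ide (Fib R A) (FOb (Pull R f) Y')) \<in>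
    reps (A, FOb (Pull L f) Y, FOb (Pull R f) Y') (C, Y, Y')"
  using assms left.base.hom1_zero[OF assms(1)] by (simp add: reps_iff hom_simps)

text \<open>By \<open>optic_cmp_iota\<close> the identity halves of the structure map are merely
  composed with \<open>l\<close> and \<open>r\<close>.\<close>

lemma optic_decomp:
  assumes f: "f \<in> hom1 B A C" and Y: "Y \<in> Obj (Fib L C)" "Y' \<in> Obj (Fib R C)"
    and l: "l \<in> hom (Fib L A) X (FOb (Pull L f) Y)" and r: "r \<in> hom (Fib R A) (FOb (Pull R f) Y') X'"
  shows "Str (iota_op B L R) f (Y, Y') \<cdot>\<^bsub>Optic B L R\<^esub> FAr (iota B L R A) (l, r) =
    opt (A, X, X') (C, Y, Y') f l r"
proof -
  have "A \<in> Zero B" "C \<in> Zero B"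
    using left.base.hom1_zero[OF f] .
  then show ?thesis
    using optic_cmp_iota[OF Str_iota_reps[OF f Y] _ _ l r] Y l r
    by (auto simp: Str_iota_op[OF f Y] Optic_obj_iff hom_def)
qed

end

text \<open>Naturality of the structure maps is asked for in coordinates, on a forward arrow
  \<open>u\<close> and a backward arrow \<open>v\<close>. This is the shape in which laws of optics
  are available.\<close>

lemma tambara_representationI:
  assumes L: "indexed_category B L" and R: "indexed_category B R" and D: "category D"
    and "Prof P \<in> extensional (Zero B)" "Str P \<in> extensional (Obj (Vert B))"
    and prof: "\<And>A. A \<in> Zero B \<Longrightarrow> cat_functor (prof_cat L R A) D (Prof P A)"
    and ext: "\<And>f. f \<in> Obj (Vert B) \<Longrightarrow> Str P f \<in> extensional (Obj (prof_cat L R (Trg B f)))"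
    and str_hom: "\<And>f A C Y Y'. f \<in> hom1 B A C \<Longrightarrow> Y \<in> Obj (Fib L C) \<Longrightarrow> Y' \<in> Obj (Fib R C) \<Longrightarrow>
      Str P f (Y, Y') \<in> hom D (FOb (Prof P C) (Y, Y'))
        (FOb (Prof P A) (FOb (Pull L f) Y, FOb (Pull R f) Y'))"
    and str_nat: "\<And>f A C u v X Y X' Y'. f \<in> hom1 B A C \<Longrightarrow>
      u \<in> hom (Fib L C) X Y \<Longrightarrow> v \<in> hom (Fib R C) Y' X' \<Longrightarrow>
      FAr (Prof P A) (FAr (Pull L f) u, FAr (Pull R f) v) \<cdot>\<^bsub>D\<^esub> Str P f (Y, Y') =
        Str P f (X, X') \<cdot>\<^bsub>D\<^esub> FAr (Prof P C) (u, v)"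
    and laws: "\<And>f g A C m Y Y'. f \<in> hom1 B A C \<Longrightarrow> m \<in> hom2 B f g \<Longrightarrow>
      Y \<in> Obj (Fib L C) \<Longrightarrow> Y' \<in> Obj (Fib R C) \<Longrightarrow>
      FAr (Prof P A) (Act L m Y, Ide (Fib R A) (FOb (Pull R g) Y')) \<cdot>\<^bsub>D\<^esub> Str P g (Y, Y')
        = FAr (Prof P A) (Ide (Fib L A) (FOb (Pull L f) Y), Act R m Y') \<cdot>\<^bsub>D\<^esub> Str P f (Y, Y')"
    "\<And>A X X'. A \<in> Zero B \<Longrightarrow> X \<in> Obj (Fib L A) \<Longrightarrow> X' \<in> Obj (Fib R A) \<Longrightarrow>
      FAr (Prof P A) (ThId L A X, id_inv R A X') \<cdot>\<^bsub>D\<^esub> Str P (One B A) (X, X')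
        = Ide D (FOb (Prof P A) (X, X'))"
    "\<And>f g A C E Z Z'. f \<in> hom1 B A C \<Longrightarrow> g \<in> hom1 B C E \<Longrightarrow>
      Z \<in> Obj (Fib L E) \<Longrightarrow> Z' \<in> Obj (Fib R E) \<Longrightarrow>
      FAr (Prof P A) (ThCmp L f g Z, cmp_inv R A f g Z') \<cdot>\<^bsub>D\<^esub> Str P (g \<star>\<^bsub>B\<^esub> f) (Z, Z')
        = Str P f (FOb (Pull L g) Z, FOb (Pull R g) Z') \<cdot>\<^bsub>D\<^esub> Str P g (Z, Z')"
  shows "tambara_representation B L R D P"
proof -
  interpret optics B L R
    using L R by (simp add: optics_def)
  have "nat_trans (prof_cat L R C) D (Prof P C)
      (comp_functor (prof_cat L R C) (Prof P A) (pull2 B L R f)) (Str P f)" if f: "f \<in> hom1 B A C" for f A C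
  proof -
    have AC: "A \<in> Zero B" "C \<in> Zero B" "Trg B f = C" "f \<in> Obj (Vert B)"
      using f left.base.hom1_zero[OF f] by (simp_all add: left.base.hom1_iff)
    show ?thesis
    proof (rule nat_transI)
      show "cat_functor (prof_cat L R C) D (comp_functor (prof_cat L R C) (Prof P A) (pull2 B L R f))"
        by (rule cat_functor_comp[OF pull2_functor[OF f] prof[OF AC(1)]])
      show "Str P f X \<in> Arr D \<and> Dom D (Str P f X) = FOb (Prof P C) X \<and> Cod D (Str P f X) =
          FOb (comp_functor (prof_cat L R C) (Prof P A) (pull2 B L R f)) X"
        if "X \<in> Obj (prof_cat L R C)" for X
        using that str_hom[OF f] AC by (auto simp: hom_def)
      show "FAr (comp_functor (prof_cat L R C) (Prof P A) (pull2 B L R f)) w \<cdot>\<^bsub>D\<^esub>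
            Str P f (Dom (prof_cat L R C) w) =
          Str P f (Cod (prof_cat L R C) w) \<cdot>\<^bsub>D\<^esub> FAr (Prof P C) w"
        if w: "w \<in> Arr (prof_cat L R C)" for w
      proof -
        obtain u v where "w = (u, v)" by (cases w)
        then show ?thesis
          using w str_nat[OF f, of u _ _ v] AC by (auto simp: hom_def)
      qed
    qed (use ext[of f] prof AC in auto)
  qed
  then show ?thesis
    using assms by (auto simp: tambara_representation_def tambara_representation_axioms_def)
qed

section \<open>Typing and functoriality inside a Tambara representation\<close>

context tambara_representation
begin

sublocale optics B L R ..

text \<open>A pair \<open>(u, v)\<close> has the shape of the halves of an optic, and
  \<open>P\<close> sends it against the direction of that optic; hence the opposite of
  \<open>Optic\<close> in the theorem.\<close>

lemma prof_hom:
  assumes "A \<in> Zero B" "u \<in> hom (Fib L A) X Y" "v \<in> hom (Fib R A) Y' X'"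
  shows "FAr (Prof P A) (u, v) \<in> hom D (FOb (Prof P A) (Y, Y')) (FOb (Prof P A) (X, X'))"
  using cat_functor.FAr_hom[OF prof_functor[OF assms(1)], of "(u, v)"] assms(2,3) by simp

lemma prof_obj:
  assumes "A \<in> Zero B" "X \<in> Obj (Fib L A)" "X' \<in> Obj (Fib R A)"
  shows "FOb (Prof P A) (X, X') \<in> Obj D"
  using cat_functor.FOb_obj[OF prof_functor[OF assms(1)]] assms(2,3) by simp

lemma prof_ide:
  assumes "A \<in> Zero B" "X \<in> Obj (Fib L A)" "X' \<in> Obj (Fib R A)"
  shows "FAr (Prof P A) (Ide (Fib L A) X, Ide (Fib R A) X') = Ide D (FOb (Prof P A) (X, X'))"
  using cat_functor.FAr_ide[OF prof_functor[OF assms(1)], of "(X, X')"] assms(2,3) by simp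

lemma prof_cmp:
  assumes "A \<in> Zero B" and u: "u1 \<in> hom (Fib L A) X Y" "u2 \<in> hom (Fib L A) Y Z"
    and v: "v1 \<in> hom (Fib R A) Y' X'" "v2 \<in> hom (Fib R A) Z' Y'"
  shows "FAr (Prof P A) (u2 \<cdot>\<^bsub>Fib L A\<^esub> u1, v1 \<cdot>\<^bsub>Fib R A\<^esub> v2) =
    FAr (Prof P A) (u1, v1) \<cdot>\<^bsub>D\<^esub> FAr (Prof P A) (u2, v2)"
  using cat_functor.FAr_cmp[OF prof_functor[OF assms(1)], of "(u2, v2)" "(Z, Z')" "(Y, Y')" "(u1, v1)" "(X, X')"]
    u v by simp

lemma str_hom:
  assumes "f \<in> hom1 B A C" "Y \<in> Obj (Fib L C)" "Y' \<in> Obj (Fib R C)"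
  shows "Str P f (Y, Y') \<in> hom D (FOb (Prof P C) (Y, Y'))
    (FOb (Prof P A) (FOb (Pull L f) Y, FOb (Pull R f) Y'))"
  using nat_trans.comp_hom[OF str_nat_trans[OF assms(1)], of "(Y, Y')"] assms
  by (simp add: left.base.hom1_iff)

lemma str_nat:
  assumes "f \<in> hom1 B A C" "u \<in> hom (Fib L C) X Y" "v \<in> hom (Fib R C) Y' X'"
  shows "FAr (Prof P A) (FAr (Pull L f) u, FAr (Pull R f) v) \<cdot>\<^bsub>D\<^esub> Str P f (Y, Y') =
    Str P f (X, X') \<cdot>\<^bsub>D\<^esub> FAr (Prof P C) (u, v)"
  using nat_trans.naturality[OF str_nat_trans[OF assms(1)], of "(u, v)" "(Y, Y')" "(X, X')"] assms
  by (auto simp add: left.base.hom1_iff hom_def)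

end

text \<open>The laws are equations in the opposite category, so composites read in reverse, and
  \<open>optic_decomp\<close> computes those that end in a structure map. Extranaturality becomes
  the generating relation at identity halves, and the unit law becomes the definition of the
  identity optic.\<close>

lemma (in optics) tambara_iota_op: "tambara_representation B L R (op_cat (Optic B L R)) (iota_op B L R)"
proof (rule tambara_representationI)
  let ?S = "Str (iota_op B L R)"
  show "category (op_cat (Optic B L R))" by (intro category_op_cat category_Optic)
  show "Prof (iota_op B L R) \<in> extensional (Zero B)" "?S \<in> extensional (Obj (Vert B))"
    by (auto simp: iota_op_def)
  show "?S f \<in> extensional (Obj (prof_cat L R (Trg B f)))" if "f \<in> Obj (Vert B)" for f
    using that by (simp add: iota_op_def)
  show "cat_functor (prof_cat L R A) (op_cat (Optic B L R)) (Prof (iota_op B L R) A)" if "A \<in> Zero B" for A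
    using iota_functor[OF that] that by (simp add: Prof_iota_op)
  show "?S f (Y, Y') \<in> hom (op_cat (Optic B L R)) (FOb (Prof (iota_op B L R) C) (Y, Y'))
        (FOb (Prof (iota_op B L R) A) (FOb (Pull L f) Y, FOb (Pull R f) Y'))"
    if f: "f \<in> hom1 B A C" and Y: "Y \<in> Obj (Fib L C)" "Y' \<in> Obj (Fib R C)" for f A C Y Y'
  proof -
    have "A \<in> Zero B" "C \<in> Zero B"
      using left.base.hom1_zero[OF f] .
    then show ?thesis
      using f Y Str_iota_reps[OF f Y] optic_hom[OF Str_iota_reps[OF f Y]]
      by (auto simp: Prof_iota_op Str_iota_op Optic_obj_iff left.base.hom1_iff)
  qed
  show "FAr (Prof (iota_op B L R) A) (FAr (Pull L f) u, FAr (Pull R f) v) \<cdot>\<^bsub>op_cat (Optic B L R)\<^esub> ?S f (Y, Y') =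
      ?S f (X, X') \<cdot>\<^bsub>op_cat (Optic B L R)\<^esub> FAr (Prof (iota_op B L R) C) (u, v)"
    if f: "f \<in> hom1 B A C" and u: "u \<in> hom (Fib L C) X Y" and v: "v \<in> hom (Fib R C) Y' X'"
    for f A C u v X Y X' Y'
  proof -
    have AC: "A \<in> Zero B" "C \<in> Zero B"
      using left.base.hom1_zero[OF f] .
    note obj = left.fib_obj[OF u AC(2)] right.fib_obj[OF v AC(2)]
    have fu: "FAr (Pull L f) u \<in> hom (Fib L A) (FOb (Pull L f) X) (FOb (Pull L f) Y)"
      and fv: "FAr (Pull R f) v \<in> hom (Fib R A) (FOb (Pull R f) Y') (FOb (Pull R f) X')"
      using f u v by (auto simp: hom_simps)
    have "(A, FOb (Pull L f) X, FOb (Pull R f) X') \<in> OptOb"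
      using f obj AC by (auto simp: Optic_obj_iff left.base.hom1_iff)
    \<comment> \<open>Both sides are the optic with representative \<open>f\<close> whose halves are
      the pullbacks of \<open>u\<close> and \<open>v\<close>: one by \<open>optic_decomp\<close>,
      the other by \<open>iota_cmp_optic\<close>.\<close>
    then show ?thesis
      using optic_decomp[OF f obj(2,3) fu fv] iota_cmp_optic[OF Str_iota_reps[OF f obj(1,4)] _ AC(2) u v] fu fv AC
      by (simp add: Prof_iota_op Str_iota_op[OF f obj(1,4)] hom_def)
  qed
  show "FAr (Prof (iota_op B L R) A) (Act L m Y, Ide (Fib R A) (FOb (Pull R g) Y')) \<cdot>\<^bsub>op_cat (Optic B L R)\<^esub> ?S g (Y, Y')
      = FAr (Prof (iota_op B L R) A) (Ide (Fib L A) (FOb (Pull L f) Y), Act R m Y') \<cdot>\<^bsub>op_cat (Optic B L R)\<^esub> ?S f (Y, Y')"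
    if f: "f \<in> hom1 B A C" and m: "m \<in> hom2 B f g" and Y: "Y \<in> Obj (Fib L C)" "Y' \<in> Obj (Fib R C)"
    for f g A C m Y Y'
  proof -
    have A: "A \<in> Zero B"
      using left.base.hom1_zero(1)[OF f] .
    have g: "g \<in> hom1 B A C" using left.base.cell_cod f m .
    have hom: "Act L m Y \<in> hom (Fib L A) (FOb (Pull L f) Y) (FOb (Pull L g) Y)"
      "Act R m Y' \<in> hom (Fib R A) (FOb (Pull R f) Y') (FOb (Pull R g) Y')"
      "Ide (Fib L A) (FOb (Pull L f) Y) \<in> hom (Fib L A) (FOb (Pull L f) Y) (FOb (Pull L f) Y)"
      "Ide (Fib R A) (FOb (Pull R g) Y') \<in> hom (Fib R A) (FOb (Pull R g) Y') (FOb (Pull R g) Y')"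
      using f g m Y A by (simp_all add: hom_simps)
    have "opt (A, FOb (Pull L f) Y, FOb (Pull R g) Y') (C, Y, Y') g (Act L m Y) (Ide (Fib R A) (FOb (Pull R g) Y')) =
      opt (A, FOb (Pull L f) Y, FOb (Pull R g) Y') (C, Y, Y') f (Ide (Fib L A) (FOb (Pull L f) Y)) (Act R m Y')"
      using hom A by (intro optic_eqI[OF f m]) (auto simp: hom_def)
    then show ?thesis
      using optic_decomp[OF g Y hom(1,4)] optic_decomp[OF f Y hom(3,2)] A by (simp add: Prof_iota_op)
  qed
  show "FAr (Prof (iota_op B L R) A) (ThId L A X, id_inv R A X') \<cdot>\<^bsub>op_cat (Optic B L R)\<^esub> ?S (One B A) (X, X')
        = Ide (op_cat (Optic B L R)) (FOb (Prof (iota_op B L R) A) (X, X'))"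
    if "A \<in> Zero B" "X \<in> Obj (Fib L A)" "X' \<in> Obj (Fib R A)" for A X X'
    using that optic_decomp[OF left.base.one_hom1[OF that(1)] that(2,3), of "ThId L A X" X "id_inv R A X'" X']
    by (simp add: Prof_iota_op hom_def) (simp add: Optic_def)
  show "FAr (Prof (iota_op B L R) A) (ThCmp L f g Z, cmp_inv R A f g Z') \<cdot>\<^bsub>op_cat (Optic B L R)\<^esub> ?S (g \<star>\<^bsub>B\<^esub> f) (Z, Z')
      = ?S f (FOb (Pull L g) Z, FOb (Pull R g) Z') \<cdot>\<^bsub>op_cat (Optic B L R)\<^esub> ?S g (Z, Z')"
    if f: "f \<in> hom1 B A C" and g: "g \<in> hom1 B C E" and Z: "Z \<in> Obj (Fib L E)" "Z' \<in> Obj (Fib R E)"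
    for f g A C E Z Z'
  proof -
    have ACE: "A \<in> Zero B" "C \<in> Zero B" "E \<in> Zero B"
      using left.base.hom1_zero[OF f] left.base.hom1_zero[OF g] by simp_all
    have gZ: "FOb (Pull L g) Z \<in> Obj (Fib L C)" "FOb (Pull R g) Z' \<in> Obj (Fib R C)"
      using g Z by (auto simp: left.base.hom1_iff)
    have gf: "g \<star>\<^bsub>B\<^esub> f \<in> hom1 B A E" using f g left.base.hcmp_hom1 by blast
    have th: "ThCmp L f g Z \<in> hom (Fib L A) (FOb (Pull L f) (FOb (Pull L g) Z)) (FOb (Pull L (g \<star>\<^bsub>B\<^esub> f)) Z)"
      "cmp_inv R A f g Z' \<in> hom (Fib R A) (FOb (Pull R (g \<star>\<^bsub>B\<^esub> f)) Z') (FOb (Pull R f) (FOb (Pull R g) Z'))"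
      using f g Z by (auto simp: hom_simps)
    \<comment> \<open>With identity halves in both factors, only theta and the inverse of theta'
      survive in the composite.\<close>
    have "?S g (Z, Z') \<cdot>\<^bsub>Optic B L R\<^esub> ?S f (FOb (Pull L g) Z, FOb (Pull R g) Z') =
      opt (A, FOb (Pull L f) (FOb (Pull L g) Z), FOb (Pull R f) (FOb (Pull R g) Z')) (E, Z, Z') (g \<star>\<^bsub>B\<^esub> f)
        (ThCmp L f g Z) (cmp_inv R A f g Z')"
      unfolding Str_iota_op[OF f gZ] Str_iota_op[OF g Z] using f g Z gZ ACE
      by (intro optic_cmp Str_iota_reps)
        (auto simp: Optic_obj_iff optic_rep_cmp_def left.base.hom1_iff)
    then show ?thesis
      using optic_decomp[OF gf Z th] ACE by (simp add: Prof_iota_op)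
  qed
qed (rule left.indexed_category_axioms right.indexed_category_axioms)+

section \<open>Composition of a Tambara representation with a functor\<close>

lemma Prof_tamb_comp [simp]:
  "A \<in> Zero B \<Longrightarrow> Prof (tamb_comp B L R F P) A = comp_functor (prof_cat L R A) F (Prof P A)"
  by (simp add: tamb_comp_def)

lemma Str_tamb_comp:
  "f \<in> hom1 B A C \<Longrightarrow> Z \<in> Obj (prof_cat L R C) \<Longrightarrow> Str (tamb_comp B L R F P) f Z = FAr F (Str P f Z)"
  by (auto simp: tamb_comp_def hom1_def)

text \<open>Each law is an equation between composites in \<open>E\<close>, and a functor preserves
  it. The case of interest has the opposite of \<open>Optic\<close> for \<open>E\<close> and
  \<open>iota_op\<close> for \<open>P\<close>.\<close>

lemma tambara_comp:
  assumes P: "tambara_representation B L R E P" and F: "cat_functor E D F"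
  shows "tambara_representation B L R D (tamb_comp B L R F P)"
proof -
  interpret P: tambara_representation B L R E P by fact
  interpret F: cat_functor E D F by fact
  show ?thesis
  proof (rule tambara_representationI)
    show "Prof (tamb_comp B L R F P) \<in> extensional (Zero B)"
      "Str (tamb_comp B L R F P) \<in> extensional (Obj (Vert B))"
      by (auto simp: tamb_comp_def)
    show "Str (tamb_comp B L R F P) f \<in> extensional (Obj (prof_cat L R (Trg B f)))" if "f \<in> Obj (Vert B)" for f
      using that by (simp add: tamb_comp_def)
    show "cat_functor (prof_cat L R A) D (Prof (tamb_comp B L R F P) A)" if "A \<in> Zero B" for A
      using that cat_functor_comp[OF P.prof_functor F] by simp
    show "Str (tamb_comp B L R F P) f (Y, Y') \<in> hom D (FOb (Prof (tamb_comp B L R F P) C) (Y, Y'))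
        (FOb (Prof (tamb_comp B L R F P) A) (FOb (Pull L f) Y, FOb (Pull R f) Y'))"
      if f: "f \<in> hom1 B A C" and Y: "Y \<in> Obj (Fib L C)" "Y' \<in> Obj (Fib R C)" for f A C Y Y'
      using f Y F.FAr_hom[OF P.str_hom[OF f Y]] P.left.base.hom1_zero[OF f]
      by (auto simp: Str_tamb_comp P.left.base.hom1_iff)
    show "FAr (Prof (tamb_comp B L R F P) A) (FAr (Pull L f) u, FAr (Pull R f) v) \<cdot>\<^bsub>D\<^esub>
          Str (tamb_comp B L R F P) f (Y, Y') =
        Str (tamb_comp B L R F P) f (X, X') \<cdot>\<^bsub>D\<^esub> FAr (Prof (tamb_comp B L R F P) C) (u, v)"
      if f: "f \<in> hom1 B A C" and u: "u \<in> hom (Fib L C) X Y" and v: "v \<in> hom (Fib R C) Y' X'"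
      for f A C u v X Y X' Y'
    proof -
      have AC: "A \<in> Zero B" "C \<in> Zero B"
        using P.left.base.hom1_zero[OF f] by simp_all
      note obj = P.left.fib_obj[OF u AC(2)] P.right.fib_obj[OF v AC(2)]
      have fu: "FAr (Pull L f) u \<in> hom (Fib L A) (FOb (Pull L f) X) (FOb (Pull L f) Y)"
        and fv: "FAr (Pull R f) v \<in> hom (Fib R A) (FOb (Pull R f) Y') (FOb (Pull R f) X')"
        using f u v by (auto simp: P.hom_simps)
      show ?thesis
        using F.FAr_cmp[OF P.str_hom[OF f obj(2,3)] P.prof_hom[OF AC(1) fu fv]]
          F.FAr_cmp[OF P.prof_hom[OF AC(2) u v] P.str_hom[OF f obj(1,4)]]
          P.str_nat[OF f u v] u v fu fv AC obj
        by (simp add: Str_tamb_comp[OF f]) (simp add: hom_def)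
    qed
    show "FAr (Prof (tamb_comp B L R F P) A) (Act L m Y, Ide (Fib R A) (FOb (Pull R g) Y')) \<cdot>\<^bsub>D\<^esub>
          Str (tamb_comp B L R F P) g (Y, Y') =
        FAr (Prof (tamb_comp B L R F P) A) (Ide (Fib L A) (FOb (Pull L f) Y), Act R m Y') \<cdot>\<^bsub>D\<^esub>
          Str (tamb_comp B L R F P) f (Y, Y')"
      if f: "f \<in> hom1 B A C" and m: "m \<in> hom2 B f g" and Y: "Y \<in> Obj (Fib L C)" "Y' \<in> Obj (Fib R C)"
      for f g A C m Y Y'
    proof -
      have A: "A \<in> Zero B"
        using P.left.base.hom1_zero[OF f] by simp_all
      have g: "g \<in> hom1 B A C" using P.left.base.cell_cod f m .
      have hom: "Act L m Y \<in> hom (Fib L A) (FOb (Pull L f) Y) (FOb (Pull L g) Y)"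
        "Act R m Y' \<in> hom (Fib R A) (FOb (Pull R f) Y') (FOb (Pull R g) Y')"
        "Ide (Fib L A) (FOb (Pull L f) Y) \<in> hom (Fib L A) (FOb (Pull L f) Y) (FOb (Pull L f) Y)"
        "Ide (Fib R A) (FOb (Pull R g) Y') \<in> hom (Fib R A) (FOb (Pull R g) Y') (FOb (Pull R g) Y')"
        using f g m Y A by (simp_all add: P.hom_simps)
      show ?thesis
        using F.FAr_cmp[OF P.str_hom[OF g Y] P.prof_hom[OF A hom(1,4)]]
          F.FAr_cmp[OF P.str_hom[OF f Y] P.prof_hom[OF A hom(3,2)]]
          P.str_extranatural[OF f g m Y] hom A Y
        by (simp add: Str_tamb_comp[OF f] Str_tamb_comp[OF g]) (simp add: hom_def)
    qed
    show "FAr (Prof (tamb_comp B L R F P) A) (ThId L A X, id_inv R A X') \<cdot>\<^bsub>D\<^esub>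
          Str (tamb_comp B L R F P) (One B A) (X, X') =
        Ide D (FOb (Prof (tamb_comp B L R F P) A) (X, X'))"
      if A: "A \<in> Zero B" and X: "X \<in> Obj (Fib L A)" "X' \<in> Obj (Fib R A)" for A X X'
    proof -
      note one = P.left.base.one_hom1[OF A]
      have th: "ThId L A X \<in> hom (Fib L A) X (FOb (Pull L (One B A)) X)"
        "id_inv R A X' \<in> hom (Fib R A) (FOb (Pull R (One B A)) X') X'"
        using A X by (simp_all add: hom_def)
      show ?thesis
        using F.FAr_cmp[OF P.str_hom[OF one X] P.prof_hom[OF A th]]
          P.str_unit[OF A X] th A X F.FAr_ide[OF P.prof_obj[OF A X]]
        by (simp add: Str_tamb_comp[OF one]) 
    qed
    show "FAr (Prof (tamb_comp B L R F P) A) (ThCmp L f g Z, cmp_inv R A f g Z') \<cdot>\<^bsub>D\<^esub>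
          Str (tamb_comp B L R F P) (g \<star>\<^bsub>B\<^esub> f) (Z, Z') =
        Str (tamb_comp B L R F P) f (FOb (Pull L g) Z, FOb (Pull R g) Z') \<cdot>\<^bsub>D\<^esub>
          Str (tamb_comp B L R F P) g (Z, Z')"
      if f: "f \<in> hom1 B A C" and g: "g \<in> hom1 B C G" and Z: "Z \<in> Obj (Fib L G)" "Z' \<in> Obj (Fib R G)"
      for f g A C G Z Z'
    proof -
      have A: "A \<in> Zero B"
        using P.left.base.hom1_zero[OF f] by simp_all
      have gZ: "FOb (Pull L g) Z \<in> Obj (Fib L C)" "FOb (Pull R g) Z' \<in> Obj (Fib R C)"
        using g Z by (auto simp: P.left.base.hom1_iff)
      have gf: "g \<star>\<^bsub>B\<^esub> f \<in> hom1 B A G" using f g P.left.base.hcmp_hom1 by blast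
      have th: "ThCmp L f g Z \<in> hom (Fib L A) (FOb (Pull L f) (FOb (Pull L g) Z)) (FOb (Pull L (g \<star>\<^bsub>B\<^esub> f)) Z)"
        "cmp_inv R A f g Z' \<in> hom (Fib R A) (FOb (Pull R (g \<star>\<^bsub>B\<^esub> f)) Z') (FOb (Pull R f) (FOb (Pull R g) Z'))"
        using f g Z by (auto simp: P.hom_simps)
      show ?thesis
        using F.FAr_cmp[OF P.str_hom[OF gf Z] P.prof_hom[OF A th]]
          F.FAr_cmp[OF P.str_hom[OF g Z] P.str_hom[OF f gZ]]
          P.str_cmp[OF f g Z] th A Z gZ
        by (simp add: Str_tamb_comp[OF f] Str_tamb_comp[OF g] Str_tamb_comp[OF gf]) (simp add: hom_def)
    qed
  qed (rule P.left.indexed_category_axioms P.right.indexed_category_axioms F.target.category_axioms)+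
qed

lemma tambara_morphismI:
  assumes "tambara_representation B L R D P" "tambara_representation B L R D Q"
    and "e \<in> extensional (Zero B)"
    and "\<And>A. A \<in> Zero B \<Longrightarrow> nat_trans (prof_cat L R A) D (Prof P A) (Prof Q A) (e A)"
    and "\<And>f A C Y Y'. f \<in> hom1 B A C \<Longrightarrow> Y \<in> Obj (Fib L C) \<Longrightarrow> Y' \<in> Obj (Fib R C) \<Longrightarrow>
      e A (FOb (Pull L f) Y, FOb (Pull R f) Y') \<cdot>\<^bsub>D\<^esub> Str P f (Y, Y')
        = Str Q f (Y, Y') \<cdot>\<^bsub>D\<^esub> e C (Y, Y')"
  shows "tambara_morphism B L R D P Q e"
  using assms by (auto simp: tambara_morphism_def tambara_morphism_axioms_def)

context tambara_morphism
begin

lemma family_hom: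
  assumes "A \<in> Zero B" "X \<in> Obj (Fib L A)" "X' \<in> Obj (Fib R A)"
  shows "e A (X, X') \<in> hom D (FOb (Prof P A) (X, X')) (FOb (Prof Q A) (X, X'))"
  using nat_trans.comp_hom[OF family_nat_trans[OF assms(1)]] assms(2,3) by simp

lemma family_nat:
  assumes "A \<in> Zero B" "u \<in> hom (Fib L A) X Y" "v \<in> hom (Fib R A) Y' X'"
  shows "FAr (Prof Q A) (u, v) \<cdot>\<^bsub>D\<^esub> e A (Y, Y') = e A (X, X') \<cdot>\<^bsub>D\<^esub> FAr (Prof P A) (u, v)"
  using nat_trans.naturality[OF family_nat_trans[OF assms(1)], of "(u, v)" "(Y, Y')" "(X, X')"] assms(2,3)
  by simp

lemma family_component_ext:
  "A \<in> Zero B \<Longrightarrow> e A \<in> extensional (Obj (prof_cat L R A))"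
  using nat_trans.comp_ext[OF family_nat_trans] .

end

section \<open>The category of Tambara representations\<close>

lemma Tamb_simps:
  "Obj (Tamb B L R D) = {P. tambara_representation B L R D P}"
  "Arr (Tamb B L R D) = {(P, Q, e). tambara_morphism B L R D P Q e}"
  "Dom (Tamb B L R D) (P, Q, e) = P"
  "Cod (Tamb B L R D) (P, Q, e) = Q"
  "Ide (Tamb B L R D) P =
     (P, P, \<lambda>A\<in>Zero B. \<lambda>Z\<in>Obj (prof_cat L R A). Ide D (FOb (Prof P A) Z))"
  "(Q', S, d) \<cdot>\<^bsub>Tamb B L R D\<^esub> (P, Q, e) =
     (P, S, \<lambda>A\<in>Zero B. \<lambda>Z\<in>Obj (prof_cat L R A). d A Z \<cdot>\<^bsub>D\<^esub> e A Z)"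
  by (simp_all add: Tamb_def)

lemma tambara_morphism_ide:
  assumes "tambara_representation B L R D P"
  shows "tambara_morphism B L R D P P
    (\<lambda>A\<in>Zero B. \<lambda>Z\<in>Obj (prof_cat L R A). Ide D (FOb (Prof P A) Z))"
proof -
  interpret tambara_representation B L R D P by fact
  show ?thesis
  proof (rule tambara_morphismI[OF assms assms])
    show "nat_trans (prof_cat L R A) D (Prof P A) (Prof P A)
        ((\<lambda>A\<in>Zero B. \<lambda>Z\<in>Obj (prof_cat L R A). Ide D (FOb (Prof P A) Z)) A)" if "A \<in> Zero B" for A
      using nat_trans_ide[OF prof_functor[OF that]] that by simp
  next
    fix f A C Y Y' assume *: "f \<in> hom1 B A C" "Y \<in> Obj (Fib L C)" "Y' \<in> Obj (Fib R C)"
    then have "FOb (Pull L f) Y \<in> Obj (Fib L A)" "FOb (Pull R f) Y' \<in> Obj (Fib R A)"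
      by (auto simp: left.base.hom1_iff)
    then show "(\<lambda>A\<in>Zero B. \<lambda>Z\<in>Obj (prof_cat L R A). Ide D (FOb (Prof P A) Z)) A
          (FOb (Pull L f) Y, FOb (Pull R f) Y') \<cdot>\<^bsub>D\<^esub> Str P f (Y, Y') =
        Str P f (Y, Y') \<cdot>\<^bsub>D\<^esub>
          (\<lambda>A\<in>Zero B. \<lambda>Z\<in>Obj (prof_cat L R A). Ide D (FOb (Prof P A) Z)) C (Y, Y')"
      using * str_hom[OF *] left.base.hom1_zero[OF *(1)] by (simp add: hom_def)
  qed auto
qed

text \<open>The squares of \<open>e\<close> and \<open>d\<close> over a structure map paste
  together.\<close>

lemma tambara_morphism_cmp:
  assumes "tambara_morphism B L R D P Q e" "tambara_morphism B L R D Q S d"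
  shows "tambara_morphism B L R D P S (\<lambda>A\<in>Zero B. \<lambda>Z\<in>Obj (prof_cat L R A). d A Z \<cdot>\<^bsub>D\<^esub> e A Z)"
proof -
  interpret e: tambara_morphism B L R D P Q e by fact
  interpret d: tambara_morphism B L R D Q S d by fact
  let ?de = "\<lambda>A\<in>Zero B. \<lambda>Z\<in>Obj (prof_cat L R A). d A Z \<cdot>\<^bsub>D\<^esub> e A Z"
  show ?thesis
  proof (rule tambara_morphismI)
    show "tambara_representation B L R D P" "tambara_representation B L R D S"
      by unfold_locales
    show "nat_trans (prof_cat L R A) D (Prof P A) (Prof S A) (?de A)" if "A \<in> Zero B" for A
      using nat_trans_cmp[OF e.family_nat_trans[OF that] d.family_nat_trans[OF that]] that by simp
  next
    fix f A C Y Y' assume *: "f \<in> hom1 B A C" "Y \<in> Obj (Fib L C)" "Y' \<in> Obj (Fib R C)"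
    let ?fY = "(FOb (Pull L f) Y, FOb (Pull R f) Y')"
    note AC = e.source.left.base.hom1_zero[OF *(1)]
    have fY: "FOb (Pull L f) Y \<in> Obj (Fib L A)" "FOb (Pull R f) Y' \<in> Obj (Fib R A)"
      using * by (auto simp: e.source.left.base.hom1_iff)
    note typing = e.family_hom[OF AC(2) *(2,3)] d.family_hom[OF AC(2) *(2,3)]
      e.family_hom[OF AC(1) fY] d.family_hom[OF AC(1) fY]
      e.source.str_hom[OF *] e.target.str_hom[OF *] d.target.str_hom[OF *]
    note simps = hom_def e.source.target.assoc
    have "(d A ?fY \<cdot>\<^bsub>D\<^esub> e A ?fY) \<cdot>\<^bsub>D\<^esub> Str P f (Y, Y') =
        d A ?fY \<cdot>\<^bsub>D\<^esub> (e A ?fY \<cdot>\<^bsub>D\<^esub> Str P f (Y, Y'))"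
      using typing by (simp add: simps)
    also have "\<dots> = (d A ?fY \<cdot>\<^bsub>D\<^esub> Str Q f (Y, Y')) \<cdot>\<^bsub>D\<^esub> e C (Y, Y')"
      unfolding e.family_str[OF *] using typing by (simp add: simps)
    also have "\<dots> = Str S f (Y, Y') \<cdot>\<^bsub>D\<^esub> (d C (Y, Y') \<cdot>\<^bsub>D\<^esub> e C (Y, Y'))"
      unfolding d.family_str[OF *] using typing by (simp add: simps)
    finally show "?de A ?fY \<cdot>\<^bsub>D\<^esub> Str P f (Y, Y') = Str S f (Y, Y') \<cdot>\<^bsub>D\<^esub> ?de C (Y, Y')"
      using AC fY * by simp
  qed auto
qed

text \<open>A family of natural transformations is extensional in two layers, in the index and in
  each member; strict equality has to account for both.\<close>

lemma family_eqI:
  assumes "d \<in> extensional I" "e \<in> extensional I"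
    and "\<And>i. i \<in> I \<Longrightarrow> d i \<in> extensional (S i)" "\<And>i. i \<in> I \<Longrightarrow> e i \<in> extensional (S i)"
    and "\<And>i x. i \<in> I \<Longrightarrow> x \<in> S i \<Longrightarrow> d i x = e i x"
  shows "d = e"
proof (rule extensionalityI[OF assms(1,2)])
  fix i assume "i \<in> I"
  then show "d i = e i"
    using assms(3-5) by (blast intro: extensionalityI)
qed

lemma category_Tamb: "category (Tamb B L R D)"
proof
  let ?T = "Tamb B L R D"
  show "Dom ?T f \<in> Obj ?T" "Cod ?T f \<in> Obj ?T" if "f \<in> Arr ?T" for f
    using that by (auto simp: Tamb_simps tambara_morphism_def)
  show "Ide ?T X \<in> hom ?T X X" if "X \<in> Obj ?T" for X
    using that by (auto simp: hom_def Tamb_simps tambara_morphism_ide simp del: prod_cat_simps)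
  show "g \<cdot>\<^bsub>?T\<^esub> f \<in> hom ?T X Z" if "f \<in> hom ?T X Y" "g \<in> hom ?T Y Z" for f g X Y Z
    using that by (auto simp: hom_def Tamb_simps tambara_morphism_cmp simp del: prod_cat_simps)
  show "Ide ?T Q \<cdot>\<^bsub>?T\<^esub> f = f" "f \<cdot>\<^bsub>?T\<^esub> Ide ?T P = f" if hom: "f \<in> hom ?T P Q" for f P Q
  proof -
    obtain e where f: "f = (P, Q, e)" "tambara_morphism B L R D P Q e"
      using hom by (auto simp: hom_def Tamb_simps)
    interpret tambara_morphism B L R D P Q e by fact
    have "e A (X, X') \<in> Arr D" "Dom D (e A (X, X')) = FOb (Prof P A) (X, X')"
      "Cod D (e A (X, X')) = FOb (Prof Q A) (X, X')"
      if "A \<in> Zero B" "X \<in> Obj (Fib L A)" "X' \<in> Obj (Fib R A)" for A X X'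
      using family_hom[OF that] by (auto simp: hom_def)
    then show "Ide ?T Q \<cdot>\<^bsub>?T\<^esub> f = f" "f \<cdot>\<^bsub>?T\<^esub> Ide ?T P = f"
      using family_ext family_component_ext
      by (auto simp: f Tamb_simps intro!: family_eqI[where I = "Zero B" and S = "\<lambda>A. Obj (prof_cat L R A)"])
  qed
  show "(h \<cdot>\<^bsub>?T\<^esub> g) \<cdot>\<^bsub>?T\<^esub> f = h \<cdot>\<^bsub>?T\<^esub> (g \<cdot>\<^bsub>?T\<^esub> f)"
    if hom: "f \<in> hom ?T P Q" "g \<in> hom ?T Q S" "h \<in> hom ?T S U" for f g h P Q S U
  proof -
    obtain e d c where f: "f = (P, Q, e)" "tambara_morphism B L R D P Q e"
      "g = (Q, S, d)" "tambara_morphism B L R D Q S d" "h = (S, U, c)" "tambara_morphism B L R D S U c"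
      using hom by (auto simp: hom_def Tamb_simps)
    interpret e: tambara_morphism B L R D P Q e by fact
    interpret d: tambara_morphism B L R D Q S d by fact
    interpret c: tambara_morphism B L R D S U c by fact
    have "(c A (X, X') \<cdot>\<^bsub>D\<^esub> d A (X, X')) \<cdot>\<^bsub>D\<^esub> e A (X, X') = c A (X, X') \<cdot>\<^bsub>D\<^esub> (d A (X, X') \<cdot>\<^bsub>D\<^esub> e A (X, X'))"
      if "A \<in> Zero B" "X \<in> Obj (Fib L A)" "X' \<in> Obj (Fib R A)" for A X X'
      using e.source.target.cmp_assoc[OF e.family_hom[OF that] d.family_hom[OF that] c.family_hom[OF that]] .
    then show ?thesis
      by (auto simp: f Tamb_simps intro!: restrict_ext)
  qed
qed

text \<open>
  \<open>tamb_val\<close> is the value \<open>P(l,r) \<circ> \<zeta>\<^sub>f\<close> that a functor extending \<open>(P,\<zeta>)\<close> is forced to take on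
  \<open>\<langle>l|r\<rangle>\<close>, since \<open>\<langle>l|r\<rangle> = \<langle>id|id\<rangle>\<^sub>f \<circ> \<iota>(l,r)\<close>.
\<close>

definition tamb_val ::
  "('do, 'dr) cat \<Rightarrow> ('a, 'f, 'lo, 'lr, 'ro, 'rr, 'do, 'dr) tamb_data \<Rightarrow>
   ('a, 'lo, 'ro) optic_obj \<Rightarrow> ('a, 'lo, 'ro) optic_obj \<Rightarrow> ('f, 'lr, 'rr) optic_rep \<Rightarrow> 'dr" where
  "tamb_val D P = (\<lambda>(A, X, X') (C, Y, Y') (f, l, r).
     FAr (Prof P A) (l, r) \<cdot>\<^bsub>D\<^esub> Str P f (Y, Y'))"

text \<open>The choice made by \<open>SOME\<close> is immaterial, since \<open>tamb_val\<close> is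
  constant on classes by \<open>tamb_val_class\<close>. An optic from \<open>S\<close> to
  \<open>T\<close> is sent to an arrow from the value at \<open>T\<close> to the value at
  \<open>S\<close>, so these data define a functor on the opposite category.\<close>

definition optic_functor ::
  "('a, 'f, 'm) bicat \<Rightarrow> ('a, 'f, 'm, 'lo, 'lr) indexed \<Rightarrow> ('a, 'f, 'm, 'ro, 'rr) indexed \<Rightarrow>
   ('do, 'dr) cat \<Rightarrow> ('a, 'f, 'lo, 'lr, 'ro, 'rr, 'do, 'dr) tamb_data \<Rightarrow>
   (('a, 'lo, 'ro) optic_obj, ('a, 'f, 'lo, 'lr, 'ro, 'rr) optic_arr, 'do, 'dr) fun_data" where
  "optic_functor B L R D P =
     \<lparr>FOb = (\<lambda>(A, X, X')\<in>Obj (Optic B L R). FOb (Prof P A) (X, X')),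
      FAr = (\<lambda>(S, T, c)\<in>Arr (Optic B L R). tamb_val D P S T (SOME t. t \<in> c))\<rparr>"

section \<open>The extension of a Tambara representation to optics\<close>

context tambara_representation
begin

text \<open>Functoriality of \<open>P\<close> splits off the action of \<open>m\<close> on
  \<open>L\<close> from one value and the action of \<open>m\<close> on \<open>R\<close> from the
  other. Both then begin with \<open>P\<close> at \<open>(l, r)\<close>, and the remaining factors
  agree by extranaturality.\<close>

lemma tamb_val_step:
  assumes "step S T t u" "T \<in> OptOb"
  shows "tamb_val D P S T t = tamb_val D P S T u"
  using assms(1)
proof cases
  case (1 f A C g m l X Y r Y' X')
  note A = left.base.hom1_zero(1)[OF 1(5)]
  have Y: "Y \<in> Obj (Fib L C)" "Y' \<in> Obj (Fib R C)"
    using assms(2) by (auto simp: 1 Optic_obj_iff)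
  have hom: "Act L m Y \<in> hom (Fib L A) (FOb (Pull L f) Y) (FOb (Pull L g) Y)"
    "Act R m Y' \<in> hom (Fib R A) (FOb (Pull R f) Y') (FOb (Pull R g) Y')"
    "Ide (Fib L A) (FOb (Pull L f) Y) \<in> hom (Fib L A) (FOb (Pull L f) Y) (FOb (Pull L f) Y)"
    "Ide (Fib R A) (FOb (Pull R g) Y') \<in> hom (Fib R A) (FOb (Pull R g) Y') (FOb (Pull R g) Y')"
    using 1(5-7) Y A by (simp_all add: hom_simps)
  have "FAr (Prof P A) (Act L m Y \<cdot>\<^bsub>Fib L A\<^esub> l, r) \<cdot>\<^bsub>D\<^esub> Str P g (Y, Y') =
      FAr (Prof P A) (l, r) \<cdot>\<^bsub>D\<^esub>
        (FAr (Prof P A) (Act L m Y, Ide (Fib R A) (FOb (Pull R g) Y')) \<cdot>\<^bsub>D\<^esub> Str P g (Y, Y'))"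
    using prof_cmp[OF A 1(8) hom(1) 1(9) hom(4)] 1(9) A
      target.cmp_assoc[OF str_hom[OF 1(6) Y] prof_hom[OF A hom(1,4)] prof_hom[OF A 1(8,9)]]
    by (simp add: hom_def)
  also have "\<dots> = FAr (Prof P A) (l, r \<cdot>\<^bsub>Fib R A\<^esub> Act R m Y') \<cdot>\<^bsub>D\<^esub> Str P f (Y, Y')"
    using prof_cmp[OF A 1(8) hom(3) 1(9) hom(2)] 1(8) A str_extranatural[OF 1(5-7) Y]
      target.cmp_assoc[OF str_hom[OF 1(5) Y] prof_hom[OF A hom(3,2)] prof_hom[OF A 1(8,9)]]
    by (simp add: hom_def)
  finally show ?thesis
    by (simp add: 1 tamb_val_def)
qed

text \<open>Equality is an equivalence relation, so invariance under the generating steps is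
  enough.\<close>

lemma tamb_val_class:
  assumes "u \<in> cls S T t" "T \<in> OptOb"
  shows "tamb_val D P S T u = tamb_val D P S T t"
proof -
  have "equivclp (step S T) t u" using assms(1) by (simp add: optic_class_def)
  then show ?thesis
    by (induction rule: equivclp_induct) (auto dest: tamb_val_step[OF _ assms(2)])
qed

lemma optic_functor_obj [simp]:
  assumes "(A, X, X') \<in> OptOb"
  shows "FOb (optic_functor B L R D P) (A, X, X') = FOb (Prof P A) (X, X')"
  using assms by (simp add: optic_functor_def)

lemma optic_functor_arr:
  assumes "(f, l, r) \<in> reps (A, X, X') (C, Y, Y')" "(A, X, X') \<in> OptOb" "(C, Y, Y') \<in> OptOb"
  shows "FAr (optic_functor B L R D P) (opt (A, X, X') (C, Y, Y') f l r) =
    FAr (Prof P A) (l, r) \<cdot>\<^bsub>D\<^esub> Str P f (Y, Y')"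
proof -
  let ?c = "cls (A, X, X') (C, Y, Y') (f, l, r)"
  have "(SOME t. t \<in> ?c) \<in> ?c" using in_class_self by (rule someI)
  then have "tamb_val D P (A, X, X') (C, Y, Y') (SOME t. t \<in> ?c) =
      tamb_val D P (A, X, X') (C, Y, Y') (f, l, r)"
    by (rule tamb_val_class[OF _ assms(3)])
  then show ?thesis
    using optic_arr[OF assms] unfolding optic_functor_def optic_def by (simp add: tamb_val_def)
qed

lemma optic_functor_hom:
  assumes "(f, l, r) \<in> reps (A, X, X') (C, Y, Y')" "(A, X, X') \<in> OptOb" "(C, Y, Y') \<in> OptOb"
  shows "FAr (optic_functor B L R D P) (opt (A, X, X') (C, Y, Y') f l r) \<in>
    hom D (FOb (Prof P C) (Y, Y')) (FOb (Prof P A) (X, X'))"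
  unfolding optic_functor_arr[OF assms] using assms
  by (intro target.cmp_hom[OF str_hom prof_hom]) (auto simp: reps_iff Optic_obj_iff)

lemma cat_functor_optic_functor:
  "cat_functor (op_cat (Optic B L R)) D (optic_functor B L R D P)"
proof (rule cat_functorI)
  let ?F = "optic_functor B L R D P"
  show "category (op_cat (Optic B L R))" by (intro category_op_cat category_Optic)
  show "category D" by unfold_locales
  show "FOb ?F \<in> extensional (Obj (op_cat (Optic B L R)))"
    "FAr ?F \<in> extensional (Arr (op_cat (Optic B L R)))"
    by (auto simp: optic_functor_def)
  show "FOb ?F S \<in> Obj D" if "S \<in> Obj (op_cat (Optic B L R))" for S
    using that by (cases S) (auto simp: Optic_obj_iff prof_obj)
  show "FAr ?F x \<in> Arr D \<and> Dom D (FAr ?F x) = FOb ?F (Dom (op_cat (Optic B L R)) x) \<and>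
      Cod D (FAr ?F x) = FOb ?F (Cod (op_cat (Optic B L R)) x)"
    if x: "x \<in> Arr (op_cat (Optic B L R))" for x
  proof -
    obtain A X X' C Y Y' f l r where *: "(A, X, X') \<in> OptOb" "(C, Y, Y') \<in> OptOb"
      "(f, l, r) \<in> reps (A, X, X') (C, Y, Y')" "x = opt (A, X, X') (C, Y, Y') f l r"
      using x by (auto elim!: Optic_arrE)
    show ?thesis
      using optic_functor_hom[OF *(3,1,2)] *(1,2) by (simp add: *(4) hom_def)
  qed
  show "FAr ?F (Ide (op_cat (Optic B L R)) S) = Ide D (FOb ?F S)" if S: "S \<in> Obj (op_cat (Optic B L R))" for S
  proof -
    obtain A X X' where S_eq: "S = (A, X, X')" by (cases S)
    have A: "A \<in> Zero B" "X \<in> Obj (Fib L A)" "X' \<in> Obj (Fib R A)"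
      using S by (auto simp: S_eq Optic_obj_iff)
    \<comment> \<open>The definition of the identity optic is wanted here, rather than its form as
      \<open>iota\<close> of identities: its halves are the arguments of \<open>P\<close> in
      \<open>str_unit\<close>.\<close>
    have "Ide (Optic B L R) S = opt S S (One B A) (ThId L A X) (id_inv R A X')"
      by (simp add: Optic_def S_eq)
    moreover have "(One B A, ThId L A X, id_inv R A X') \<in> reps S S"
      using A left.base.one_hom1 by (auto simp: S_eq reps_iff hom_def)
    ultimately show ?thesis
      using S str_unit[OF A] by (simp add: S_eq optic_functor_arr)
  qed
  show "FAr ?F (y \<cdot>\<^bsub>op_cat (Optic B L R)\<^esub> x) = FAr ?F y \<cdot>\<^bsub>D\<^esub> FAr ?F x"
    if y: "x \<in> Arr (op_cat (Optic B L R))" and x: "y \<in> Arr (op_cat (Optic B L R))"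
      and xy: "Cod (op_cat (Optic B L R)) x = Dom (op_cat (Optic B L R)) y" for x y
  proof -
    \<comment> \<open>\<open>y\<close> after \<open>x\<close> in the opposite category is
      \<open>x\<close> after \<open>y\<close> in \<open>Optic\<close>, so \<open>y\<close> is the
      optic that comes first. The fact named \<open>x\<close> types \<open>y\<close>, and the fact
      named \<open>y\<close> types \<open>x\<close>.\<close>
    obtain A X X' C Y Y' f l1 r1 where f: "(A, X, X') \<in> OptOb" "(C, Y, Y') \<in> OptOb"
      "(f, l1, r1) \<in> reps (A, X, X') (C, Y, Y')" "y = opt (A, X, X') (C, Y, Y') f l1 r1"
      using x by (auto elim!: Optic_arrE)
    then obtain E Z Z' g l2 r2 where g: "(E, Z, Z') \<in> OptOb"
      "(g, l2, r2) \<in> reps (C, Y, Y') (E, Z, Z')" "x = opt (C, Y, Y') (E, Z, Z') g l2 r2"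
      using y xy by (auto elim!: Optic_arrE)
    have f': "f \<in> hom1 B A C" "l1 \<in> hom (Fib L A) X (FOb (Pull L f) Y)"
        "r1 \<in> hom (Fib R A) (FOb (Pull R f) Y') X'"
      and g': "g \<in> hom1 B C E" "l2 \<in> hom (Fib L C) Y (FOb (Pull L g) Z)"
        "r2 \<in> hom (Fib R C) (FOb (Pull R g) Z') Y'"
      using f(3) g(2) by (auto simp: reps_iff)
    have obj: "A \<in> Zero B" "X \<in> Obj (Fib L A)" "X' \<in> Obj (Fib R A)"
      "C \<in> Zero B" "Y \<in> Obj (Fib L C)" "Y' \<in> Obj (Fib R C)"
      "E \<in> Zero B" "Z \<in> Obj (Fib L E)" "Z' \<in> Obj (Fib R E)"
      using f(1,2) g(1) by (auto simp: Optic_obj_iff)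
    let ?gf = "g \<star>\<^bsub>B\<^esub> f" and ?th = "ThCmp L f g Z" and ?th' = "cmp_inv R A f g Z'"
    let ?l = "?th \<cdot>\<^bsub>Fib L A\<^esub> (FAr (Pull L f) l2 \<cdot>\<^bsub>Fib L A\<^esub> l1)"
    let ?r = "r1 \<cdot>\<^bsub>Fib R A\<^esub> (FAr (Pull R f) r2 \<cdot>\<^bsub>Fib R A\<^esub> ?th')"
    have cmp: "rcmp (A, X, X') (E, Z, Z') (g, l2, r2) (f, l1, r1) = (?gf, ?l, ?r)"
      by (simp add: optic_rep_cmp_def)
    have gf: "?gf \<in> hom1 B A E" using f'(1) g'(1) left.base.hcmp_hom1 by blast
    have gZ: "FOb (Pull L g) Z \<in> Obj (Fib L C)" "FOb (Pull R g) Z' \<in> Obj (Fib R C)"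
      using g' obj by (auto simp: left.base.hom1_iff)
    have th: "?th \<in> hom (Fib L A) (FOb (Pull L f) (FOb (Pull L g) Z)) (FOb (Pull L ?gf) Z)"
      "?th' \<in> hom (Fib R A) (FOb (Pull R ?gf) Z') (FOb (Pull R f) (FOb (Pull R g) Z'))"
      using f' g' obj by (auto simp: hom_simps)
    have fl: "FAr (Pull L f) l2 \<in> hom (Fib L A) (FOb (Pull L f) Y) (FOb (Pull L f) (FOb (Pull L g) Z))"
      "FAr (Pull R f) r2 \<in> hom (Fib R A) (FOb (Pull R f) (FOb (Pull R g) Z')) (FOb (Pull R f) Y')"
      using f' g' by (auto simp: hom_simps)
    have fl1: "FAr (Pull L f) l2 \<cdot>\<^bsub>Fib L A\<^esub> l1 \<in> hom (Fib L A) X (FOb (Pull L f) (FOb (Pull L g) Z))"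
      "r1 \<cdot>\<^bsub>Fib R A\<^esub> FAr (Pull R f) r2 \<in> hom (Fib R A) (FOb (Pull R f) (FOb (Pull R g) Z')) X'"
      using fl f' obj by (auto simp: hom_def)
    \<comment> \<open>Rebracketing isolates the inverse of theta', so that \<open>P\<close> of the
      composite splits off one factor at theta and this inverse.\<close>
    have r: "?r = (r1 \<cdot>\<^bsub>Fib R A\<^esub> FAr (Pull R f) r2) \<cdot>\<^bsub>Fib R A\<^esub> ?th'"
      using fl f' th obj by (auto simp: hom_def right.fib_assoc)
    let ?P = "FAr (Prof P A)"
    note typing = prof_hom[OF obj(1) th] prof_hom[OF obj(1) fl] prof_hom[OF obj(1) f'(2,3)]
      prof_hom[OF obj(4) g'(2,3)] str_hom[OF gf obj(8,9)] str_hom[OF f'(1) gZ] str_hom[OF g'(1) obj(8,9)]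
      str_hom[OF f'(1) obj(5,6)]
    note simps = hom_def target.assoc
    have "FAr ?F (x \<cdot>\<^bsub>Optic B L R\<^esub> y) = ?P (?l, ?r) \<cdot>\<^bsub>D\<^esub> Str P ?gf (Z, Z')"
      unfolding f(4) g(3) optic_cmp[OF f(3) g(2) f(1,2) g(1) cmp]
      using rcmp_reps[OF f(3) g(2) f(1,2) g(1)] f g by (simp add: cmp optic_functor_arr)
    also have "\<dots> = (?P (l1, r1) \<cdot>\<^bsub>D\<^esub> ?P (FAr (Pull L f) l2, FAr (Pull R f) r2)) \<cdot>\<^bsub>D\<^esub>
        (?P (?th, ?th') \<cdot>\<^bsub>D\<^esub> Str P ?gf (Z, Z'))"
      unfolding r prof_cmp[OF obj(1) fl1(1) th(1) fl1(2) th(2)]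
        prof_cmp[OF obj(1) f'(2) fl(1) f'(3) fl(2)]
      using typing by (simp add: simps)
    \<comment> \<open>\<open>str_cmp\<close> trades the factor at theta and the structure map of the
      composite 1-cell for two structure maps.\<close>
    also have "\<dots> = ?P (l1, r1) \<cdot>\<^bsub>D\<^esub> ((?P (FAr (Pull L f) l2, FAr (Pull R f) r2) \<cdot>\<^bsub>D\<^esub>
        Str P f (FOb (Pull L g) Z, FOb (Pull R g) Z')) \<cdot>\<^bsub>D\<^esub> Str P g (Z, Z'))"
      unfolding str_cmp[OF f'(1) g'(1) obj(8,9)] using typing by (simp add: simps)
    \<comment> \<open>Naturality of the structure map of \<open>f\<close> moves \<open>l2\<close>
      and \<open>r2\<close> from the fibres over \<open>A\<close> back to those over
      \<open>C\<close>.\<close>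
    also have "\<dots> = (?P (l1, r1) \<cdot>\<^bsub>D\<^esub> Str P f (Y, Y')) \<cdot>\<^bsub>D\<^esub>
        (FAr (Prof P C) (l2, r2) \<cdot>\<^bsub>D\<^esub> Str P g (Z, Z'))"
      unfolding str_nat[OF f'(1) g'(2,3)] using typing by (simp add: simps)
    also have "\<dots> = FAr ?F y \<cdot>\<^bsub>D\<^esub> FAr ?F x"
      using f g by (simp add: optic_functor_arr)
    finally show ?thesis by simp
  qed
qed

end

section \<open>The isomorphism\<close>

lemma fun_data_eqI:
  assumes "cat_functor C D F" "cat_functor C D G"
    and "\<And>X. X \<in> Obj C \<Longrightarrow> FOb F X = FOb G X" "\<And>f. f \<in> Arr C \<Longrightarrow> FAr F f = FAr G f"
  shows "F = G"
proof -
  interpret F: cat_functor C D F by fact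
  interpret G: cat_functor C D G by fact
  have "FOb F = FOb G" "FAr F = FAr G"
    using F.FOb_ext G.FOb_ext F.FAr_ext G.FAr_ext assms(3,4) by (blast intro: extensionalityI)+
  then show ?thesis by (cases F; cases G) simp
qed

text \<open>\<open>Prof\<close>, \<open>Str\<close> and each member of \<open>Str\<close> are
  extensional, the last by being a natural transformation; hence comparison on well-typed arguments
  decides equality.\<close>

lemma tamb_data_eqI:
  assumes P: "tambara_representation B L R D P" and Q: "tambara_representation B L R D Q"
    and prof: "\<And>A. A \<in> Zero B \<Longrightarrow> Prof P A = Prof Q A"
    and str: "\<And>f A C Y Y'. f \<in> hom1 B A C \<Longrightarrow> Y \<in> Obj (Fib L C) \<Longrightarrow> Y' \<in> Obj (Fib R C) \<Longrightarrow>
      Str P f (Y, Y') = Str Q f (Y, Y')"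
  shows "P = Q"
proof -
  interpret P: tambara_representation B L R D P by fact
  interpret Q: tambara_representation B L R D Q by fact
  have "Prof P = Prof Q"
    using P.prof_ext Q.prof_ext prof by (rule extensionalityI)
  moreover have "Str P = Str Q"
  proof (rule extensionalityI[OF P.str_ext Q.str_ext], rule extensionalityI)
    fix f assume "f \<in> Obj (Vert B)"
    then have f: "f \<in> hom1 B (Src B f) (Trg B f)" by (simp add: P.left.base.hom1_iff)
    show "Str P f \<in> extensional (Obj (prof_cat L R (Trg B f)))"
      "Str Q f \<in> extensional (Obj (prof_cat L R (Trg B f)))"
      using nat_trans.comp_ext[OF P.str_nat_trans[OF f]] nat_trans.comp_ext[OF Q.str_nat_trans[OF f]] .
    show "Str P f Z = Str Q f Z" if "Z \<in> Obj (prof_cat L R (Trg B f))" for Z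
      using that str[OF f] by (cases Z) simp
  qed
  ultimately show ?thesis by (cases P; cases Q) simp
qed

lemma (in optics) Str_iota_hom:
  assumes f: "f \<in> hom1 B A C" and Y: "Y \<in> Obj (Fib L C)" "Y' \<in> Obj (Fib R C)"
  shows "Str (iota_op B L R) f (Y, Y') \<in>
    hom (Optic B L R) (A, FOb (Pull L f) Y, FOb (Pull R f) Y') (C, Y, Y')"
  unfolding Str_iota_op[OF assms] using f Y left.base.hom1_zero[OF f]
  by (intro optic_hom Str_iota_reps) (auto simp: Optic_obj_iff left.base.hom1_iff)

text \<open>At \<open>iota\<close> of \<open>(u, v)\<close> the extension yields \<open>P\<close> at
  \<open>(u, v)\<close> composed with \<open>P\<close> at theta and its inverse counterpart and the
  structure map of the identity 1-cell; the unit law cancels the last two. At a structure map of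
  \<open>iota_op\<close> it yields \<open>P\<close> at identities composed with the structure map of
  \<open>P\<close> itself.\<close>

lemma (in tambara_representation) tamb_comp_optic_functor:
  "tamb_comp B L R (optic_functor B L R D P) (iota_op B L R) = P"
proof (rule tamb_data_eqI)
  let ?F = "optic_functor B L R D P"
  show rep: "tambara_representation B L R D (tamb_comp B L R ?F (iota_op B L R))"
    by (rule tambara_comp[OF tambara_iota_op cat_functor_optic_functor])
  show "tambara_representation B L R D P" by unfold_locales
  show "Prof (tamb_comp B L R ?F (iota_op B L R)) A = Prof P A" if A: "A \<in> Zero B" for A
  proof (rule fun_data_eqI)
    show "cat_functor (prof_cat L R A) D (Prof (tamb_comp B L R ?F (iota_op B L R)) A)"
      by (rule tambara_representation.prof_functor[OF rep A])
    show "cat_functor (prof_cat L R A) D (Prof P A)" by (rule prof_functor[OF A])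
    show "FOb (Prof (tamb_comp B L R ?F (iota_op B L R)) A) Z = FOb (Prof P A) Z"
      if "Z \<in> Obj (prof_cat L R A)" for Z
      using that A by (auto simp: Prof_iota_op Optic_obj_iff)
    show "FAr (Prof (tamb_comp B L R ?F (iota_op B L R)) A) w = FAr (Prof P A) w"
      if w: "w \<in> Arr (prof_cat L R A)" for w
    proof -
      obtain u v where w_eq: "w = (u, v)" by (cases w)
      \<comment> \<open>The ends of \<open>v\<close> are named against those of \<open>u\<close>, as
        for the two halves of an optic.\<close>
      define X Y Y' X' where "X = Dom (Fib L A) u" "Y = Cod (Fib L A) u"
        "Y' = Dom (Fib R A) v" "X' = Cod (Fib R A) v"
      then have u: "u \<in> hom (Fib L A) X Y" and v: "v \<in> hom (Fib R A) Y' X'"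
        using w by (auto simp: w_eq hom_def)
      note obj = left.fib_obj[OF u A] right.fib_obj[OF v A]
      note one = left.base.one_hom1[OF A]
      have th: "ThId L A Y \<in> hom (Fib L A) Y (FOb (Pull L (One B A)) Y)"
        "id_inv R A Y' \<in> hom (Fib R A) (FOb (Pull R (One B A)) Y') Y'"
        using A obj by (simp_all add: hom_def)
      have "FAr ?F (FAr (iota B L R A) (u, v)) = FAr (Prof P A)
          (ThId L A Y \<cdot>\<^bsub>Fib L A\<^esub> u, v \<cdot>\<^bsub>Fib R A\<^esub> id_inv R A Y') \<cdot>\<^bsub>D\<^esub> Str P (One B A) (Y, Y')"
        unfolding iota_arr[OF u v] using iota_reps[OF A u v] A obj
        by (intro optic_functor_arr) (auto simp: Optic_obj_iff)
      also have "\<dots> = FAr (Prof P A) (u, v) \<cdot>\<^bsub>D\<^esub>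
          (FAr (Prof P A) (ThId L A Y, id_inv R A Y') \<cdot>\<^bsub>D\<^esub> Str P (One B A) (Y, Y'))"
        unfolding prof_cmp[OF A u th(1) v th(2)]
        by (rule target.cmp_assoc[OF str_hom[OF one obj(2,3)] prof_hom[OF A th] prof_hom[OF A u v]])
      also have "\<dots> = FAr (Prof P A) (u, v)"
        unfolding str_unit[OF A obj(2,3)] by (rule target.ide_right[OF prof_hom[OF A u v]])
      finally show ?thesis
        using w A by (simp add: w_eq Prof_iota_op)
    qed
  qed
  show "Str (tamb_comp B L R ?F (iota_op B L R)) f (Y, Y') = Str P f (Y, Y')"
    if f: "f \<in> hom1 B A C" and Y: "Y \<in> Obj (Fib L C)" "Y' \<in> Obj (Fib R C)" for f A C Y Y'
  proof -
    note AC = left.base.hom1_zero[OF f]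
    have fY: "FOb (Pull L f) Y \<in> Obj (Fib L A)" "FOb (Pull R f) Y' \<in> Obj (Fib R A)"
      using f Y by (auto simp: left.base.hom1_iff)
    have "FAr ?F (Str (iota_op B L R) f (Y, Y')) = FAr (Prof P A)
        (Ide (Fib L A) (FOb (Pull L f) Y), Ide (Fib R A) (FOb (Pull R f) Y')) \<cdot>\<^bsub>D\<^esub> Str P f (Y, Y')"
      unfolding Str_iota_op[OF f Y] using Str_iota_reps[OF f Y] AC fY Y
      by (intro optic_functor_arr) (auto simp: Optic_obj_iff)
    also have "\<dots> = Str P f (Y, Y')"
      unfolding prof_ide[OF AC(1) fY] by (rule target.ide_left[OF str_hom[OF f Y]])
    finally show ?thesis
      using Y by (simp add: Str_tamb_comp[OF f])
  qed
qed

section \<open>Injectivity on functors, and the passage between transformations and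
  morphisms\<close>

context optics
begin

text \<open>Every object of \<open>Optic\<close> is a value of \<open>iota\<close>. On arrows,
  equality of the \<open>Prof\<close> parts settles the factors in the image of \<open>iota\<close>,
  and equality of the \<open>Str\<close> parts settles the factors with identity halves.\<close>

lemma tamb_comp_inj:
  assumes F: "cat_functor (op_cat (Optic B L R)) D F" and G: "cat_functor (op_cat (Optic B L R)) D G"
    and eq: "tamb_comp B L R F (iota_op B L R) = tamb_comp B L R G (iota_op B L R)"
  shows "F = G"
proof (rule fun_data_eqI[OF F G])
  interpret F: cat_functor "op_cat (Optic B L R)" D F by fact
  interpret G: cat_functor "op_cat (Optic B L R)" D G by fact
  have prof: "comp_functor (prof_cat L R A) F (iota B L R A) = comp_functor (prof_cat L R A) G (iota B L R A)"
    if "A \<in> Zero B" for A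
    using arg_cong[OF eq, of "\<lambda>P. Prof P A"] that by (simp add: Prof_iota_op)
  show "FOb F S = FOb G S" if "S \<in> Obj (op_cat (Optic B L R))" for S
  proof -
    obtain A X X' where "S = (A, X, X')" by (cases S)
    then show ?thesis
      using that arg_cong[OF prof, of A "\<lambda>H. FOb H (X, X')"] by (auto simp: Optic_obj_iff)
  qed
  show "FAr F x = FAr G x" if x: "x \<in> Arr (op_cat (Optic B L R))" for x
  proof -
    obtain A X X' C Y Y' f l r where *: "(A, X, X') \<in> OptOb" "(C, Y, Y') \<in> OptOb"
      "(f, l, r) \<in> reps (A, X, X') (C, Y, Y')" "x = opt (A, X, X') (C, Y, Y') f l r"
      using x by (auto elim!: Optic_arrE)
    then have obj: "A \<in> Zero B" "Y \<in> Obj (Fib L C)" "Y' \<in> Obj (Fib R C)"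
      and f: "f \<in> hom1 B A C" and l: "l \<in> hom (Fib L A) X (FOb (Pull L f) Y)"
      and r: "r \<in> hom (Fib R A) (FOb (Pull R f) Y') X'"
      by (auto simp: Optic_obj_iff reps_iff)
    let ?s = "Str (iota_op B L R) f (Y, Y')" and ?i = "FAr (iota B L R A) (l, r)"
    have x_eq: "x = ?i \<cdot>\<^bsub>op_cat (Optic B L R)\<^esub> ?s"
      using optic_decomp[OF f obj(2,3) l r] *(4) by simp
    have s: "?s \<in> hom (op_cat (Optic B L R)) (C, Y, Y') (A, FOb (Pull L f) Y, FOb (Pull R f) Y')"
      using Str_iota_hom[OF f obj(2,3)] by simp
    have i: "?i \<in> hom (op_cat (Optic B L R)) (A, FOb (Pull L f) Y, FOb (Pull R f) Y') (A, X, X')"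
      using iota_hom[OF obj(1) l r] by simp
    have "FAr F ?s = FAr G ?s"
      using arg_cong[OF eq, of "\<lambda>P. Str P f (Y, Y')"] obj by (simp add: Str_tamb_comp[OF f])
    moreover have "FAr F ?i = FAr G ?i"
      using arg_cong[OF prof[OF obj(1)], of "\<lambda>H. FAr H (l, r)"] l r by (simp add: hom_def)
    ultimately show ?thesis
      by (simp only: x_eq F.FAr_cmp[OF s i] G.FAr_cmp[OF s i])
  qed
qed

text \<open>Both conditions on a morphism are naturality of \<open>t\<close> at optics of two
  special kinds: images under \<open>iota\<close>, and the structure maps of
  \<open>iota_op\<close>.\<close>

lemma tambara_morphism_comp:
  assumes "nat_trans (op_cat (Optic B L R)) D F G t"
  shows "tambara_morphism B L R D (tamb_comp B L R F (iota_op B L R)) (tamb_comp B L R G (iota_op B L R))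
    (\<lambda>A\<in>Zero B. \<lambda>Z\<in>Obj (prof_cat L R A). t (FOb (iota B L R A) Z))"
proof -
  interpret nat_trans "op_cat (Optic B L R)" D F G t by fact
  show ?thesis
  proof (rule tambara_morphismI)
    show P: "tambara_representation B L R D (tamb_comp B L R F (iota_op B L R))"
      by (rule tambara_comp[OF tambara_iota_op source.cat_functor_axioms])
    show Q: "tambara_representation B L R D (tamb_comp B L R G (iota_op B L R))"
      by (rule tambara_comp[OF tambara_iota_op target.cat_functor_axioms])
    show "nat_trans (prof_cat L R A) D (Prof (tamb_comp B L R F (iota_op B L R)) A)
        (Prof (tamb_comp B L R G (iota_op B L R)) A)
        ((\<lambda>A\<in>Zero B. \<lambda>Z\<in>Obj (prof_cat L R A). t (FOb (iota B L R A) Z)) A)" if A: "A \<in> Zero B" for A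
    proof (rule nat_transI)
      interpret I: cat_functor "prof_cat L R A" "op_cat (Optic B L R)" "iota B L R A"
        by (rule iota_functor[OF A])
      show "cat_functor (prof_cat L R A) D (Prof (tamb_comp B L R F (iota_op B L R)) A)"
        "cat_functor (prof_cat L R A) D (Prof (tamb_comp B L R G (iota_op B L R)) A)"
        using tambara_representation.prof_functor[OF _ A] P Q by blast+
      show "((\<lambda>A\<in>Zero B. \<lambda>Z\<in>Obj (prof_cat L R A). t (FOb (iota B L R A) Z)) A Z) \<in> Arr D \<and>
          Dom D ((\<lambda>A\<in>Zero B. \<lambda>Z\<in>Obj (prof_cat L R A). t (FOb (iota B L R A) Z)) A Z) =
            FOb (Prof (tamb_comp B L R F (iota_op B L R)) A) Z \<and>
          Cod D ((\<lambda>A\<in>Zero B. \<lambda>Z\<in>Obj (prof_cat L R A). t (FOb (iota B L R A) Z)) A Z) =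
            FOb (Prof (tamb_comp B L R G (iota_op B L R)) A) Z"
        if "Z \<in> Obj (prof_cat L R A)" for Z
        using trans_arr[OF I.FOb_obj[OF that]] that A by (simp add: Prof_iota_op del: prod_cat_simps(1))
      show "FAr (Prof (tamb_comp B L R G (iota_op B L R)) A) w \<cdot>\<^bsub>D\<^esub>
          (\<lambda>A\<in>Zero B. \<lambda>Z\<in>Obj (prof_cat L R A). t (FOb (iota B L R A) Z)) A (Dom (prof_cat L R A) w) =
          (\<lambda>A\<in>Zero B. \<lambda>Z\<in>Obj (prof_cat L R A). t (FOb (iota B L R A) Z)) A (Cod (prof_cat L R A) w) \<cdot>\<^bsub>D\<^esub>
          FAr (Prof (tamb_comp B L R F (iota_op B L R)) A) w"
        if w: "w \<in> Arr (prof_cat L R A)" for w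
        using natural[OF I.fun_arr(1)[OF w]] I.fun_arr[OF w] I.source.dom_obj[OF w] I.source.cod_obj[OF w] w A
        by (simp add: Prof_iota_op del: prod_cat_simps op_cat_simps)
    qed (use A in auto)
    show "(\<lambda>A\<in>Zero B. \<lambda>Z\<in>Obj (prof_cat L R A). t (FOb (iota B L R A) Z)) A
          (FOb (Pull L f) Y, FOb (Pull R f) Y') \<cdot>\<^bsub>D\<^esub> Str (tamb_comp B L R F (iota_op B L R)) f (Y, Y') =
        Str (tamb_comp B L R G (iota_op B L R)) f (Y, Y') \<cdot>\<^bsub>D\<^esub>
          (\<lambda>A\<in>Zero B. \<lambda>Z\<in>Obj (prof_cat L R A). t (FOb (iota B L R A) Z)) C (Y, Y')"
      if f: "f \<in> hom1 B A C" and Y: "Y \<in> Obj (Fib L C)" "Y' \<in> Obj (Fib R C)" for f A C Y Y'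
    proof -
      note AC = left.base.hom1_zero[OF f]
      have fY: "FOb (Pull L f) Y \<in> Obj (Fib L A)" "FOb (Pull R f) Y' \<in> Obj (Fib R A)"
        using f Y by (auto simp: left.base.hom1_iff)
      show ?thesis
        using naturality[of "Str (iota_op B L R) f (Y, Y')"] Str_iota_hom[OF f Y] AC Y fY
        by (simp add: Str_tamb_comp[OF f])
    qed
  qed auto
qed

end

text \<open>The square at an optic is pasted from the square of \<open>e\<close> at the structure
  map of \<open>f\<close> and the naturality square of \<open>e A\<close> at \<open>(l, r)\<close>.
  An object \<open>(A, X, X')\<close> is the pair of \<open>A\<close> and \<open>(X, X')\<close>, so
  its component is read directly off \<open>e A\<close>.\<close>

lemma (in tambara_morphism) nat_trans_optic_functor:
  "nat_trans (op_cat (Optic B L R)) D (optic_functor B L R D P) (optic_functor B L R D Q)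
    (\<lambda>(A, Z)\<in>Obj (Optic B L R). e A Z)"
proof (rule nat_transI)
  let ?F = "optic_functor B L R D P" and ?G = "optic_functor B L R D Q"
    and ?t = "\<lambda>(A, Z)\<in>Obj (Optic B L R). e A Z"
  show "cat_functor (op_cat (Optic B L R)) D ?F" "cat_functor (op_cat (Optic B L R)) D ?G"
    by (rule source.cat_functor_optic_functor target.cat_functor_optic_functor)+
  show "?t \<in> extensional (Obj (op_cat (Optic B L R)))" by simp
  show "?t S \<in> Arr D \<and> Dom D (?t S) = FOb ?F S \<and> Cod D (?t S) = FOb ?G S"
    if S: "S \<in> Obj (op_cat (Optic B L R))" for S
  proof -
    obtain A X X' where "S = (A, X, X')" by (cases S)
    then show ?thesis
      using S family_hom[of A X X'] source.Optic_obj_iff by (auto simp: hom_def)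
  qed
  show "FAr ?G x \<cdot>\<^bsub>D\<^esub> ?t (Dom (op_cat (Optic B L R)) x) = ?t (Cod (op_cat (Optic B L R)) x) \<cdot>\<^bsub>D\<^esub> FAr ?F x"
    if x: "x \<in> Arr (op_cat (Optic B L R))" for x
  proof -
    obtain A X X' C Y Y' f l r where *: "(A, X, X') \<in> Obj (Optic B L R)" "(C, Y, Y') \<in> Obj (Optic B L R)"
      "(f, l, r) \<in> optic_reps B L R (A, X, X') (C, Y, Y')" "x = optic B L R (A, X, X') (C, Y, Y') f l r"
      using x by (auto elim!: source.Optic_arrE)
    then have obj: "A \<in> Zero B" "C \<in> Zero B" "Y \<in> Obj (Fib L C)" "Y' \<in> Obj (Fib R C)"
      and f: "f \<in> hom1 B A C" and l: "l \<in> hom (Fib L A) X (FOb (Pull L f) Y)"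
      and r: "r \<in> hom (Fib R A) (FOb (Pull R f) Y') X'"
      by (auto simp: source.Optic_obj_iff source.reps_iff)
    have X: "X \<in> Obj (Fib L A)" "X' \<in> Obj (Fib R A)"
      using *(1) by (auto simp: source.Optic_obj_iff)
    have fY: "FOb (Pull L f) Y \<in> Obj (Fib L A)" "FOb (Pull R f) Y' \<in> Obj (Fib R A)"
      using f obj by (auto simp: source.left.base.hom1_iff)
    let ?fY = "(FOb (Pull L f) Y, FOb (Pull R f) Y')"
    note typing = family_hom[OF obj(2-4)] family_hom[OF obj(1) fY] family_hom[OF obj(1) X]
      source.str_hom[OF f obj(3,4)] target.str_hom[OF f obj(3,4)]
      source.prof_hom[OF obj(1) l r] target.prof_hom[OF obj(1) l r]
    note simps = hom_def source.target.assoc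
    have "(FAr (Prof Q A) (l, r) \<cdot>\<^bsub>D\<^esub> Str Q f (Y, Y')) \<cdot>\<^bsub>D\<^esub> e C (Y, Y') =
        FAr (Prof Q A) (l, r) \<cdot>\<^bsub>D\<^esub> (Str Q f (Y, Y') \<cdot>\<^bsub>D\<^esub> e C (Y, Y'))"
      using typing by (simp add: simps)
    also have "\<dots> = (FAr (Prof Q A) (l, r) \<cdot>\<^bsub>D\<^esub> e A ?fY) \<cdot>\<^bsub>D\<^esub> Str P f (Y, Y')"
      unfolding family_str[OF f obj(3,4), symmetric] using typing by (simp add: simps)
    also have "\<dots> = e A (X, X') \<cdot>\<^bsub>D\<^esub> (FAr (Prof P A) (l, r) \<cdot>\<^bsub>D\<^esub> Str P f (Y, Y'))"
      unfolding family_nat[OF obj(1) l r] using typing by (simp add: simps)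
    finally show ?thesis
      using * by (simp add: source.optic_functor_arr target.optic_functor_arr)
  qed
qed

text \<open>Identities and composites are formed componentwise on both sides, so the functor laws
  amount to equalities of functions restricted to the same sets.\<close>

lemma (in optics) comp_iota_op_functor:
  assumes "category D"
  shows "cat_functor (functor_category (op_cat (Optic B L R)) D) (Tamb B L R D) (comp_iota_op B L R D)"
proof (rule cat_functorI)
  let ?V = "functor_category (op_cat (Optic B L R)) D" and ?T = "Tamb B L R D" and ?K = "comp_iota_op B L R D"
  show "category ?V" "category ?T" by (rule category_functor_category category_Tamb)+
  show "FOb ?K \<in> extensional (Obj ?V)" "FAr ?K \<in> extensional (Arr ?V)"
    by (auto simp: comp_iota_op_def)
  show "FOb ?K F \<in> Obj ?T" if "F \<in> Obj ?V" for F
    using that tambara_comp[OF tambara_iota_op]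
    by (simp add: comp_iota_op_def functor_category_simps Tamb_simps)
  show "FAr ?K x \<in> Arr ?T \<and> Dom ?T (FAr ?K x) = FOb ?K (Dom ?V x) \<and> Cod ?T (FAr ?K x) = FOb ?K (Cod ?V x)"
    if "x \<in> Arr ?V" for x
    using that tambara_morphism_comp
    by (auto simp: comp_iota_op_def functor_category_simps Tamb_simps nat_trans_def simp del: prod_cat_simps)
  show "FAr ?K (Ide ?V F) = Ide ?T (FOb ?K F)" if "F \<in> Obj ?V" for F
    using that nat_trans_ide[of "op_cat (Optic B L R)" D F]
    by (auto simp: comp_iota_op_def functor_category_simps Tamb_simps Prof_iota_op Optic_obj_iff
        intro!: restrict_ext)
  show "FAr ?K (y \<cdot>\<^bsub>?V\<^esub> x) = FAr ?K y \<cdot>\<^bsub>?T\<^esub> FAr ?K x"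
    if "x \<in> Arr ?V" "y \<in> Arr ?V" "Cod ?V x = Dom ?V y" for x y
    using that
    by (auto simp: comp_iota_op_def functor_category_simps Tamb_simps Optic_obj_iff
        intro!: restrict_ext dest: nat_trans_cmp)
qed

theorem theorem2:
  fixes B :: "('a, 'f, 'm) bicat"
    and L :: "('a, 'f, 'm, 'lo, 'lr) indexed"
    and R :: "('a, 'f, 'm, 'ro, 'rr) indexed"
    and D :: "('do, 'dr) cat"
  assumes "bicategory B"
    and "indexed_category B L"
    and "indexed_category B R"
    and "category D"
  shows "isomorphism_of_categories
           (functor_category (op_cat (Optic B L R)) D)
           (Tamb B L R D)
           (comp_iota_op B L R D)"
proof (rule isomorphism_of_categoriesI)
  interpret optics B L R
    using assms by (simp add: optics_def)
  let ?O = "op_cat (Optic B L R)"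
  let ?V = "functor_category ?O D" and ?T = "Tamb B L R D" and ?K = "comp_iota_op B L R D"
  show K: "cat_functor ?V ?T ?K"
    by (rule comp_iota_op_functor[OF assms(4)])
  interpret K: cat_functor ?V ?T ?K by (rule K)
  have K_ob: "FOb ?K F = tamb_comp B L R F (iota_op B L R)" if "cat_functor ?O D F" for F
    using that by (simp add: comp_iota_op_def functor_category_simps)
  have K_ar: "FAr ?K (F, G, t) = (tamb_comp B L R F (iota_op B L R), tamb_comp B L R G (iota_op B L R),
      \<lambda>A\<in>Zero B. \<lambda>Z\<in>Obj (prof_cat L R A). t (FOb (iota B L R A) Z))" if "nat_trans ?O D F G t" for F G t
    using that by (simp add: comp_iota_op_def functor_category_simps)
  \<comment> \<open>The preimage of a representation is its extension to optics.\<close>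
  have inverse: "cat_functor ?O D (optic_functor B L R D P)"
    "tamb_comp B L R (optic_functor B L R D P) (iota_op B L R) = P"
    if "tambara_representation B L R D P" for P
    using tambara_representation.cat_functor_optic_functor[OF that]
      tambara_representation.tamb_comp_optic_functor[OF that] .
  show "bij_betw (FOb ?K) (Obj ?V) (Obj ?T)"
  proof (rule bij_betwI')
    show "FOb ?K F = FOb ?K G \<longleftrightarrow> F = G" if "F \<in> Obj ?V" "G \<in> Obj ?V" for F G
      using that tamb_comp_inj[of D F G] by (auto simp: functor_category_simps K_ob)
    show "\<exists>F\<in>Obj ?V. P = FOb ?K F" if "P \<in> Obj ?T" for P
      using that inverse[of P] by (auto simp: functor_category_simps Tamb_simps K_ob
          intro!: bexI[of _ "optic_functor B L R D P"])
  qed simp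
  show "bij_betw (FAr ?K) (Arr ?V) (Arr ?T)"
  proof (rule bij_betwI')
    show "FAr ?K x = FAr ?K y \<longleftrightarrow> x = y" if x: "x \<in> Arr ?V" and y: "y \<in> Arr ?V" for x y
    proof
      obtain F G t where x_eq: "x = (F, G, t)" and t: "nat_trans ?O D F G t"
        using x by (auto simp: functor_category_simps)
      obtain F' G' t' where y_eq: "y = (F', G', t')" and t': "nat_trans ?O D F' G' t'"
        using y by (auto simp: functor_category_simps)
      interpret t: nat_trans ?O D F G t by fact
      interpret t': nat_trans ?O D F' G' t' by fact
      assume eq: "FAr ?K x = FAr ?K y"
      \<comment> \<open>An arrow carries its source and target, so these are recovered first, by
        injectivity on functors.\<close>
      have FG: "F = F'" "G = G'"
        using eq tamb_comp_inj t.source.cat_functor_axioms t'.source.cat_functor_axioms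
          t.target.cat_functor_axioms t'.target.cat_functor_axioms
        by (auto simp: x_eq y_eq K_ar[OF t] K_ar[OF t'])
      have "t = t'"
      proof (rule extensionalityI[OF t.comp_ext t'.comp_ext])
        fix S assume S: "S \<in> Obj ?O"
        obtain A X X' where S_eq: "S = (A, X, X')" by (cases S)
        \<comment> \<open>The component at \<open>(A, X, X')\<close> is found in the family at
          \<open>A\<close> and \<open>(X, X')\<close>, which \<open>iota\<close> sends to that
          object.\<close>
        have "(\<lambda>A\<in>Zero B. \<lambda>Z\<in>Obj (prof_cat L R A). t (FOb (iota B L R A) Z)) A (X, X') =
          (\<lambda>A\<in>Zero B. \<lambda>Z\<in>Obj (prof_cat L R A). t' (FOb (iota B L R A) Z)) A (X, X')"
          using eq by (simp only: x_eq y_eq K_ar[OF t] K_ar[OF t'] prod.inject)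
        then show "t S = t' S"
          using S by (simp add: S_eq Optic_obj_iff)
      qed
      then show "x = y" by (simp add: x_eq y_eq FG)
    qed simp
    show "\<exists>x\<in>Arr ?V. y = FAr ?K x" if y: "y \<in> Arr ?T" for y
    proof -
      obtain P Q e where y_eq: "y = (P, Q, e)" and e: "tambara_morphism B L R D P Q e"
        using y by (auto simp: Tamb_simps)
      interpret e: tambara_morphism B L R D P Q e by fact
      \<comment> \<open>The preimage of \<open>e\<close> has the same components, indexed by the
        objects of \<open>Optic\<close>; reindexing along \<open>iota\<close> gives back
        \<open>e\<close>.\<close>
      let ?t = "\<lambda>(A, Z)\<in>Obj (Optic B L R). e A Z"
      have "(\<lambda>A\<in>Zero B. \<lambda>Z\<in>Obj (prof_cat L R A). ?t (FOb (iota B L R A) Z)) = e"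
      proof (rule family_eqI[where I = "Zero B" and S = "\<lambda>A. Obj (prof_cat L R A)"])
        show "(\<lambda>A\<in>Zero B. \<lambda>Z\<in>Obj (prof_cat L R A). ?t (FOb (iota B L R A) Z)) A Z = e A Z"
          if "A \<in> Zero B" "Z \<in> Obj (prof_cat L R A)" for A Z
          using that by (cases Z) (auto simp: Optic_obj_iff)
      qed (use e.family_ext e.family_component_ext in auto)
      then have "y = FAr ?K (optic_functor B L R D P, optic_functor B L R D Q, ?t)"
        using e.source.tamb_comp_optic_functor e.target.tamb_comp_optic_functor
        by (simp add: y_eq K_ar[OF e.nat_trans_optic_functor])
      then show ?thesis
        using e.nat_trans_optic_functor by (auto simp: functor_category_simps)
    qed
  qed simp
qed

end
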